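(* Let $\mathcal M$ be a finite-dimensional von Neumann algebra with faithful trace $\tau$, let $\mathcal N\subset\mathcal M$ be a von Neumann subalgebra, and let $\rho,\sigma$ be faithful states. Let $s\in(-1,0)\cup(0,1)$, $Q_s(\rho\|\sigma)=\tau(\rho^{1-s}\sigma^s)$ and $Q_{x^{-1}}(\rho\|\sigma)=\tau(\rho^2\sigma^{-1})$. Then for all $t\in\mathbb R$ and $\varepsilon\in(0,(1-|s|)/2)$, \begin{align*} |Q_s(\rho\|\sigma)-Q_s(\rho_{\mathcal N}\|\sigma_{\mathcal N})|&\ge\left(K\,\frac{\pi}{2}\|\rho-R_\sigma(\rho_{\mathcal N})\|_1\right)^{\frac{1}{\frac{1-|s|}{2}-\varepsilon}},\\ |Q_s(\rho\|\sigma)-Q_s(\rho_{\mathcal N}\|\sigma_{\mathcal N})|&\ge\left(K\,\frac{\pi}{2\cosh(\pi t)}\|\rho-R^t_\sigma(\rho_{\mathcal N})\|_1\right)^{\frac{1}{\frac{1-|s|}{2}-\varepsilon}},\\ |Q_s(\rho\|\sigma)-Q_s(\rho_{\mathcal N}\|\sigma_{\mathcal N})|&\ge\left(K\,\|\rho-R^u_\sigma(\rho_{\mathcal N})\|_1\right)^{\frac{1}{\frac{1-|s|}{2}-\varepsilon}}, \end{align*} where $K=K(s,Q_{x^{-1}}(\rho\|\sigma),\varepsilon)=\left(4Q_{x^{-1}}(\rho\|\sigma)^{1/2}+\left(\frac{\pi}{e\varepsilon\sin(\pi|s|)}\right)^{1/2}+4\right)^{-1}$.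
   Context: $\mathcal M$ is a finite-dimensional von Neumann algebra with faithful trace $\tau$; $\mathcal N\subset\mathcal M$ is a von Neumann subalgebra containing the identity, and $E:\mathcal M\to\mathcal N$ is the trace-preserving conditional expectation. A state is a density operator $\rho\ge0$ with $\tau(\rho)=1$; faithful means invertible. $\rho_{\mathcal N}:=E(\rho)$, $\sigma_{\mathcal N}:=E(\sigma)$. $\|x\|_1=\tau(|x|)$. For faithful $\sigma$ and $t\in\mathbb R$, $R^t_\sigma(x)=\sigma^{\frac12-it}\sigma_{\mathcal N}^{-\frac12+it}\,x\,\sigma_{\mathcal N}^{-\frac12-it}\sigma^{\frac12+it}$ for $x\in\mathcal N$; $R_\sigma:=R^0_\sigma$; $R^u_\sigma(x)=\int_{\mathbb R}R_\sigma^{t/2}(x)\,d\beta(t)$ with $d\beta(t)=\frac{\pi}{2}(\cosh(\pi t)+1)^{-1}dt$. *)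

theory Defs
  imports "HOL-Analysis.Analysis"
begin

text \<open>Finite-dimensional von Neumann algebras are modelled as unital *-subalgebras
of the full matrix algebra of complex n x n matrices (n given by a finite type 'n).\<close>

type_synonym 'n cmat = "complex^'n^'n"

definition cadj :: "'n::finite cmat \<Rightarrow> 'n cmat" where
  "cadj A = (\<chi> i j. cnj (A $ j $ i))"

definition cscale :: "complex \<Rightarrow> 'n::finite cmat \<Rightarrow> 'n cmat" where
  "cscale c A = (\<chi> i j. c * A $ i $ j)"

definition diagm :: "('n::finite \<Rightarrow> complex) \<Rightarrow> 'n cmat" where
  "diagm d = (\<chi> i j. if i = j then d i else 0)"

definition unitary :: "'n::finite cmat \<Rightarrow> bool" where
  "unitary U \<longleftrightarrow> U ** cadj U = mat 1 \<and> cadj U ** U = mat 1"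

definition hermitian :: "'n::finite cmat \<Rightarrow> bool" where
  "hermitian A \<longleftrightarrow> cadj A = A"

definition mfun :: "(complex \<Rightarrow> complex) \<Rightarrow> 'n::finite cmat \<Rightarrow> 'n cmat" where
  "mfun f A = (let (U, d) = (SOME (U, d). unitary U \<and> A = U ** diagm d ** cadj U)
               in U ** diagm (f \<circ> d) ** cadj U)"

definition mpow :: "'n::finite cmat \<Rightarrow> complex \<Rightarrow> 'n cmat" where
  "mpow A z = mfun (\<lambda>x. x powr z) A"

definition mabs :: "'n::finite cmat \<Rightarrow> 'n cmat" where
  "mabs X = mfun csqrt (cadj X ** X)"

definition pos_op :: "'n::finite cmat \<Rightarrow> bool" where
  "pos_op A \<longleftrightarrow> (\<exists>B. A = cadj B ** B)"

definition star_subalg :: "'n::finite cmat set \<Rightarrow> bool" where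
  "star_subalg M \<longleftrightarrow> mat 1 \<in> M \<and>
     (\<forall>x\<in>M. \<forall>y\<in>M. x + y \<in> M \<and> x ** y \<in> M) \<and>
     (\<forall>c. \<forall>x\<in>M. cscale c x \<in> M) \<and> (\<forall>x\<in>M. cadj x \<in> M)"

definition faithful_trace :: "'n::finite cmat set \<Rightarrow> ('n cmat \<Rightarrow> complex) \<Rightarrow> bool" where
  "faithful_trace M \<tau> \<longleftrightarrow>
     (\<forall>x\<in>M. \<forall>y\<in>M. \<tau> (x + y) = \<tau> x + \<tau> y \<and> \<tau> (x ** y) = \<tau> (y ** x)) \<and>
     (\<forall>c. \<forall>x\<in>M. \<tau> (cscale c x) = c * \<tau> x) \<and>
     (\<forall>x\<in>M. \<tau> (cadj x ** x) \<in> \<real> \<and> Re (\<tau> (cadj x ** x)) \<ge> 0) \<and>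
     (\<forall>x\<in>M. \<tau> (cadj x ** x) = 0 \<longrightarrow> x = 0)"

definition cond_exp :: "'n::finite cmat set \<Rightarrow> ('n cmat \<Rightarrow> complex) \<Rightarrow> 'n cmat \<Rightarrow> 'n cmat" where
  "cond_exp N \<tau> x = (THE y. y \<in> N \<and> (\<forall>z\<in>N. \<tau> (y ** z) = \<tau> (x ** z)))"

definition faithful_state :: "'n::finite cmat set \<Rightarrow> ('n cmat \<Rightarrow> complex) \<Rightarrow> 'n cmat \<Rightarrow> bool" where
  "faithful_state M \<tau> \<rho> \<longleftrightarrow> \<rho> \<in> M \<and> pos_op \<rho> \<and> \<tau> \<rho> = 1 \<and> invertible \<rho>"

definition norm1 :: "('n::finite cmat \<Rightarrow> complex) \<Rightarrow> 'n cmat \<Rightarrow> real" where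
  "norm1 \<tau> x = Re (\<tau> (mabs x))"

definition petz_rot :: "'n::finite cmat set \<Rightarrow> ('n cmat \<Rightarrow> complex) \<Rightarrow> 'n cmat \<Rightarrow> real \<Rightarrow> 'n cmat \<Rightarrow> 'n cmat" where
  "petz_rot N \<tau> \<sigma> t x =
     (let \<sigma>N = cond_exp N \<tau> \<sigma> in
      mpow \<sigma> (1/2 - \<i> * of_real t) ** mpow \<sigma>N (-1/2 + \<i> * of_real t) ** x **
      mpow \<sigma>N (-1/2 - \<i> * of_real t) ** mpow \<sigma> (1/2 + \<i> * of_real t))"

definition petz_univ :: "'n::finite cmat set \<Rightarrow> ('n cmat \<Rightarrow> complex) \<Rightarrow> 'n cmat \<Rightarrow> 'n cmat \<Rightarrow> 'n cmat" where
  "petz_univ N \<tau> \<sigma> x =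
     integral UNIV (\<lambda>t. (pi / 2 / (cosh (pi * t) + 1)) *\<^sub>R petz_rot N \<tau> \<sigma> (t / 2) x)"

definition Q_s :: "('n::finite cmat \<Rightarrow> complex) \<Rightarrow> real \<Rightarrow> 'n cmat \<Rightarrow> 'n cmat \<Rightarrow> complex" where
  "Q_s \<tau> s \<rho> \<sigma> = \<tau> (mpow \<rho> (of_real (1 - s)) ** mpow \<sigma> (of_real s))"

definition Q_inv :: "('n::finite cmat \<Rightarrow> complex) \<Rightarrow> 'n cmat \<Rightarrow> 'n cmat \<Rightarrow> complex" where
  "Q_inv \<tau> \<rho> \<sigma> = \<tau> (mpow \<rho> 2 ** mpow \<sigma> (-1))"

end

theory Submission
  imports Defs "HOL-Complex_Analysis.Conformal_Mappings"
begin

text \<open>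
  In the GNS space of \<open>\<sigma>\<close> the relative modular operators of \<open>(\<rho>, \<sigma>)\<close> and of
  \<open>(\<rho>N, \<sigma>N)\<close> are given by one quadratic form, restricted to \<open>M\<close> and to its subspace \<open>N\<close>. The vectors
  obtained by applying their resolvents at \<open>-u\<close> to \<open>1\<close> therefore differ by a Galerkin error \<open>w(u)\<close>, and
  the difference of the resolvent functionals dominates \<open>u \<parallel>w(u)\<parallel>\<^sup>2\<close>. Integrating that difference against
  \<open>u\<^bsup>1-s\<^esup>\<close> gives \<open>|Q_s(\<rho>,\<sigma>) - Q_s(\<rho>N,\<sigma>N)|\<close>, while integrating \<open>w(u)\<close> against \<open>u\<^bsup>1/2+it\<^esup>\<close> gives a
  difference of complex powers that controls \<open>\<rho> - R\<^sup>t(\<rho>N)\<close> in trace norm. The second integral is cut at a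
  small and a large value of \<open>u\<close>: the a priori bounds \<open>2/u\<close> and \<open>2 Q\<^bsup>1/2\<^esup>/u\<^sup>2\<close> for \<open>\<parallel>w(u)\<parallel>\<close> handle the
  two ends, and a weighted arithmetic-geometric mean inequality the middle.
\<close>

section \<open>Spectral theorem for Hermitian matrices\<close>

text \<open>The obstacle is that the two integrals weight \<open>w(u)\<close> differently: the
  entropy gap controls only the integral of \<open>u^(2-s) \<parallel>w(u)\<parallel>^2\<close>,
  while the modular gap needs that of \<open>u^(1/2) \<parallel>w(u)\<parallel>\<close>.
  Cauchy-Schwarz between them leaves the weight \<open>u^(s-1)\<close>, which is not integrable on
  the half-line; hence the cut, at \<open>a\<close> and \<open>1/a\<close>. In the middle
  \<open>u^s\<close> is bounded by \<open>a^(-|s|)\<close>, which leaves \<open>1/u\<close> and so a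
  logarithm; absorbing it costs the \<epsilon> in the exponent and produces the number e in
  \<open>K\<close>. In the denominator of \<open>K\<close> the plain 4 comes from the end near 0,
  \<open>4 Q^(1/2)\<close> from the end near infinity, the other root from the middle. The factor
  \<open>pi / cosh (pi t)\<close> is \<open>pi / sin (pi z)\<close> at \<open>z = 1/2 + it\<close>.
  After multiplication by it the bound on the modular gap is free of \<open>t\<close>, so it can be
  averaged against \<beta>. The extra factor 1/2 in the rotated estimates appears because \<rho> and
  its recovered version are both of the form \<open>cadj v ** v\<close> with \<open>v\<close> of
  norm 1, and the difference of two such products costs twice the distance of the vectors.\<close>

lemma cadj_simps [simp]:
  "cadj (cadj A) = A" "cadj (A + B) = cadj A + cadj B" "cadj (A - B) = cadj A - cadj B"
  "cadj (cscale c A) = cscale (cnj c) (cadj A)" "cadj (mat 1) = mat 1" "cadj 0 = 0"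
  "cadj (diagm d) = diagm (cnj \<circ> d)"
  by (auto simp: cadj_def cscale_def vec_eq_iff mat_def diagm_def)

lemma cadj_mult [simp]: "cadj (A ** B) = cadj B ** cadj A"
  by (auto simp: cadj_def vec_eq_iff matrix_matrix_mult_def mult.commute)

lemma cadj_sum: "cadj (sum f S) = (\<Sum>i\<in>S. cadj (f i))"
  by (induction S rule: infinite_finite_induct) auto

lemma cscale_simps [simp]:
  "cscale c A ** B = cscale c (A ** B)" "A ** cscale c B = cscale c (A ** B)"
  "cscale c (cscale d A) = cscale (c * d) A" "cscale 1 A = A" "cscale 0 A = 0" "cscale c 0 = 0"
  by (auto simp: cscale_def vec_eq_iff matrix_matrix_mult_def sum_distrib_left mult_ac intro!: sum.cong)

lemma cscale_add: "cscale c (A + B) = cscale c A + cscale c B" "cscale (c + d) A = cscale c A + cscale d A"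
  and cscale_diff: "cscale c (A - B) = cscale c A - cscale c B" "cscale (c - d) A = cscale c A - cscale d A"
  by (auto simp: cscale_def vec_eq_iff algebra_simps)

lemma cscale_sum: "cscale c (sum f S) = (\<Sum>i\<in>S. cscale c (f i))"
  by (induction S rule: infinite_finite_induct) (auto simp: cscale_add)

lemma scaleR_eq_cscale: "r *\<^sub>R A = cscale (of_real r) (A :: 'n::finite cmat)"
  by (auto simp: cscale_def vec_eq_iff scaleR_conv_of_real[where 'a = complex])

lemma bounded_linear_cscale: "bounded_linear (\<lambda>c. cscale c (X :: 'n::finite cmat))"
  by (rule linear_conv_bounded_linear[THEN iffD1])
    (auto intro!: linearI simp: cscale_add scaleR_eq_cscale scaleR_conv_of_real)

lemma bounded_linear_cadj: "bounded_linear (cadj :: 'n::finite cmat \<Rightarrow> _)"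
  by (rule linear_conv_bounded_linear[THEN iffD1])
    (auto intro!: linearI simp: scaleR_eq_cscale)

lemma mat_mult_0 [simp]: "A ** 0 = 0" "0 ** A = (0 :: 'n::finite cmat)"
  by (auto simp: vec_eq_iff matrix_matrix_mult_def)

lemma mat_add_mult: "(A + B) ** C = A ** C + B ** (C :: 'n::finite cmat)"
  and mat_mult_add: "C ** (A + B) = C ** A + C ** (B :: 'n::finite cmat)"
  and mat_diff_mult: "(A - B) ** C = A ** C - B ** (C :: 'n::finite cmat)"
  and mat_mult_diff: "C ** (A - B) = C ** A - C ** (B :: 'n::finite cmat)"
  by (auto simp: vec_eq_iff matrix_matrix_mult_def sum.distrib sum_subtractf algebra_simps)

lemma sum_mat_mult: "(sum f S :: 'n::finite cmat) ** (C :: 'n cmat) = (\<Sum>i\<in>S. f i ** C)"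
  by (induction S rule: infinite_finite_induct) (auto simp: mat_add_mult)

lemma mat_mult_sum: "(C :: 'n cmat) ** (sum f S :: 'n::finite cmat) = (\<Sum>i\<in>S. C ** f i)"
  by (induction S rule: infinite_finite_induct) (auto simp: mat_mult_add)

lemma diagm_mult: "diagm d ** diagm e = diagm (\<lambda>i. d i * e i)"
proof -
  have "(\<Sum>k\<in>UNIV. (if i = k then d i else 0) * (if k = j then e k else 0)) =
      (\<Sum>k\<in>UNIV. if k = i then (if i = j then d i * e i else 0) else 0)" for i j
    by (rule sum.cong) auto
  then show ?thesis by (simp add: diagm_def vec_eq_iff matrix_matrix_mult_def)
qed

lemma diagm_add: "diagm d + diagm e = diagm (\<lambda>i. d i + e i)"
  by (auto simp: diagm_def vec_eq_iff)

lemma cscale_diagm: "cscale c (diagm d) = diagm (\<lambda>i. c * d i)"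
  by (auto simp: diagm_def vec_eq_iff cscale_def)

lemma diagm_one: "diagm (\<lambda>i. 1) = mat 1"
  by (auto simp: diagm_def vec_eq_iff mat_def)

section \<open>Eigenvectors of Hermitian matrices\<close>

lemma self_adjoint_inner:
  assumes "hermitian A"
  shows "x \<bullet> (A *v y) = (A *v x) \<bullet> y"
proof -
  have A: "A $ i $ j = cnj (A $ j $ i)" for i j
    using assms by (auto simp: hermitian_def cadj_def vec_eq_iff) 
  have "x \<bullet> (A *v y) = (\<Sum>i\<in>UNIV. \<Sum>j\<in>UNIV. x$i \<bullet> (A$i$j * y$j))"
    by (simp add: inner_vec_def matrix_vector_mult_def inner_sum_right)
  also have "\<dots> = (\<Sum>i\<in>UNIV. \<Sum>j\<in>UNIV. (A$j$i * x$i) \<bullet> y$j)"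
  proof (intro sum.cong refl)
    fix i j
    show "x$i \<bullet> (A$i$j * y$j) = (A$j$i * x$i) \<bullet> y$j"
      by (subst A) (simp add: inner_complex_def algebra_simps)
  qed
  also have "\<dots> = (\<Sum>j\<in>UNIV. \<Sum>i\<in>UNIV. (A$j$i * x$i) \<bullet> y$j)"
    by (rule sum.swap)
  also have "\<dots> = (A *v x) \<bullet> y"
    by (simp add: inner_vec_def matrix_vector_mult_def inner_sum_left)
  finally show ?thesis .
qed

text \<open>The maximiser of the Rayleigh quotient on an invariant subspace is an eigenvector.\<close>

lemma hermitian_eigenvector_in_subspace:
  fixes A :: "'n::finite cmat"
  assumes A: "hermitian A" and S: "subspace S" and inv: "\<And>x. x \<in> S \<Longrightarrow> A *v x \<in> S"
    and "z \<in> S" "z \<noteq> 0"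
  shows "\<exists>x\<in>S. norm x = 1 \<and> (\<exists>r::real. A *v x = r *\<^sub>R x)"
proof -
  let ?C = "S \<inter> sphere 0 1"
  have "compact ?C"
    using closed_subspace[OF S] by (simp add: closed_Int_compact)
  moreover have "z /\<^sub>R norm z \<in> ?C"
    using assms by (auto intro: subspace_scale)
  moreover have "continuous_on ?C (\<lambda>x. x \<bullet> (A *v x))"
    by (intro continuous_intros linear_continuous_on) auto
  ultimately obtain x where x: "x \<in> ?C" and max: "\<And>y. y \<in> ?C \<Longrightarrow> y \<bullet> (A *v y) \<le> x \<bullet> (A *v x)"
    using continuous_attains_sup[of ?C "\<lambda>x. x \<bullet> (A *v x)"] by blast
  define r where "r = x \<bullet> (A *v x)"
  define B where "B = (\<lambda>y. r *\<^sub>R y - A *v y)"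
  have xx: "x \<bullet> x = 1" using x by (simp add: dot_square_norm)
  have pos: "y \<bullet> B y \<ge> 0" if "y \<in> S" for y
  proof (cases "y = 0")
    case False
    have "y /\<^sub>R norm y \<in> ?C" using that False S by (auto intro: subspace_scale)
    from max[OF this] have "y \<bullet> (A *v y) / (norm y)^2 \<le> r"
      by (simp add: r_def linear_scale[OF matrix_vector_mul_linear] power2_eq_square field_simps)
    with False have "y \<bullet> (A *v y) \<le> r * (norm y)^2" by (simp add: field_simps)
    then show ?thesis by (simp add: B_def inner_diff_right dot_square_norm)
  qed (simp add: B_def)
  have Bsym: "u \<bullet> B v = B u \<bullet> v" for u v
    using self_adjoint_inner[OF A, of u v] by (simp add: B_def algebra_simps)
  define y where "y = B x"
  have yS: "y \<in> S" using x inv S by (auto simp: y_def B_def intro: subspace_diff subspace_scale)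
  have "x \<bullet> B x = 0" using xx by (simp add: B_def inner_diff_right r_def)
  \<comment> \<open>The form of \<open>B\<close> is nonnegative on \<open>S\<close> and vanishes at
    \<open>x\<close>. Expanding it at \<open>x - e y\<close> with \<open>y = B x\<close> and
    dividing by \<open>e\<close> leaves this inequality; small \<open>e\<close> then forces
    \<open>y = 0\<close>.\<close>
  have quad: "0 \<le> e * (y \<bullet> B y) - 2 * (y \<bullet> y)" if "e > 0" for e
  proof -
    have "x - e *\<^sub>R y \<in> S" using x yS S by (auto intro: subspace_diff subspace_scale)
    from pos[OF this] have "0 \<le> (x - e *\<^sub>R y) \<bullet> B (x - e *\<^sub>R y)" .
    also have "B (x - e *\<^sub>R y) = B x - e *\<^sub>R B y"
      by (simp add: B_def algebra_simps linear_scale[OF matrix_vector_mul_linear])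
    also have "(x - e *\<^sub>R y) \<bullet> (B x - e *\<^sub>R B y) = e * (e * (y \<bullet> B y) - 2 * (y \<bullet> y))"
      using \<open>x \<bullet> B x = 0\<close> Bsym[of x y]
      by (simp add: inner_diff_left inner_diff_right y_def algebra_simps inner_commute)
    finally show ?thesis using that by (simp add: zero_le_mult_iff)
  qed
  have "y \<bullet> y \<le> 0"
  proof (rule field_le_epsilon)
    fix e :: real assume e: "e > 0"
    define c where "c = \<bar>y \<bullet> B y\<bar> + 1"
    have c: "c > 0" "y \<bullet> B y \<le> c" by (auto simp: c_def)
    have "2 * (y \<bullet> y) \<le> e / c * (y \<bullet> B y)" using quad[of "e / c"] e c by simp
    also have "\<dots> \<le> e / c * c" using e c by (intro mult_left_mono) auto
    finally have "2 * (y \<bullet> y) \<le> e" using c by simp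
    then show "y \<bullet> y \<le> 0 + e" using e by simp
  qed
  then have "y = 0" using inner_ge_zero[of y] by (metis antisym inner_eq_zero_iff)
  then have "A *v x = r *\<^sub>R x" by (simp add: y_def B_def)
  then show ?thesis using x by auto
qed

text \<open>The library product \<open>\<bullet>\<close> on \<open>complex^'n\<close> is only the
  real part of this form; orthonormality over the complex numbers needs the sesquilinear version,
  conjugate-linear on the left.\<close>

definition cinner :: "complex^'n \<Rightarrow> complex^'n \<Rightarrow> complex" where
  "cinner x y = (\<Sum>i\<in>UNIV. cnj (x $ i) * y $ i)"

lemma cinner_linear [simp]:
  "cinner x (y + z) = cinner x y + cinner x z" "cinner x (y - z) = cinner x y - cinner x z"
  "cinner x (c *s y) = c * cinner x y" "cinner x 0 = 0" "cinner x (r *\<^sub>R y) = of_real r * cinner x y"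
  unfolding cinner_def
  by (auto simp: sum.distrib sum_subtractf sum_distrib_left algebra_simps vector_scalar_mult_def scaleR_conv_of_real[where 'a = complex])

lemma cinner_sum: "cinner x (sum f S) = (\<Sum>i\<in>S. cinner x (f i))"
  by (induction S rule: infinite_finite_induct) auto

lemma cinner_commute: "cinner x y = cnj (cinner y x)"
  by (simp add: cinner_def mult.commute)

lemma cinner_self: "cinner x x = of_real ((norm x)\<^sup>2)"
  unfolding cinner_def norm_vec_def L2_set_def
  by (simp add: sum_nonneg complex_norm_square[symmetric] mult.commute)

lemma cinner_cadj: "cinner x (A *v y) = cinner (cadj A *v x) y"
  unfolding cinner_def matrix_vector_mult_def cadj_def
  apply (simp add: sum_distrib_left sum_distrib_right)
  apply (subst sum.swap)
  by (simp add: algebra_simps)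

definition orthonormal_eigenvectors :: "'n::finite cmat \<Rightarrow> (complex^'n) set \<Rightarrow> bool" where
  "orthonormal_eigenvectors A B \<longleftrightarrow>
     finite B \<and> (\<forall>b\<in>B. \<forall>c\<in>B. cinner b c = (if b = c then 1 else 0)) \<and> (\<forall>b\<in>B. \<exists>r::real. A *v b = r *\<^sub>R b)"

lemma orthonormal_eigenvectors_independent:
  assumes "orthonormal_eigenvectors A B"
  shows "vec.independent B"
proof (rule vec.independent_if_scalars_zero)
  show "finite B" using assms by (simp add: orthonormal_eigenvectors_def)
  fix f b assume f: "(\<Sum>x\<in>B. f x *s x) = 0" and b: "b \<in> B"
  have "0 = cinner b (\<Sum>x\<in>B. f x *s x)" using f by simp
  also have "\<dots> = (\<Sum>x\<in>B. f x * (if b = x then 1 else 0))"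
    using assms b by (auto simp: cinner_sum orthonormal_eigenvectors_def intro!: sum.cong)
  also have "\<dots> = f b" using b assms by (simp add: orthonormal_eigenvectors_def if_distrib cong: if_cong)
  finally show "f b = 0" by simp
qed

text \<open>An orthonormal family of eigenvectors of maximal size must span: its orthogonal
  complement is invariant under \<open>A\<close>, and if it were nonzero it would supply one more
  unit eigenvector.\<close>

lemma hermitian_orthonormal_eigenbasis:
  fixes A :: "'n::finite cmat"
  assumes A: "hermitian A"
  shows "\<exists>B. orthonormal_eigenvectors A B \<and> card B = CARD('n)"
proof -
  have dimU: "vec.dim (UNIV :: (complex^'n) set) = CARD('n)"
    using vec.dim_UNIV card_cart_basis by metis
  have bound: "card B \<le> CARD('n)" if "orthonormal_eigenvectors A B" for B
    using vec.independent_card_le_dim[of B UNIV] orthonormal_eigenvectors_independent[OF that] dimU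
    by simp
  have "orthonormal_eigenvectors A {}" by (simp add: orthonormal_eigenvectors_def)
  then obtain B where B: "orthonormal_eigenvectors A B"
    and max: "\<And>C. orthonormal_eigenvectors A C \<Longrightarrow> card C \<le> card B"
    using ex_has_greatest_nat[of "orthonormal_eigenvectors A" "{}" card "Suc CARD('n)"] bound
    by (metis less_Suc_eq_le)
  define S where "S = {x. \<forall>b\<in>B. cinner b x = 0}"
  have S: "subspace S" by (auto simp: S_def subspace_def)
  have inv: "A *v x \<in> S" if "x \<in> S" for x
  proof -
    have "cinner b (A *v x) = 0" if "b \<in> B" for b
    proof -
      obtain r :: real where "A *v b = r *\<^sub>R b"
        using B \<open>b \<in> B\<close> unfolding orthonormal_eigenvectors_def by blast
      then have "cinner b (A *v x) = cinner (r *\<^sub>R b) x"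
        using A by (simp add: cinner_cadj hermitian_def)
      also have "\<dots> = 0" using \<open>x \<in> S\<close> \<open>b \<in> B\<close>
        by (subst cinner_commute) (simp add: S_def, subst cinner_commute, simp)
      finally show ?thesis .
    qed
    then show ?thesis by (simp add: S_def)
  qed
  have S0: "x = 0" if "x \<in> S" for x
  proof (rule ccontr)
    assume "x \<noteq> 0"
    from hermitian_eigenvector_in_subspace[OF A S inv \<open>x \<in> S\<close> this]
    obtain e where e: "e \<in> S" "norm e = 1" "\<exists>r::real. A *v e = r *\<^sub>R e" by auto
    have ee: "cinner e e = 1" using e by (simp add: cinner_self)
    have be: "cinner b e = 0" "cinner e b = 0" if "b \<in> B" for b
      using e(1) that cinner_commute[of e b] by (auto simp: S_def)
    have "e \<notin> B" using be ee by force
    have "orthonormal_eigenvectors A (insert e B)"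
      using B e be ee by (auto simp: orthonormal_eigenvectors_def)
    from max[OF this] show False using \<open>e \<notin> B\<close> B by (simp add: orthonormal_eigenvectors_def)
  qed
  have "x \<in> vec.span B" for x
  proof -
    let ?y = "\<Sum>b\<in>B. cinner b x *s b"
    have "cinner b ?y = cinner b x" if "b \<in> B" for b
    proof -
      have "cinner b ?y = (\<Sum>c\<in>B. cinner c x * (if b = c then 1 else 0))"
        using B that by (auto simp: cinner_sum orthonormal_eigenvectors_def intro!: sum.cong)
      also have "\<dots> = cinner b x" using that B by (simp add: orthonormal_eigenvectors_def if_distrib cong: if_cong)
      finally show ?thesis .
    qed
    then have "x - ?y \<in> S" by (simp add: S_def)
    then have "x = ?y" using S0 by fastforce
    also have "?y \<in> vec.span B" by (intro vec.span_sum vec.span_scale vec.span_base)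
    finally show ?thesis .
  qed
  then have "card B = vec.dim (UNIV :: (complex^'n) set)"
    using orthonormal_eigenvectors_independent[OF B] by (intro vec.basis_card_eq_dim) auto
  with B dimU show ?thesis by auto
qed

theorem hermitian_diagonalizable:
  fixes A :: "'n::finite cmat"
  assumes A: "hermitian A"
  shows "\<exists>U (r :: 'n \<Rightarrow> real). unitary U \<and> A = U ** diagm (of_real \<circ> r) ** cadj U"
proof -
  obtain B where B: "orthonormal_eigenvectors A B" "card B = CARD('n)"
    using hermitian_orthonormal_eigenbasis[OF A] by auto
  then obtain e :: "'n \<Rightarrow> complex^'n" where e: "bij_betw e UNIV B"
    using finite_same_card_bij[of "UNIV :: 'n set" B] by (auto simp: orthonormal_eigenvectors_def)
  have eB: "e j \<in> B" for j using e by (auto simp: bij_betw_def)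
  have orth: "cinner (e i) (e j) = (if i = j then 1 else 0)" for i j
    using B eB[of i] eB[of j] e by (auto simp: orthonormal_eigenvectors_def bij_betw_def inj_on_def)
  have "\<forall>j. \<exists>r::real. A *v e j = r *\<^sub>R e j"
    using B eB by (auto simp: orthonormal_eigenvectors_def)
  then obtain r :: "'n \<Rightarrow> real" where r: "\<And>j. A *v e j = r j *\<^sub>R e j" by metis
  define U :: "'n cmat" where "U = (\<chi> i j. e j $ i)"
  have 1: "cadj U ** U = mat 1"
    using orth by (simp add: vec_eq_iff matrix_matrix_mult_def cadj_def U_def mat_def cinner_def)
  then have 2: "U ** cadj U = mat 1" using matrix_left_right_inverse by blast
  have "A ** U = U ** diagm (\<lambda>j. of_real (r j))"
  proof -
    have "(A ** U) $ i $ j = (U ** diagm (\<lambda>j. of_real (r j))) $ i $ j" for i j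
    proof -
      have "(A ** U) $ i $ j = (A *v e j) $ i"
        by (simp add: matrix_matrix_mult_def matrix_vector_mult_def U_def)
      also have "\<dots> = of_real (r j) * e j $ i" by (simp add: r scaleR_conv_of_real[where 'a = complex])
      also have "\<dots> = (U ** diagm (\<lambda>j. of_real (r j))) $ i $ j"
        by (simp add: matrix_matrix_mult_def U_def diagm_def if_distrib mult.commute cong: if_cong)
      finally show ?thesis .
    qed
    then show ?thesis by (simp add: vec_eq_iff)
  qed
  then have "A = U ** diagm (\<lambda>j. of_real (r j)) ** cadj U"
    using 2 by (metis matrix_mul_assoc matrix_mul_rid)
  then have "A = U ** diagm (of_real \<circ> r) ** cadj U" by (simp only: comp_def)
  with 1 2 show ?thesis unfolding unitary_def by blast
qed

section \<open>Functional calculus\<close>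

text \<open>\<open>mfun\<close> selects a diagonalisation by choice, so independence of that choice
  is needed. The transition matrix \<open>W\<close> intertwines the two diagonals, hence
  \<open>W $ i $ j\<close> vanishes unless \<open>d j = e i\<close>, and therefore it intertwines
  their images under \<open>f\<close> too.\<close>

lemma mfun_unitary:
  assumes U: "unitary U"
  shows "mfun f (U ** diagm d ** cadj U) = U ** diagm (f \<circ> d) ** cadj U"
proof -
  let ?A = "U ** diagm d ** cadj U"
  define p where "p = (SOME (V, e). unitary V \<and> ?A = V ** diagm e ** cadj V)"
  obtain V e where p: "p = (V, e)" by (cases p)
  have "case p of (V, e) \<Rightarrow> unitary V \<and> ?A = V ** diagm e ** cadj V"
    unfolding p_def by (rule someI[of _ "(U, d)"]) (use U in auto)
  then have V: "unitary V" and A: "?A = V ** diagm e ** cadj V" by (auto simp: p)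
  define W where "W = cadj V ** U"
  have "cadj V ** ?A ** U = W ** diagm d"
    using U by (metis W_def matrix_mul_assoc matrix_mul_rid unitary_def)
  moreover have "cadj V ** ?A ** U = diagm e ** W"
    unfolding A using V by (metis W_def matrix_mul_assoc matrix_mul_lid unitary_def)
  ultimately have We: "W ** diagm d = diagm e ** W" by simp
  have md: "(W ** diagm h) $ i $ j = W $ i $ j * h j" "(diagm h ** W) $ i $ j = h i * W $ i $ j" for h i j
  proof -
    have "(W ** diagm h) $ i $ j = (\<Sum>k\<in>UNIV. if k = j then W $ i $ j * h j else 0)"
      unfolding matrix_matrix_mult_def diagm_def vec_lambda_beta by (intro sum.cong) auto
    then show "(W ** diagm h) $ i $ j = W $ i $ j * h j" by simp
    have "(diagm h ** W) $ i $ j = (\<Sum>k\<in>UNIV. if k = i then h i * W $ i $ j else 0)"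
      unfolding matrix_matrix_mult_def diagm_def vec_lambda_beta by (intro sum.cong) auto
    then show "(diagm h ** W) $ i $ j = h i * W $ i $ j" by simp
  qed
  have "W $ i $ j * f (d j) = f (e i) * W $ i $ j" for i j
  proof (cases "W $ i $ j = 0")
    case False
    have "W $ i $ j * d j = e i * W $ i $ j" using We md by metis
    with False have "d j = e i" by simp
    then show ?thesis by simp
  qed simp
  then have Wf: "W ** diagm (f \<circ> d) = diagm (f \<circ> e) ** W" by (simp add: vec_eq_iff md)
  have "mfun f ?A = V ** diagm (f \<circ> e) ** cadj V"
    unfolding mfun_def p_def[symmetric] by (simp add: p)
  also have "\<dots> = V ** diagm (f \<circ> e) ** W ** cadj U"
    using U by (metis W_def matrix_mul_assoc matrix_mul_rid unitary_def)
  also have "\<dots> = V ** W ** diagm (f \<circ> d) ** cadj U"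
    by (metis Wf matrix_mul_assoc)
  also have "V ** W = U"
    using V by (metis W_def matrix_mul_assoc matrix_mul_lid unitary_def)
  finally show ?thesis .
qed

text \<open>One \<open>U\<close> serves all \<open>f\<close> simultaneously, which reduces
  identities between functions of \<open>A\<close> to identities between diagonals.\<close>

lemma hermitian_mfunE:
  fixes A :: "'n::finite cmat"
  assumes "hermitian A"
  obtains U and r :: "'n \<Rightarrow> real"
  where "unitary U" "\<And>f. mfun f A = U ** diagm (\<lambda>i. f (of_real (r i))) ** cadj U"
    "A = U ** diagm (\<lambda>i. of_real (r i)) ** cadj U"
proof -
  obtain U and r :: "'n \<Rightarrow> real" where "unitary U" "A = U ** diagm (of_real \<circ> r) ** cadj U"
    using hermitian_diagonalizable[OF assms] by blast
  then show ?thesis using mfun_unitary[of U _ "of_real \<circ> r"] that[of U r] by (simp add: comp_def)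
qed

lemma unitary_conj_mult:
  assumes "unitary U"
  shows "(U ** X ** cadj U) ** (U ** Y ** cadj U) = U ** (X ** Y) ** cadj U"
  using assms by (metis matrix_mul_assoc matrix_mul_rid unitary_def)

context
  fixes A :: "'n::finite cmat"
  assumes herm: "hermitian A"
begin

lemma mfun_mult: "mfun f A ** mfun g A = mfun (\<lambda>x. f x * g x) A"
  by (rule hermitian_mfunE[OF herm]) (simp add: unitary_conj_mult diagm_mult)

lemma mfun_add: "mfun f A + mfun g A = mfun (\<lambda>x. f x + g x) A"
  by (rule hermitian_mfunE[OF herm]) (simp flip: mat_add_mult mat_mult_add diagm_add)

lemma mfun_cscale: "cscale c (mfun f A) = mfun (\<lambda>x. c * f x) A"
  by (rule hermitian_mfunE[OF herm]) (simp flip: cscale_diagm)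

lemma mfun_const: "mfun (\<lambda>x. c) A = cscale c (mat 1)"
  using mfun_cscale[of c "\<lambda>x. 1"]
  by (rule_tac hermitian_mfunE[OF herm]) (simp add: diagm_one unitary_def)

lemma mfun_ident: "mfun (\<lambda>x. x) A = A"
  by (rule hermitian_mfunE[OF herm]) simp

lemma cadj_mfun: "cadj (mfun f A) = mfun (\<lambda>x. cnj (f x)) A"
  by (rule hermitian_mfunE[OF herm]) (simp add: matrix_mul_assoc comp_def)

lemma mfun_compose: "mfun g (mfun f A) = mfun (\<lambda>x. g (f x)) A"
  by (rule hermitian_mfunE[OF herm]) (simp add: mfun_unitary comp_def)

lemma mfun_cong: "(\<And>r::real. f (of_real r) = g (of_real r)) \<Longrightarrow> mfun f A = mfun g A"
  by (rule hermitian_mfunE[OF herm]) simp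

lemma mfun_sum: "finite S \<Longrightarrow> (\<Sum>i\<in>S. mfun (f i) A) = mfun (\<lambda>x. \<Sum>i\<in>S. f i x) A"
  by (induction S rule: finite_induct) (simp_all add: mfun_const mfun_add)

end

definition eigenproj :: "'n::finite cmat \<Rightarrow> real \<Rightarrow> 'n cmat" where
  "eigenproj A r = mfun (\<lambda>x. if x = of_real r then 1 else 0) A"

text \<open>For Hermitian \<open>A\<close> these are the distinct eigenvalues; multiplicity is
  hidden in the rank of \<open>eigenproj\<close>.\<close>

definition spectrum :: "'n::finite cmat \<Rightarrow> real set" where
  "spectrum A = {r. eigenproj A r \<noteq> 0}"

context
  fixes A :: "'n::finite cmat"
  assumes herm: "hermitian A"
begin

lemma cadj_eigenproj: "cadj (eigenproj A r) = eigenproj A r"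
  by (auto simp: eigenproj_def cadj_mfun[OF herm] intro!: mfun_cong[OF herm])

lemma eigenproj_mult: "eigenproj A r ** eigenproj A s = (if r = s then eigenproj A r else 0)"
proof -
  have "mfun (\<lambda>x. 0) A = 0" using mfun_const[OF herm, of 0] by simp
  then show ?thesis
    by (auto simp: eigenproj_def mfun_mult[OF herm] intro!: mfun_cong[OF herm] trans[of _ "mfun (\<lambda>x. 0) A"])
qed

lemma finite_spectrum: "finite (spectrum A)"
  and mfun_spectral: "mfun f A = (\<Sum>r\<in>spectrum A. cscale (f (of_real r)) (eigenproj A r))"
proof -
  obtain U and d :: "'n \<Rightarrow> real" where U: "unitary U"
    and f: "\<And>f. mfun f A = U ** diagm (\<lambda>i. f (of_real (d i))) ** cadj U"
    using hermitian_mfunE[OF herm] by metis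
  have sub: "spectrum A \<subseteq> range d"
  proof
    fix r assume r: "r \<in> spectrum A"
    show "r \<in> range d"
    proof (rule ccontr)
      assume "r \<notin> range d"
      then have "(\<lambda>i. if complex_of_real (d i) = of_real r then 1 else 0) = (\<lambda>i. 0 :: complex)"
        by (intro ext) auto
      then have "eigenproj A r = 0"
        using cscale_diagm[of 0 "\<lambda>i::'n. 0"] by (simp add: eigenproj_def f)
      with r show False by (simp add: spectrum_def)
    qed
  qed
  then show "finite (spectrum A)" by (rule finite_subset) simp
  have "mfun f A = mfun (\<lambda>x. \<Sum>r\<in>range d. f (of_real r) * (if x = of_real r then 1 else 0)) A"
  proof -
    have "(\<Sum>r\<in>range d. f (of_real r) * (if of_real (d i) = complex_of_real r then 1 else 0)) = f (of_real (d i))" for i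
    proof -
      have "(\<Sum>r\<in>range d. f (of_real r) * (if of_real (d i) = complex_of_real r then 1 else 0)) =
          (\<Sum>r\<in>range d. if r = d i then f (of_real (d i)) else 0)"
        by (intro sum.cong) auto
      then show ?thesis by simp
    qed
    then show ?thesis unfolding f by (simp only:)
  qed
  also have "\<dots> = (\<Sum>r\<in>range d. cscale (f (of_real r)) (eigenproj A r))"
    by (simp add: mfun_sum[OF herm, symmetric] mfun_cscale[OF herm, symmetric] eigenproj_def)
  also have "\<dots> = (\<Sum>r\<in>spectrum A. cscale (f (of_real r)) (eigenproj A r))"
    using sub by (intro sum.mono_neutral_right) (auto simp: spectrum_def)
  finally show "mfun f A = (\<Sum>r\<in>spectrum A. cscale (f (of_real r)) (eigenproj A r))" .
qed

lemma sum_eigenproj: "(\<Sum>r\<in>spectrum A. eigenproj A r) = mat 1"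
  using mfun_spectral[of "\<lambda>x. 1"] mfun_const[OF herm, of 1] by simp

lemma mult_eigenproj: "A ** eigenproj A r = cscale (of_real r) (eigenproj A r)"
proof -
  have "mfun (\<lambda>x. x) A ** eigenproj A r = cscale (of_real r) (eigenproj A r)"
    unfolding eigenproj_def mfun_mult[OF herm] mfun_cscale[OF herm] by (rule mfun_cong[OF herm]) auto
  then show ?thesis by (simp add: mfun_ident[OF herm])
qed

text \<open>Lagrange interpolation on the spectrum: every function of \<open>A\<close> agrees with a polynomial in \<open>A\<close>.\<close>

lemma mfun_in_star_subalg:
  assumes M: "star_subalg M" and "A \<in> M"
  shows "mfun f A \<in> M"
proof -
  have one: "mat 1 \<in> M" and add: "x \<in> M \<Longrightarrow> y \<in> M \<Longrightarrow> x + y \<in> M"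
    and mult: "x \<in> M \<Longrightarrow> y \<in> M \<Longrightarrow> x ** y \<in> M"
    and scale: "x \<in> M \<Longrightarrow> cscale c x \<in> M" for x y c
    using M by (auto simp: star_subalg_def)
  have zero: "0 \<in> M" using scale[OF one, of 0] by simp
  have lagrange: "\<exists>g. mfun g A \<in> M \<and> g (of_real r) = 1 \<and> (\<forall>s\<in>F. g (of_real s) = 0)"
    if "finite F" "r \<notin> F" for F and r :: real
    using that
  proof (induction F rule: finite_induct)
    case empty
    have "mfun (\<lambda>x. 1) A \<in> M" by (simp add: mfun_const[OF herm] one)
    then show ?case by (intro exI[of _ "\<lambda>x. 1"]) simp
  next
    case (insert s F)
    then obtain g where g: "mfun g A \<in> M" "g (of_real r) = 1" "\<forall>s\<in>F. g (of_real s) = 0" by auto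
    \<comment> \<open>The new factor is linear in \<open>x\<close>, vanishes at \<open>s\<close> and
      equals 1 at \<open>r\<close>.\<close>
    define h where "h = (\<lambda>x. g x * (inverse (of_real (r - s)) * (x + of_real (- s))))"
    have "mfun h A = mfun g A ** cscale (inverse (of_real (r - s))) (A + cscale (of_real (- s)) (mat 1))"
      unfolding h_def
      by (simp add: mfun_mult[OF herm, symmetric] mfun_cscale[OF herm, symmetric]
          mfun_add[OF herm, symmetric] mfun_const[OF herm] mfun_ident[OF herm] del: of_real_diff of_real_minus)
    also have "\<dots> \<in> M" using g(1) assms one by (intro mult scale add)
    finally show ?case using g insert.prems
      by (intro exI[of _ h]) (auto simp: h_def)
  qed
  have "eigenproj A r \<in> M" for r
  proof -
    obtain g where g: "mfun g A \<in> M" "g (of_real r) = 1" "\<forall>s\<in>spectrum A - {r}. g (of_real s) = 0"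
      using lagrange[of "spectrum A - {r}" r] finite_spectrum by auto
    have "mfun g A = (\<Sum>s\<in>spectrum A. if s = r then eigenproj A r else 0)"
      unfolding mfun_spectral[of g] using g by (intro sum.cong) auto
    also have "\<dots> = eigenproj A r" using finite_spectrum by (auto simp: spectrum_def)
    finally show ?thesis using g by simp
  qed
  then have summand: "cscale (f (of_real r)) (eigenproj A r) \<in> M" for r by (rule scale)
  have "(\<Sum>r\<in>F. cscale (f (of_real r)) (eigenproj A r)) \<in> M" if "finite F" for F
    using that by (induction F rule: finite_induct) (auto intro: add zero summand)
  then show ?thesis unfolding mfun_spectral using finite_spectrum by blast
qed

end

lemma eigenproj_in_star_subalg:
  assumes "hermitian A" "star_subalg M" "A \<in> M"
  shows "eigenproj A r \<in> M"
  unfolding eigenproj_def using mfun_in_star_subalg[OF assms] .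

section \<open>Positive operators\<close>

lemma sum_diag_cadj_mult:
  "(\<Sum>i\<in>UNIV. (cadj X ** X) $ i $ i) = of_real (\<Sum>i\<in>UNIV. \<Sum>k\<in>UNIV. (cmod (X $ k $ i))\<^sup>2)"
  by (simp add: matrix_matrix_mult_def cadj_def complex_norm_square[symmetric] mult.commute)

lemma pos_op_hermitian: "pos_op A \<Longrightarrow> hermitian A"
  by (auto simp: pos_op_def hermitian_def)

text \<open>With \<open>A = cadj B ** B\<close> and \<open>?E\<close> the spectral projection at
  \<open>r\<close>, the products \<open>cadj (B ** ?E) ** (B ** ?E)\<close> and \<open>r\<close>
  times \<open>cadj ?E ** ?E\<close> agree; their ordinary matrix traces are sums of squares, the
  second one nonzero.\<close>

lemma pos_op_spectrum_nonneg:
  assumes "pos_op A" "r \<in> spectrum A"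
  shows "r \<ge> 0"
proof -
  have herm: "hermitian A" using assms pos_op_hermitian by blast
  obtain B where B: "A = cadj B ** B" using assms by (auto simp: pos_op_def)
  let ?E = "eigenproj A r"
  let ?n = "\<lambda>X. \<Sum>i\<in>UNIV. \<Sum>k\<in>UNIV. (cmod (X $ k $ i))\<^sup>2 :: real"
  have "cadj (B ** ?E) ** (B ** ?E) = ?E ** (A ** ?E)"
    by (simp add: B cadj_eigenproj[OF herm, unfolded B] matrix_mul_assoc)
  also have "\<dots> = cscale (of_real r) (cadj ?E ** ?E)"
    by (simp add: mult_eigenproj[OF herm] cadj_eigenproj[OF herm] eigenproj_mult[OF herm])
  finally have "(\<Sum>i\<in>UNIV. (cadj (B ** ?E) ** (B ** ?E)) $ i $ i) =
      of_real r * (\<Sum>i\<in>UNIV. (cadj ?E ** ?E) $ i $ i)"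
    by (simp add: cscale_def sum_distrib_left)
  then have "complex_of_real (?n (B ** ?E)) = of_real (r * ?n ?E)"
    unfolding sum_diag_cadj_mult of_real_mult .
  then have "?n (B ** ?E) = r * ?n ?E" by (simp only: of_real_eq_iff)
  moreover have "?n (B ** ?E) \<ge> 0" by (intro sum_nonneg) auto
  moreover have "?n ?E > 0"
  proof -
    obtain i k where ik: "?E $ k $ i \<noteq> 0" using assms(2) by (auto simp: spectrum_def vec_eq_iff)
    have "(cmod (?E $ k $ i))\<^sup>2 \<le> (\<Sum>k\<in>UNIV. (cmod (?E $ k $ i))\<^sup>2)"
      by (rule member_le_sum) auto
    also have "\<dots> \<le> ?n ?E"
      by (rule member_le_sum[of i UNIV "\<lambda>i. \<Sum>k\<in>UNIV. (cmod (?E $ k $ i))\<^sup>2"]) (auto intro: sum_nonneg)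
    finally show ?thesis using ik by (smt (verit) zero_less_norm_iff zero_less_power)
  qed
  ultimately show ?thesis by (metis linorder_not_le mult_neg_pos)
qed

lemma pos_op_invertible_spectrum_pos:
  assumes "pos_op A" "invertible A" "r \<in> spectrum A"
  shows "r > 0"
proof -
  have herm: "hermitian A" using assms pos_op_hermitian by blast
  obtain B where B: "B ** A = mat 1" using assms(2) unfolding invertible_def by blast
  have "r \<noteq> 0"
  proof
    assume "r = 0"
    then have "A ** eigenproj A r = 0" by (simp add: mult_eigenproj[OF herm])
    then have "B ** (A ** eigenproj A r) = 0" by simp
    then have "eigenproj A r = 0" by (simp add: matrix_mul_assoc B)
    with assms(3) show False by (simp add: spectrum_def)
  qed
  with pos_op_spectrum_nonneg[OF assms(1,3)] show ?thesis by linarith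
qed

lemma mabs_hermitian:
  assumes "hermitian X"
  shows "mabs X = mfun (\<lambda>x. of_real \<bar>Re x\<bar>) X"
proof -
  have "cadj X ** X = mfun (\<lambda>x. x * x) X"
    using assms mfun_mult[OF assms, of "\<lambda>x. x" "\<lambda>x. x"]
    by (simp only: mfun_ident[OF assms] hermitian_def)
  then have "mabs X = mfun (\<lambda>x. csqrt (x * x)) X"
    unfolding mabs_def by (simp only: mfun_compose[OF assms])
  also have "\<dots> = mfun (\<lambda>x. of_real \<bar>Re x\<bar>) X"
  proof (rule mfun_cong[OF assms])
    fix r :: real
    show "csqrt (of_real r * of_real r) = of_real \<bar>Re (of_real r)\<bar>"
      using csqrt_of_real_nonneg[of "complex_of_real (r * r)", OF Im_complex_of_real]
      by (simp add: real_sqrt_abs2 del: csqrt_of_real_nonneg)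
  qed
  finally show ?thesis .
qed

section \<open>Mellin transforms\<close>

text \<open>The common majorant of all integrals over the half-line: integrable powers at both ends
  and a logarithmic middle. It serves for integrability (\<open>a = b = 1\<close>), for truncation
  errors (\<open>E = 0\<close>) and for the final splitting.\<close>

lemma has_integral_piecewise_powr:
  fixes a b d C0 C1 E :: real
  assumes "0 < a" "a \<le> b" "0 < d"
  shows "((\<lambda>u. if u < a then C0 * u powr (d - 1) else if u \<le> b then E / u else C1 * u powr (- d - 1))
     has_integral (C0 * a powr d / d + E * ln (b / a) + C1 * b powr (- d) / d)) {0<..}"
    (is "(?h has_integral _) _")
proof -
  have neg: "negligible {b::real}" for b by simp
  have 1: "(?h has_integral (C0 * (a powr d / d))) {0<..<a}"
  proof -
    have "((\<lambda>u. u powr (d - 1)) has_integral (a powr d / d)) {0..a}"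
      using has_integral_powr_from_0[of "d - 1" a] assms by simp
    then have "((\<lambda>u. C0 * u powr (d - 1)) has_integral (C0 * (a powr d / d))) {0<..<a}"
      by (intro has_integral_mult_right) (simp add: has_integral_Icc_iff_Ioo)
    then show ?thesis by (rule has_integral_eq[rotated]) auto
  qed
  have 2: "(?h has_integral (E * ln (b / a))) {a..b}"
  proof -
    have "((\<lambda>u. E / u) has_integral (E * ln b - E * ln a)) {a..b}"
      by (rule fundamental_theorem_of_calculus)
        (use assms in \<open>auto intro!: derivative_eq_intros simp flip: has_real_derivative_iff_has_vector_derivative\<close>)
    moreover have "E * ln b - E * ln a = E * ln (b / a)"
      using assms by (simp add: ln_div algebra_simps)
    ultimately have "((\<lambda>u. E / u) has_integral (E * ln (b / a))) {a..b}" by simp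
    then show ?thesis by (rule has_integral_eq[rotated]) auto
  qed
  have 3: "(?h has_integral (C1 * (b powr (- d) / d))) {b..}"
  proof -
    have "((\<lambda>u. u powr (- d - 1)) has_integral (b powr (- d) / d)) {b..}"
      using has_integral_powr_to_inf[of "- d - 1" b] assms by simp
    then have "((\<lambda>u. C1 * u powr (- d - 1)) has_integral (C1 * (b powr (- d) / d))) {b..}"
      by (rule has_integral_mult_right)
    then show ?thesis
      by (rule has_integral_spike[OF neg[of b], rotated]) (use assms in auto)
  qed
  have "(?h has_integral (C0 * (a powr d / d) + E * ln (b / a))) ({0<..<a} \<union> {a..b})"
    by (rule has_integral_Un[OF 1 2]) (auto intro: negligible_subset[OF negligible_empty])
  moreover have "{0<..<a} \<union> {a..b} = {0<..b}" using assms by auto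
  ultimately have 12: "(?h has_integral (C0 * (a powr d / d) + E * ln (b / a))) {0<..b}" by simp
  have "(?h has_integral (C0 * (a powr d / d) + E * ln (b / a) + C1 * (b powr (- d) / d))) ({0<..b} \<union> {b..})"
    by (rule has_integral_Un[OF 12 3]) (auto intro: negligible_subset[OF neg[of b]])
  moreover have "{0<..b} \<union> {b..} = {0<..}" using assms by auto
  ultimately show ?thesis by simp
qed

text \<open>The substitution \<open>g u = u / (x + u)\<close> turns the integral into
  \<open>Beta p (1 - p)\<close>, which the reflection formula of the Gamma function
  evaluates.\<close>

lemma has_integral_mellin_real:
  fixes x p :: real
  assumes x: "x > 0" and p: "0 < p" "p < 1"
  shows "((\<lambda>u. u powr (p - 1) * (x / (x + u))) has_integral (pi / sin (pi * p) * x powr p)) {0<..}"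
proof -
  define f where "f = (\<lambda>y::real. y powr (p - 1) * (1 - y) powr ((1 - p) - 1))"
  define g where "g = (\<lambda>u. u / (x + u))"
  have Beta: "Beta p (1 - p) = pi / sin (pi * p)"
  proof -
    have eq: "1 - complex_of_real p = of_real (1 - p)" "of_real pi * complex_of_real p = of_real (pi * p)"
      by simp_all
    have "complex_of_real (Gamma p * Gamma (1 - p)) = of_real (pi / sin (pi * p))"
      using Gamma_reflection_complex[of "of_real p"]
      unfolding eq Gamma_complex_of_real sin_of_real by (simp only: of_real_mult of_real_divide)
    then show ?thesis by (simp only: of_real_eq_iff) (simp add: Beta_def)
  qed
  have f_int: "(f has_integral (pi / sin (pi * p))) {0<..<1}"
    using has_integral_Beta_real[of p "1 - p"] p
    unfolding f_def Beta[symmetric] has_integral_Icc_iff_Ioo by simp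
  have f_abs: "f absolutely_integrable_on {0<..<1}"
    by (rule nonnegative_absolutely_integrable_1) (use f_int in \<open>auto simp: f_def integrable_on_def\<close>)
  have img: "g ` {0<..} = {0<..<1}"
  proof (intro equalityI subsetI)
    fix y assume y: "y \<in> {0<..<1::real}"
    have "x + x * y / (1 - y) = x / (1 - y)" using y by (simp add: field_simps)
    then have "y = g (x * y / (1 - y))" "x * y / (1 - y) > 0" using x y by (auto simp: g_def)
    then show "y \<in> g ` {0<..}" by auto
  qed (use x in \<open>auto simp: g_def field_simps\<close>)
  have der: "(g has_field_derivative x / (x + u)\<^sup>2) (at u within {0<..})" if "u \<in> {0<..}" for u
    unfolding g_def using that x
    by (auto intro!: derivative_eq_intros simp: power2_eq_square)
  have inj: "inj_on g {0<..}"
    using x by (auto simp: inj_on_def g_def field_simps)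
  have "(\<lambda>u. \<bar>x / (x + u)\<^sup>2\<bar> * f (g u)) absolutely_integrable_on {0<..} \<and>
      integral {0<..} (\<lambda>u. \<bar>x / (x + u)\<^sup>2\<bar> * f (g u)) = pi / sin (pi * p)"
    using f_abs f_int unfolding img[symmetric]
    by (subst has_absolute_integral_change_of_variables_1'[OF _ der inj]) (auto intro: integral_unique)
  then have int: "((\<lambda>u. \<bar>x / (x + u)\<^sup>2\<bar> * f (g u)) has_integral (pi / sin (pi * p))) {0<..}"
    using absolutely_integrable_on_def has_integral_iff by blast
  have "x powr p * (\<bar>x / (x + u)\<^sup>2\<bar> * f (g u)) = u powr (p - 1) * (x / (x + u))" if "u \<in> {0<..}" for u
  proof -
    have u: "u > 0" "x + u > 0" using that x by auto
    have "1 - g u = x / (x + u)" using u by (simp add: g_def field_simps)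
    then have "f (g u) = u powr (p - 1) / (x + u) powr (p - 1) * (x powr (- p) / (x + u) powr (- p))"
      using u x by (simp add: f_def g_def powr_divide)
    also have "\<dots> = u powr (p - 1) * x powr (- p) / ((x + u) powr (p - 1) * (x + u) powr (- p))" by simp
    also have "(x + u) powr (p - 1) * (x + u) powr (- p) = inverse (x + u)"
      using u by (simp only: powr_add[symmetric]) (simp add: powr_neg_one inverse_eq_divide)
    finally have fg: "f (g u) = u powr (p - 1) * x powr (- p) * (x + u)" using u by (simp add: field_simps)
    have "x powr p * x powr (- p) = 1" using x by (simp flip: powr_add)
    then have "x powr p * (\<bar>x / (x + u)\<^sup>2\<bar> * f (g u)) = x / (x + u)\<^sup>2 * u powr (p - 1) * (x + u)"
      unfolding fg using x by (simp add: mult_ac)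
    also have "\<dots> = u powr (p - 1) * (x / (x + u))" using u by (simp add: power2_eq_square)
    finally show ?thesis .
  qed
  with has_integral_mult_right[OF int, of "x powr p"] show ?thesis
    by (metis (no_types, lifting) has_integral_eq mult.commute)
qed

text \<open>The bound depends on \<open>z\<close> only through \<open>d\<close>, hence is uniform on
  a closed substrip; this gives the locally uniform convergence behind holomorphy.\<close>

lemma norm_mellin_integrand_le:
  fixes x d u :: real
  assumes "x > 0" "u > 0" "d \<le> Re z" "Re z \<le> 1 - d"
  shows "norm (of_real u powr (z - 1) * of_real (x / (x + u)) :: complex) \<le>
    (if u < 1 then u powr (d - 1) else x * u powr (- d - 1))"
proof -
  have eq: "norm (of_real u powr (z - 1) * of_real (x / (x + u)) :: complex) = u powr (Re z - 1) * (x / (x + u))"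
    using assms by (simp add: norm_mult norm_powr_real_powr norm_divide abs_of_pos flip: of_real_add)
  show ?thesis
  proof (cases "u < 1")
    case True
    have "u powr (Re z - 1) * (x / (x + u)) \<le> u powr (d - 1) * 1"
      using assms True by (intro mult_mono powr_mono') auto
    with True show ?thesis by (simp only: eq) simp
  next
    case False
    have "u powr (Re z - 1) * (x / (x + u)) \<le> u powr (- d) * (x / u)"
      using assms False by (intro mult_mono powr_mono divide_left_mono) auto
    also have "\<dots> = x * u powr (- d - 1)" using assms by (simp add: powr_diff)
    finally show ?thesis using False by (simp only: eq) simp
  qed
qed

lemma integrable_mellin:
  fixes x :: real
  assumes "x > 0" "0 < Re z" "Re z < 1"
  shows "(\<lambda>u. of_real u powr (z - 1) * of_real (x / (x + u)) :: complex) integrable_on {0<..}"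
proof (rule measurable_bounded_by_integrable_imp_integrable)
  define d where "d = min (Re z) (1 - Re z)"
  have d: "d > 0" "d \<le> Re z" "Re z \<le> 1 - d" using assms by (auto simp: d_def)
  show "(\<lambda>u. of_real u powr (z - 1) * of_real (x / (x + u)) :: complex) \<in> borel_measurable (lebesgue_on {0<..})"
    using assms by (intro continuous_imp_measurable_on_sets_lebesgue continuous_intros) auto
  let ?h = "\<lambda>u. if u < 1 then 1 * u powr (d - 1) else if u \<le> 1 then x / u else x * u powr (- d - 1)"
  show "?h integrable_on {0<..}"
    using has_integral_piecewise_powr[of 1 1 d 1 x x] d unfolding integrable_on_def by force
  show "norm (of_real u powr (z - 1) * of_real (x / (x + u)) :: complex) \<le> ?h u" if "u \<in> {0<..}" for u
    using norm_mellin_integrand_le[OF assms(1) _ d(2,3), of u] that by (cases "u = 1") auto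
qed auto

text \<open>Integrals over compact intervals are holomorphic by differentiation under the integral
  sign, and they converge uniformly on closed discs inside the strip.\<close>

lemma holomorphic_mellin:
  fixes x :: real
  assumes x: "x > 0"
  shows "(\<lambda>z. integral {0<..} (\<lambda>u. of_real u powr (z - 1) * of_real (x / (x + u)) :: complex))
    holomorphic_on {z. 0 < Re z \<and> Re z < 1}"
proof (rule holomorphic_uniform_sequence)
  let ?F = "\<lambda>z u. of_real u powr (z - 1) * of_real (x / (x + u)) :: complex"
  let ?f = "\<lambda>n::nat. \<lambda>z. integral {1 / (Suc n)..Suc n} (?F z)"
  let ?S = "{z. 0 < Re z \<and> Re z < 1}"
  have S_eq: "?S = {z. 0 < Re z} \<inter> {z. Re z < 1}" by auto
  show "open ?S" unfolding S_eq by (intro open_Int open_halfspace_Re_gt open_halfspace_Re_lt)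
  show "?f n holomorphic_on ?S" for n
  proof -
    have pos: "u > 0" if "u \<in> {1 / real (Suc n)..Suc n}" for u
      using that by (metis atLeastAtMost_iff divide_pos_pos less_le_trans of_nat_0_less_iff zero_less_Suc zero_less_one)
    have gt: "u > 0" if "1 / (1 + real n) \<le> u" for u
      using that by (smt (verit) divide_pos_pos of_nat_0_le_iff)
    have ge: "0 \<le> u" "x + u \<noteq> 0" if "1 / (1 + real n) \<le> u" for u
      using gt[OF that] x by auto
    have ne: "complex_of_real x + of_real u \<noteq> 0" if "1 / (1 + real n) \<le> u" for u
      using gt[OF that] x by (metis add_pos_pos less_irrefl of_real_add of_real_eq_0_iff)
    have "(\<lambda>z. integral (cbox (1 / (Suc n)) (Suc n)) (?F z)) holomorphic_on ?S"
    proof (rule leibniz_rule_holomorphic[where fx = "\<lambda>z u. of_real (ln u) * ?F z u"])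
      show "convex ?S" unfolding S_eq by (intro convex_Int convex_halfspace_Re_gt convex_halfspace_Re_lt)
      show "((\<lambda>z. ?F z u) has_field_derivative of_real (ln u) * ?F z u) (at z within ?S)"
        if "u \<in> cbox (1 / real (Suc n)) (Suc n)" for z u
      proof -
        have "u > 0" using pos[of u] that by simp
        then have eq: "complex_of_real u powr (z - 1) = exp ((z - 1) * of_real (ln u))" for z
          by (simp add: powr_def Ln_of_real)
        have "((\<lambda>z. exp ((z - 1) * of_real (ln u)) * c) has_field_derivative
            of_real (ln u) * (exp ((z - 1) * of_real (ln u)) * c)) (at z within ?S)" for c
          by (auto intro!: derivative_eq_intros)
        then show ?thesis unfolding eq .
      qed
      show "?F z integrable_on cbox (1 / real (Suc n)) (Suc n)" for z
        using x by (intro integrable_continuous continuous_intros) (auto simp: ne ge dest: gt)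
      show "continuous_on (?S \<times> cbox (1 / real (Suc n)) (Suc n)) (\<lambda>(z, u). of_real (ln u) * ?F z u)"
        unfolding split_def using x
        by (intro continuous_intros) (auto simp: ne ge dest: gt)
    qed
    then show ?thesis by simp
  qed
  fix w assume w: "w \<in> ?S"
  \<comment> \<open>Half the distance of \<open>w\<close> to the boundary of the strip, so that
    \<open>d \<le> Re z \<le> 1 - d\<close> on the whole disc.\<close>
  define d where "d = min (Re w) (1 - Re w) / 2"
  have d: "d > 0" using w by (auto simp: d_def)
  have Re_bd: "d \<le> Re z \<and> Re z \<le> 1 - d" if "z \<in> cball w d" for z
  proof -
    have "\<bar>Re w - Re z\<bar> \<le> d"
      using that abs_Re_le_cmod[of "w - z"] by (simp add: dist_norm)
    moreover have "2 * d \<le> Re w" "2 * d \<le> 1 - Re w" by (simp_all add: d_def)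
    ultimately show ?thesis by linarith
  qed
  have "uniform_limit (cball w d) ?f (\<lambda>z. integral {0<..} (?F z)) sequentially"
  proof (rule uniform_limitI)
    fix e :: real assume e: "e > 0"
    let ?T = "\<lambda>n. (1 / real (Suc n)) powr d / d + x * (real (Suc n)) powr (- d) / d"
    have T: "?T \<longlonglongrightarrow> 0" using d by real_asymp
    have "norm (integral {0<..} (?F z) - ?f n z) \<le> ?T n" if z: "z \<in> cball w d" for n z
    proof -
      let ?a = "1 / real (Suc n)" and ?b = "real (Suc n)"
      have ab': "0 < ?a" "?a \<le> 1" "1 \<le> ?b" by (auto simp: divide_simps)
      then have ab: "0 < ?a" "?a \<le> ?b" "?a \<le> 1" "1 \<le> ?b" by linarith+
      have int: "?F z integrable_on {0<..}" using integrable_mellin[OF x, of z] Re_bd[OF z] d by auto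
      have sub: "{?a..?b} \<subseteq> {0<..}" by (meson ab(1) atLeastAtMost_iff greaterThan_iff less_le_trans subsetI)
      have intab: "?F z integrable_on {?a..?b}"
        by (rule integrable_on_subinterval[OF int sub])
      let ?G = "\<lambda>u. if u \<in> {?a..?b} then ?F z u else 0"
      have G: "(?G has_integral ?f n z) {0<..}"
        using integrable_integral[OF intab] sub by (subst has_integral_restrict)
      have eq1: "integral {0<..} (?F z) - ?f n z = integral {0<..} (\<lambda>u. ?F z u - ?G u)"
        using G int by (subst integral_diff) (auto simp: integrable_on_def intro!: integral_unique[symmetric])
      have le: "norm (integral {0<..} (\<lambda>u. ?F z u - ?G u)) \<le> integral {0<..} (\<lambda>u. if u < ?a then 1 * u powr (d - 1) else if u \<le> ?b then 0 / u else x * u powr (- d - 1))"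
      proof (rule integral_norm_bound_integral)
        show "(\<lambda>u. ?F z u - ?G u) integrable_on {0<..}"
          using int G by (intro integrable_diff) (auto simp: integrable_on_def)
        show "(\<lambda>u. if u < ?a then 1 * u powr (d - 1) else if u \<le> ?b then 0 / u else x * u powr (- d - 1)) integrable_on {0<..}"
          using has_integral_piecewise_powr[OF ab(1,2) d] unfolding integrable_on_def by blast
        fix u :: real assume u: "u \<in> {0<..}"
        have bd: "norm (?F z u) \<le> (if u < 1 then u powr (d - 1) else x * u powr (- d - 1))"
          using norm_mellin_integrand_le[OF x, of u d z] Re_bd[OF z] u by auto
        show "norm (?F z u - ?G u) \<le> (if u < ?a then 1 * u powr (d - 1) else if u \<le> ?b then 0 / u else x * u powr (- d - 1))"
        proof (cases "u \<in> {?a..?b}")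
          case True
          then show ?thesis by auto
        next
          case False
          then have "u < ?a \<and> u < 1 \<or> u > ?b \<and> \<not> u < ?a \<and> \<not> u < 1"
            unfolding atLeastAtMost_iff using ab by linarith
          then show ?thesis using bd False by (elim disjE conjE) simp_all
        qed
      qed
      have eq2: "integral {0<..} (\<lambda>u. if u < ?a then 1 * u powr (d - 1) else if u \<le> ?b then 0 / u else x * u powr (- d - 1)) = ?T n"
        using has_integral_piecewise_powr[OF ab(1,2) d, of 1 0 x] by (intro integral_unique) simp
      show ?thesis using le unfolding eq1 eq2 .
    qed
    moreover have "\<forall>\<^sub>F n in sequentially. ?T n < e" using order_tendstoD(2)[OF T e] .
    ultimately show "\<forall>\<^sub>F n in sequentially. \<forall>z\<in>cball w d. dist (?f n z) (integral {0<..} (?F z)) < e"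
      by (smt (verit, best) dist_norm eventually_mono norm_minus_commute)
  qed
  moreover have "cball w d \<subseteq> ?S" using Re_bd d by fastforce
  ultimately show "\<exists>d>0. cball w d \<subseteq> ?S \<and> uniform_limit (cball w d) ?f (\<lambda>z. integral {0<..} (?F z)) sequentially"
    using d by blast
qed

text \<open>Both sides are holomorphic in the strip and agree on the real segment.\<close>

lemma has_integral_mellin_complex:
  fixes x :: real
  assumes x: "x > 0" and z: "0 < Re z" "Re z < 1" and nz: "sin (of_real pi * z) \<noteq> 0"
  shows "((\<lambda>u. of_real u powr (z - 1) * of_real (x / (x + u)) :: complex) has_integral
     (of_real pi / sin (of_real pi * z) * of_real x powr z)) {0<..}"
proof -
  let ?F = "\<lambda>z u. of_real u powr (z - 1) * of_real (x / (x + u)) :: complex"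
  let ?S = "{z. 0 < Re z \<and> Re z < 1}"
  let ?D = "\<lambda>z. integral {0<..} (?F z) * sin (of_real pi * z) - of_real pi * of_real x powr z"
  have S_eq: "?S = {z. 0 < Re z} \<inter> {z. Re z < 1}" by auto
  have "?D z = 0"
  proof (rule analytic_continuation[where f = ?D and S = ?S and U = "complex_of_real ` {0<..<1}" and \<xi> = "1 / 2"])
    show "?D holomorphic_on ?S"
      using x by (intro holomorphic_intros holomorphic_mellin) auto
    show "open ?S" unfolding S_eq by (intro open_Int open_halfspace_Re_gt open_halfspace_Re_lt)
    show "connected ?S" unfolding S_eq
      by (intro convex_connected convex_Int convex_halfspace_Re_gt convex_halfspace_Re_lt)
    show "complex_of_real ` {0<..<1} \<subseteq> ?S" by auto
    show "1 / 2 \<in> ?S" by simp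
    show "z \<in> ?S" using z by simp
    show "1 / 2 islimpt complex_of_real ` {0<..<1}"
      unfolding islimpt_approachable
    proof (intro allI impI)
      fix e :: real assume e: "e > 0"
      define h where "h = min (e / 2) (1 / 4)"
      have h: "h > 0" "h < e" "h < 1 / 2" using e by (auto simp: h_def)
      have "1 / 2 + complex_of_real h = of_real (1 / 2 + h)" by simp
      then have "1 / 2 + complex_of_real h \<in> complex_of_real ` {0<..<1}"
        using h by (intro image_eqI[of _ _ "1 / 2 + h"]) auto
      then show "\<exists>w\<in>complex_of_real ` {0<..<1}. w \<noteq> 1 / 2 \<and> dist w (1 / 2) < e"
        using h by (intro bexI[of _ "1 / 2 + complex_of_real h"]) (auto simp: dist_norm)
    qed
    fix w assume "w \<in> complex_of_real ` {0<..<1}"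
    then obtain p where p: "w = of_real p" "0 < p" "p < 1" by auto
    have "((\<lambda>u. complex_of_real (u powr (p - 1) * (x / (x + u)))) has_integral
        of_real (pi / sin (pi * p) * x powr p)) {0<..}"
      using has_integral_linear[OF has_integral_mellin_real[OF x p(2,3)] bounded_linear_of_real]
      unfolding o_def .
    moreover have "complex_of_real (u powr (p - 1) * (x / (x + u))) = ?F w u" if "u \<in> {0<..}" for u
      using that powr_of_real[of u "p - 1"] by (simp add: p(1))
    ultimately have "(?F w has_integral of_real (pi / sin (pi * p) * x powr p)) {0<..}"
      by (rule has_integral_eq[rotated])
    then have "integral {0<..} (?F w) = of_real (pi / sin (pi * p) * x powr p)" by (rule integral_unique)
    moreover have "sin (pi * p) \<noteq> 0" using p sin_gt_zero[of "pi * p"] by simp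
    moreover have "sin (of_real pi * w) = of_real (sin (pi * p))"
      unfolding p(1) of_real_mult[symmetric] sin_of_real ..
    moreover have "of_real x powr w = complex_of_real (x powr p)"
      using x powr_of_real[of x p] by (simp add: p(1))
    ultimately show "?D w = 0" by simp
  qed
  then have "integral {0<..} (?F z) = of_real pi / sin (of_real pi * z) * of_real x powr z"
    using nz by (simp add: field_simps)
  with integrable_mellin[OF x z] show ?thesis by (metis integrable_integral)
qed

section \<open>Integrals of differences of resolvents\<close>

lemma sin_pi_abs_pos:
  fixes s :: real
  assumes "s \<in> {-1<..<0} \<union> {0<..<1}"
  shows "sin (pi * \<bar>s\<bar>) > 0"
proof -
  have "0 < \<bar>s\<bar>" "\<bar>s\<bar> < 1" using assms by auto
  then have "0 < pi * \<bar>s\<bar>" "pi * \<bar>s\<bar> < pi" by simp_all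
  then show ?thesis by (rule sin_gt_zero)
qed

text \<open>A single term \<open>u powr z / (x + u)\<close> is not integrable at infinity. Writing
  \<open>u / (x + u) = 1 - x / (x + u)\<close>, the leading parts cancel because the coefficients
  sum to 0, and the rest is the Mellin integral with a minus sign. At \<open>z = 1/2 + it\<close>,
  \<open>sin (pi z)\<close> becomes \<open>cosh (pi t)\<close>.\<close>

lemma has_integral_resolvent_sum_complex:
  fixes c :: "'a \<Rightarrow> complex" and x :: "'a \<Rightarrow> real"
  assumes fin: "finite I" and x: "\<And>i. i \<in> I \<Longrightarrow> x i > 0" and c: "sum c I = 0"
  shows "((\<lambda>u. of_real u powr (1 / 2 + \<i> * of_real t) * (\<Sum>i\<in>I. c i / of_real (x i + u))) has_integral
     - (of_real (pi / cosh (pi * t)) * (\<Sum>i\<in>I. c i * of_real (x i) powr (1 / 2 + \<i> * of_real t)))) {0<..}"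
proof -
  let ?z = "1 / 2 + \<i> * complex_of_real t"
  have "sin (of_real pi * ?z) = cos (\<i> * of_real (pi * t))"
    by (simp add: sin_cos_eq algebra_simps)
  also have "\<dots> = of_real (cosh (pi * t))" unfolding cosh_conv_cos[symmetric]
    by (simp only: cosh_field_def exp_of_real of_real_minus[symmetric]) simp
  finally have sin: "sin (of_real pi * ?z) = of_real (cosh (pi * t))" .
  have "cosh (pi * t) > 0" by (rule cosh_real_pos)
  then have nz: "sin (of_real pi * ?z) \<noteq> 0" unfolding sin by simp
  have "((\<lambda>u. \<Sum>i\<in>I. - c i * (of_real u powr (?z - 1) * of_real (x i / (x i + u)))) has_integral
      (\<Sum>i\<in>I. - c i * (of_real pi / sin (of_real pi * ?z) * of_real (x i) powr ?z))) {0<..}"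
    by (intro has_integral_sum fin has_integral_mult_right has_integral_mellin_complex x nz) auto
  also have "(\<Sum>i\<in>I. - c i * (of_real pi / sin (of_real pi * ?z) * of_real (x i) powr ?z)) =
      - (of_real (pi / cosh (pi * t)) * (\<Sum>i\<in>I. c i * of_real (x i) powr ?z))"
    unfolding sin by (simp add: sum_distrib_left sum_negf mult_ac)
  finally show ?thesis
  proof (rule has_integral_eq[rotated])
    fix u :: real assume u: "u \<in> {0<..}"
    have "(\<Sum>i\<in>I. - c i * (of_real u powr (?z - 1) * of_real (x i / (x i + u)))) =
        (\<Sum>i\<in>I. of_real u powr ?z * (c i / of_real (x i + u)) - of_real u powr (?z - 1) * c i)"
    proof (rule sum.cong)
      fix i assume "i \<in> I"
      then have xu: "complex_of_real (x i + u) \<noteq> 0" using x[of i] u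
        by (metis add_pos_pos greaterThan_iff less_irrefl of_real_eq_0_iff)
      have "of_real u powr z = of_real u powr (z - 1) * of_real u" for z :: complex
        using u by (simp add: powr_diff)
      note uz = this[of ?z]
      then show "- c i * (of_real u powr (?z - 1) * of_real (x i / (x i + u))) =
          of_real u powr ?z * (c i / of_real (x i + u)) - of_real u powr (?z - 1) * c i"
        unfolding of_real_divide uz using xu by (simp add: field_simps)
    qed simp
    also have "\<dots> = of_real u powr ?z * (\<Sum>i\<in>I. c i / of_real (x i + u))"
      unfolding sum_subtractf sum_distrib_left[symmetric] c by simp
    finally show "(\<Sum>i\<in>I. - c i * (of_real u powr (?z - 1) * of_real (x i / (x i + u)))) =
      of_real u powr ?z * (\<Sum>i\<in>I. c i / of_real (x i + u))" .
  qed
qed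

lemma has_integral_resolvent_sum_real:
  fixes c x :: "'a \<Rightarrow> real"
  assumes fin: "finite I" and x: "\<And>i. i \<in> I \<Longrightarrow> x i > 0" and c: "sum c I = 0" and p: "0 < p" "p < 1"
  shows "((\<lambda>u. u powr p * (\<Sum>i\<in>I. c i / (x i + u))) has_integral
     - (pi / sin (pi * p) * (\<Sum>i\<in>I. c i * x i powr p))) {0<..}"
proof -
  have "((\<lambda>u. \<Sum>i\<in>I. - c i * (u powr (p - 1) * (x i / (x i + u)))) has_integral
      (\<Sum>i\<in>I. - c i * (pi / sin (pi * p) * x i powr p))) {0<..}"
    by (intro has_integral_sum fin has_integral_mult_right has_integral_mellin_real x p) auto
  also have "(\<Sum>i\<in>I. - c i * (pi / sin (pi * p) * x i powr p)) =
      - (pi / sin (pi * p) * (\<Sum>i\<in>I. c i * x i powr p))"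
    by (simp add: sum_distrib_left sum_negf mult_ac)
  finally show ?thesis
  proof (rule has_integral_eq[rotated])
    fix u :: real assume u: "u \<in> {0<..}"
    have "(\<Sum>i\<in>I. - c i * (u powr (p - 1) * (x i / (x i + u)))) =
        (\<Sum>i\<in>I. u powr p * (c i / (x i + u)) - u powr (p - 1) * c i)"
    proof (rule sum.cong)
      fix i assume "i \<in> I"
      then have xu: "x i + u \<noteq> 0" using x[of i] u by auto
      have "u powr p = u powr (p - 1) * u"
        using u by (simp add: powr_diff)
      then show "- c i * (u powr (p - 1) * (x i / (x i + u))) =
          u powr p * (c i / (x i + u)) - u powr (p - 1) * c i"
        using xu by (simp add: field_simps)
    qed simp
    also have "\<dots> = u powr p * (\<Sum>i\<in>I. c i / (x i + u))"
      unfolding sum_subtractf sum_distrib_left[symmetric] c by simp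
    finally show "(\<Sum>i\<in>I. - c i * (u powr (p - 1) * (x i / (x i + u)))) =
      u powr p * (\<Sum>i\<in>I. c i / (x i + u))" .
  qed
qed

text \<open>For \<open>s > 0\<close> the exponent \<open>1 - s\<close> lies in the strip. For
  \<open>s < 0\<close> it exceeds 1; the vanishing zeroth moment allows one factor \<open>u\<close>
  to be traded for \<open>- x i\<close> in the coefficients, and the vanishing first moment makes
  these new coefficients admissible for the exponent \<open>- s\<close>. The trade flips the sign,
  hence \<open>sgn s\<close>.\<close>

lemma has_integral_resolvent_sum_quasi_entropy:
  fixes c x :: "'a \<Rightarrow> real"
  assumes fin: "finite I" and x: "\<And>i. i \<in> I \<Longrightarrow> x i > 0" and c: "sum c I = 0"
    and cx: "(\<Sum>i\<in>I. c i * x i) = 0" and s: "s \<in> {-1<..<0} \<union> {0<..<1}"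
  shows "((\<lambda>u. u powr (1 - s) * (\<Sum>i\<in>I. c i / (x i + u))) has_integral
     (- sgn s * (pi / sin (pi * \<bar>s\<bar>) * (\<Sum>i\<in>I. c i * x i powr (1 - s))))) {0<..}"
proof (cases "s > 0")
  case True
  have "sin (pi * (1 - s)) = sin (pi * s)" by (simp add: algebra_simps sin_pi_minus)
  with has_integral_resolvent_sum_real[OF fin x c, where p = "1 - s"] True s show ?thesis by auto
next
  case False
  with s have s: "s < 0" "-1 < s" by auto
  have "((\<lambda>u. - (u powr (- s) * (\<Sum>i\<in>I. (c i * x i) / (x i + u)))) has_integral
     - (- (pi / sin (pi * (- s)) * (\<Sum>i\<in>I. (c i * x i) * x i powr (- s))))) {0<..}"
    using s by (intro has_integral_neg has_integral_resolvent_sum_real fin x cx) auto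
  also have "(\<Sum>i\<in>I. (c i * x i) * x i powr (- s)) = (\<Sum>i\<in>I. c i * x i powr (1 - s))"
  proof (rule sum.cong)
    fix i assume "i \<in> I"
    then have "x i powr (1 - s) = x i * x i powr (- s)" using x[of i] powr_add[of "x i" 1 "- s"] by simp
    then show "c i * x i * x i powr (- s) = c i * x i powr (1 - s)" by simp
  qed simp
  also have "- (- (pi / sin (pi * (- s)) * (\<Sum>i\<in>I. c i * x i powr (1 - s)))) =
      - sgn s * (pi / sin (pi * \<bar>s\<bar>) * (\<Sum>i\<in>I. c i * x i powr (1 - s)))" using s by simp
  finally show ?thesis
  proof (rule has_integral_eq[rotated])
    fix u :: real assume u: "u \<in> {0<..}"
    have "(\<Sum>i\<in>I. (c i * x i) / (x i + u)) = (\<Sum>i\<in>I. c i - u * (c i / (x i + u)))"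
    proof (rule sum.cong)
      fix i assume "i \<in> I"
      then have "x i + u \<noteq> 0" using x[of i] u by auto
      then show "c i * x i / (x i + u) = c i - u * (c i / (x i + u))" by (simp add: field_simps)
    qed simp
    also have "\<dots> = - u * (\<Sum>i\<in>I. c i / (x i + u))" unfolding sum_subtractf sum_distrib_left[symmetric] c by simp
    finally have "- (u powr (- s) * (\<Sum>i\<in>I. c i * x i / (x i + u))) =
        (u * u powr (- s)) * (\<Sum>i\<in>I. c i / (x i + u))" by simp
    also have "u * u powr (- s) = u powr (1 - s)" using u powr_add[of u 1 "- s"] by simp
    finally show "- (u powr (- s) * (\<Sum>i\<in>I. c i * x i / (x i + u))) =
      u powr (1 - s) * (\<Sum>i\<in>I. c i / (x i + u))" .
  qed
qed

section \<open>Two probability densities on the real line\<close>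

lemma has_integral_UNIV_nonneg_FTC:
  fixes f F :: "real \<Rightarrow> real"
  assumes der: "\<And>x. (F has_real_derivative f x) (at x)" and nonneg: "\<And>x. f x \<ge> 0"
    and cont: "continuous_on UNIV f"
    and A: "(F \<longlongrightarrow> A) at_bot" and B: "(F \<longlongrightarrow> B) at_top"
  shows "(f has_integral (B - A)) UNIV"
proof (rule has_integral_monotone_convergence_increasing[where f = "\<lambda>k::nat. \<lambda>x. if x \<in> {- real k..real k} then f x else 0"
      and x = "\<lambda>k. F (real k) - F (- real k)"])
  fix k :: nat
  have "(f has_integral (F (real k) - F (- real k))) {- real k..real k}"
    using der by (intro fundamental_theorem_of_calculus)
      (auto simp flip: has_real_derivative_iff_has_vector_derivative intro: has_field_derivative_at_within)
  then show "((\<lambda>x. if x \<in> {- real k..real k} then f x else 0) has_integral (F (real k) - F (- real k))) UNIV"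
    by (simp only: has_integral_restrict_UNIV)
next
  fix k :: nat and x :: real
  show "(if x \<in> {- real k..real k} then f x else 0) \<le> (if x \<in> {- real (Suc k)..real (Suc k)} then f x else 0)"
    using nonneg by auto
next
  fix x :: real
  obtain n :: nat where n: "\<bar>x\<bar> \<le> real n" using real_arch_simple by blast
  have "\<forall>\<^sub>F k in sequentially. (if x \<in> {- real k..real k} then f x else 0) = f x"
    using eventually_ge_at_top[of n] by eventually_elim (use n in auto)
  then show "(\<lambda>k. if x \<in> {- real k..real k} then f x else 0) \<longlonglongrightarrow> f x" by (rule tendsto_eventually)
next
  show "(\<lambda>k. F (real k) - F (- real k)) \<longlonglongrightarrow> B - A"
    by (intro tendsto_diff filterlim_compose[OF B] filterlim_compose[OF A] filterlim_real_sequentially)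
      (simp add: filterlim_uminus_at_bot filterlim_real_sequentially)
qed

abbreviation logistic :: "real \<Rightarrow> real" where
  "logistic t \<equiv> pi / 2 / (cosh (pi * t) + 1)"

text \<open>The density is the derivative of \<open>- 1 / (exp (pi t) + 1)\<close>.\<close>

lemma has_integral_logistic_density:
  "(logistic has_integral 1) UNIV"
proof -
  have pos: "cosh (pi * t) + 1 > 0" for t :: real by (smt (verit) cosh_real_pos)
  have 1: "((\<lambda>t. - 1 / (exp (pi * t) + 1)) has_real_derivative pi / 2 / (cosh (pi * t) + 1)) (at t)" for t :: real
  proof -
    have e: "exp (pi * t) > 0" "exp (pi * t) + 1 \<noteq> 0" using exp_gt_zero[of "pi * t"] by linarith+
    have "cosh (pi * t) + 1 = (exp (pi * t) + 1)\<^sup>2 / (2 * exp (pi * t))"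
      using e by (simp add: cosh_def exp_minus field_simps power2_eq_square)
    then have "pi * exp (pi * t) / (exp (pi * t) + 1)\<^sup>2 = pi / 2 / (cosh (pi * t) + 1)" by simp
    moreover have "((\<lambda>t. - 1 / (exp (pi * t) + 1)) has_real_derivative pi * exp (pi * t) / (exp (pi * t) + 1)\<^sup>2) (at t)"
      using e by (auto intro!: derivative_eq_intros simp: power2_eq_square)
    ultimately show ?thesis by simp
  qed
  have "((\<lambda>t. pi / 2 / (cosh (pi * t) + 1)) has_integral (0 - (- 1))) UNIV"
  proof (rule has_integral_UNIV_nonneg_FTC[OF 1])
    show "pi / 2 / (cosh (pi * t) + 1) \<ge> 0" for t :: real using pos[of t] by simp
    show "continuous_on UNIV (\<lambda>t. pi / 2 / (cosh (pi * t) + 1))"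
      using pos by (intro continuous_intros) (auto simp: less_imp_neq[symmetric])
    show "((\<lambda>t. - 1 / (exp (pi * t) + 1)) \<longlongrightarrow> - 1) at_bot" by real_asymp
    show "((\<lambda>t. - 1 / (exp (pi * t) + 1)) \<longlongrightarrow> 0) at_top" by real_asymp
  qed
  then show ?thesis by simp
qed

text \<open>This is what remains of the logistic density after multiplication by the factor
  \<open>2 cosh (pi t / 2) / pi\<close> of the rotated estimate at \<open>t / 2\<close>. Its total
  mass 1 is the reason why the universal estimate carries \<open>K\<close> without further
  factor.\<close>

lemma has_integral_half_sech:
  "((\<lambda>t. 1 / (2 * cosh (pi * t / 2))) has_integral 1) UNIV"
proof -
  have pos: "cosh (pi * t / 2) > 0" for t :: real by (rule cosh_real_pos)
  have 1: "((\<lambda>t. 2 / pi * arctan (exp (pi * t / 2))) has_real_derivative 1 / (2 * cosh (pi * t / 2))) (at t)" for t :: real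
  proof -
    have e: "exp (pi * t / 2) > 0" by simp
    have e2: "1 + (exp (pi * t / 2))\<^sup>2 > 0" by (smt (verit) zero_le_power2)
    have "cosh (pi * t / 2) = (1 + (exp (pi * t / 2))\<^sup>2) / (2 * exp (pi * t / 2))"
      using e by (simp add: cosh_def exp_minus field_simps power2_eq_square)
    then have "exp (pi * t / 2) / (1 + (exp (pi * t / 2))\<^sup>2) = 1 / (2 * cosh (pi * t / 2))"
      using e2 by (simp add: field_simps)
    moreover have "((\<lambda>t. 2 / pi * arctan (exp (pi * t / 2))) has_real_derivative exp (pi * t / 2) / (1 + (exp (pi * t / 2))\<^sup>2)) (at t)"
    proof -
      have "((\<lambda>t. exp (pi * t / 2)) has_real_derivative exp (pi * t / 2) * (pi / 2)) (at t)"
        by (auto intro!: derivative_eq_intros)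
      from DERIV_cmult[OF DERIV_chain2[OF DERIV_arctan this], of "2 / pi"]
      moreover have "2 / pi * (inverse k * (y * (pi / 2))) = y / k" for k y :: real
        using pi_neq_zero by (cases "k = 0") (simp_all add: field_simps)
      ultimately show ?thesis by (simp only:)
    qed
    ultimately show ?thesis by simp
  qed
  have "((\<lambda>t. 1 / (2 * cosh (pi * t / 2))) has_integral (2 / pi * (pi / 2) - 2 / pi * 0)) UNIV"
  proof (rule has_integral_UNIV_nonneg_FTC[OF 1])
    show "1 / (2 * cosh (pi * t / 2)) \<ge> 0" for t :: real using pos[of t] by simp
    show "continuous_on UNIV (\<lambda>t. 1 / (2 * cosh (pi * t / 2)))"
      using pos by (intro continuous_intros) (auto simp: less_imp_neq[symmetric])
    have "((\<lambda>t::real. exp (pi * t / 2)) \<longlongrightarrow> 0) at_bot" by real_asymp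
    then show "((\<lambda>t. 2 / pi * arctan (exp (pi * t / 2))) \<longlongrightarrow> 2 / pi * 0) at_bot"
      using tendsto_mult[OF tendsto_const[of "2 / pi"] tendsto_arctan] by (metis arctan_zero_zero)
    have "filterlim (\<lambda>t::real. exp (pi * t / 2)) at_top at_top" by real_asymp
    then show "((\<lambda>t. 2 / pi * arctan (exp (pi * t / 2))) \<longlongrightarrow> 2 / pi * (pi / 2)) at_top"
      by (intro tendsto_mult tendsto_const filterlim_compose[OF tendsto_arctan_at_top])
  qed
  then show ?thesis by simp
qed

lemma integrable_logistic_mult:
  fixes k :: "real \<Rightarrow> complex"
  assumes "continuous_on UNIV k" "\<And>t. cmod (k t) \<le> C"
  shows "(\<lambda>t. of_real (logistic t) * k t) integrable_on UNIV"
proof (rule measurable_bounded_by_integrable_imp_integrable)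
  have pos: "cosh (pi * t) + 1 > 0" for t :: real by (smt (verit) cosh_real_pos)
  have "continuous_on UNIV (\<lambda>t. complex_of_real (logistic t) * k t)"
    using pos by (intro continuous_intros assms(1)) (metis less_irrefl)+
  then show "(\<lambda>t. complex_of_real (logistic t) * k t) \<in> borel_measurable (lebesgue_on UNIV)"
    by (rule continuous_imp_measurable_on_sets_lebesgue) simp
  show "(\<lambda>t. C * logistic t) integrable_on UNIV"
    using has_integral_mult_right[OF has_integral_logistic_density, of C] by (auto simp: integrable_on_def)
  show "norm (complex_of_real (logistic t) * k t) \<le> C * logistic t" for t
  proof -
    have nn: "logistic t \<ge> 0" using pos[of t] by simp
    show ?thesis using mult_left_mono[OF assms(2)[of t] nn]
      unfolding norm_mult norm_of_real abs_of_nonneg[OF nn] by (simp only: mult.commute)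
  qed
qed auto

section \<open>Traces and conditional expectations\<close>

locale star_algebra =
  fixes M :: "'n::finite cmat set"
  assumes star_subalg: "star_subalg M"
begin

lemma one_closed [simp, intro]: "mat 1 \<in> M"
  and add_closed [intro]: "x \<in> M \<Longrightarrow> y \<in> M \<Longrightarrow> x + y \<in> M"
  and mult_closed [intro]: "x \<in> M \<Longrightarrow> y \<in> M \<Longrightarrow> x ** y \<in> M"
  and cscale_closed [intro]: "x \<in> M \<Longrightarrow> cscale c x \<in> M"
  and cadj_closed [intro]: "x \<in> M \<Longrightarrow> cadj x \<in> M"
  using star_subalg by (auto simp: star_subalg_def)

lemma zero_closed [simp, intro]: "0 \<in> M"
  using cscale_closed[OF one_closed, of 0] by simp

lemma diff_closed [intro]: "x \<in> M \<Longrightarrow> y \<in> M \<Longrightarrow> x - y \<in> M"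
proof -
  assume "x \<in> M" "y \<in> M"
  moreover have "x - y = x + cscale (-1) y" by (simp add: cscale_def vec_eq_iff)
  ultimately show ?thesis using add_closed[OF _ cscale_closed] by metis
qed

lemma scaleR_closed [intro]: "x \<in> M \<Longrightarrow> r *\<^sub>R x \<in> M"
  by (auto simp: scaleR_eq_cscale)

lemma sum_closed [intro]: "(\<And>i. i \<in> I \<Longrightarrow> f i \<in> M) \<Longrightarrow> sum f I \<in> M"
  by (induction I rule: infinite_finite_induct) auto

lemma mfun_closed: "hermitian A \<Longrightarrow> A \<in> M \<Longrightarrow> mfun f A \<in> M"
  using mfun_in_star_subalg star_subalg by blast

lemma eigenproj_closed: "hermitian A \<Longrightarrow> A \<in> M \<Longrightarrow> eigenproj A r \<in> M"
  using eigenproj_in_star_subalg star_subalg by blast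

lemma subspace: "subspace M"
  by (auto simp: subspace_def)

end

text \<open>The axioms say nothing about \<tau> outside \<open>M\<close>; this is why every rule for
  traces carries membership premises and closure rules accompany each construction.\<close>

locale traced_algebra = star_algebra M
  for M :: "'n::finite cmat set" +
  fixes \<tau> :: "'n cmat \<Rightarrow> complex"
  assumes faithful_trace: "faithful_trace M \<tau>"
begin

lemma trace_add: "x \<in> M \<Longrightarrow> y \<in> M \<Longrightarrow> \<tau> (x + y) = \<tau> x + \<tau> y"
  and trace_commute: "x \<in> M \<Longrightarrow> y \<in> M \<Longrightarrow> \<tau> (x ** y) = \<tau> (y ** x)"
  and trace_cscale: "x \<in> M \<Longrightarrow> \<tau> (cscale c x) = c * \<tau> x"
  and trace_real: "x \<in> M \<Longrightarrow> Im (\<tau> (cadj x ** x)) = 0"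
  and trace_nonneg: "x \<in> M \<Longrightarrow> Re (\<tau> (cadj x ** x)) \<ge> 0"
  and trace_faithful: "x \<in> M \<Longrightarrow> \<tau> (cadj x ** x) = 0 \<Longrightarrow> x = 0"
  using faithful_trace by (auto simp: faithful_trace_def complex_is_Real_iff)

lemma trace_zero [simp]: "\<tau> 0 = 0"
  using trace_cscale[OF one_closed, of 0] by simp

lemma trace_diff: "x \<in> M \<Longrightarrow> y \<in> M \<Longrightarrow> \<tau> (x - y) = \<tau> x - \<tau> y"
  using trace_add[of "x - y" y] by (auto simp: diff_closed)

lemma trace_sum: "(\<And>i. i \<in> I \<Longrightarrow> f i \<in> M) \<Longrightarrow> \<tau> (sum f I) = (\<Sum>i\<in>I. \<tau> (f i))"
  by (induction I rule: infinite_finite_induct) (auto simp: trace_add sum_closed)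

text \<open>Polarization: positivity of \<open>\<tau>\<close> forces \<open>\<tau>\<close> to commute with adjoints.\<close>

lemma trace_cadj:
  assumes "x \<in> M"
  shows "\<tau> (cadj x) = cnj (\<tau> x)"
proof -
  have "Im (\<tau> x) + Im (\<tau> (cadj x)) = 0"
  proof -
    have "cadj (mat 1 + x) ** (mat 1 + x) = mat 1 ** mat 1 + x + cadj x + cadj x ** x"
      by (simp add: mat_add_mult mat_mult_add algebra_simps)
    then have "\<tau> (cadj (mat 1 + x) ** (mat 1 + x)) = \<tau> (cadj (mat 1) ** mat 1) + \<tau> x + \<tau> (cadj x) + \<tau> (cadj x ** x)"
      using assms by (simp add: trace_add add_closed mult_closed cadj_closed)
    then show ?thesis
      using trace_real[of "mat 1 + x"] trace_real[of "mat 1"] trace_real[of x] assms by (auto simp: add_closed)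
  qed
  moreover have "Re (\<tau> x) - Re (\<tau> (cadj x)) = 0"
  proof -
    have "cadj (mat 1 + cscale \<i> x) ** (mat 1 + cscale \<i> x) =
        mat 1 ** mat 1 + cscale \<i> x + cscale (- \<i>) (cadj x) + cadj x ** x"
      by (simp add: mat_add_mult mat_mult_add cscale_add algebra_simps)
    then have "\<tau> (cadj (mat 1 + cscale \<i> x) ** (mat 1 + cscale \<i> x)) =
        \<tau> (cadj (mat 1) ** mat 1) + \<i> * \<tau> x + (- \<i>) * \<tau> (cadj x) + \<tau> (cadj x ** x)"
      using assms by (simp add: trace_add trace_cscale add_closed mult_closed cadj_closed cscale_closed)
    then show ?thesis
      using trace_real[of "mat 1 + cscale \<i> x"] trace_real[of "mat 1"] trace_real[of x] assms
      by (auto simp: add_closed cscale_closed)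
  qed
  ultimately show ?thesis by (simp add: complex_eq_iff)
qed

definition norm2 :: "'n cmat \<Rightarrow> real" where
  "norm2 x = sqrt (Re (\<tau> (cadj x ** x)))"

lemma norm2_nonneg: "x \<in> M \<Longrightarrow> norm2 x \<ge> 0"
  by (simp add: norm2_def trace_nonneg)

lemma norm2_square: "x \<in> M \<Longrightarrow> (norm2 x)\<^sup>2 = Re (\<tau> (cadj x ** x))"
  by (simp add: norm2_def trace_nonneg)

lemma norm2_square_of_real: "x \<in> M \<Longrightarrow> of_real ((norm2 x)\<^sup>2) = \<tau> (cadj x ** x)"
  by (simp only: norm2_square) (simp add: complex_eq_iff trace_real)

lemma trace_cauchy_schwarz:
  assumes x: "x \<in> M" and y: "y \<in> M"
  shows "cmod (\<tau> (cadj x ** y)) \<le> norm2 x * norm2 y"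
proof (cases "norm2 y = 0")
  case True
  then have "\<tau> (cadj y ** y) = 0" using norm2_square_of_real[OF y] by simp
  then have "y = 0" using trace_faithful y by blast
  then show ?thesis using norm2_nonneg[OF x] by (simp add: norm2_def)
next
  case False
  define b where "b = \<tau> (cadj x ** y)"
  define c where "c = (norm2 y)\<^sup>2"
  define k where "k = cnj b / of_real c"
  have c: "c > 0" using False by (simp add: c_def)
  have yx: "\<tau> (cadj y ** x) = cnj b"
    using trace_cadj[of "cadj x ** y"] x y by (auto simp: b_def)
  have "0 \<le> Re (\<tau> (cadj (x - cscale k y) ** (x - cscale k y)))"
    using x y by (intro trace_nonneg) auto
  also have "cadj (x - cscale k y) ** (x - cscale k y) =
      (cadj x ** x - cscale k (cadj x ** y)) - (cscale (cnj k) (cadj y ** x) - cscale (k * cnj k) (cadj y ** y))"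
    by (simp add: mat_diff_mult mat_mult_diff cscale_diff mult.commute)
  also have "\<tau> \<dots> = of_real ((norm2 x)\<^sup>2) - k * b - (cnj k * cnj b - k * cnj k * of_real c)"
    using x y by (simp add: trace_diff trace_cscale diff_closed cscale_closed mult_closed cadj_closed yx b_def c_def
        norm2_square_of_real del: of_real_power)
  also have "k * b = of_real ((cmod b)\<^sup>2 / c)"
    by (simp add: k_def complex_norm_square mult.commute del: of_real_power)
  also have "cnj k * cnj b = of_real ((cmod b)\<^sup>2 / c)"
    by (simp add: k_def complex_norm_square mult.commute del: of_real_power)
  also have "k * cnj k * of_real c = of_real ((cmod b)\<^sup>2 / c)"
    using c by (simp add: k_def complex_norm_square mult.commute del: of_real_power)
  finally have "0 \<le> (norm2 x)\<^sup>2 - (cmod b)\<^sup>2 / c" by simp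
  then have "(cmod b)\<^sup>2 \<le> (norm2 x)\<^sup>2 * c" using c by (simp add: field_simps)
  also have "\<dots> = (norm2 x * norm2 y)\<^sup>2" by (simp add: c_def power_mult_distrib)
  finally show ?thesis unfolding b_def
    by (rule power2_le_imp_le) (use norm2_nonneg x y in auto)
qed

lemma norm2_triangle:
  assumes x: "x \<in> M" and y: "y \<in> M"
  shows "norm2 (x - y) \<le> norm2 x + norm2 y"
proof -
  have yx: "\<tau> (cadj y ** x) = cnj (\<tau> (cadj x ** y))"
    using trace_cadj[of "cadj x ** y"] x y by auto
  have "(norm2 (x - y))\<^sup>2 = Re (\<tau> ((cadj x ** x - cadj x ** y) - (cadj y ** x - cadj y ** y)))"
    using x y by (simp add: norm2_square diff_closed mat_diff_mult mat_mult_diff)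
       (simp add: algebra_simps)
  also have "\<dots> = (norm2 x)\<^sup>2 - 2 * Re (\<tau> (cadj x ** y)) + (norm2 y)\<^sup>2"
    using x y by (simp add: trace_diff diff_closed mult_closed cadj_closed yx norm2_square)
  finally have "(norm2 (x - y))\<^sup>2 = (norm2 x)\<^sup>2 - 2 * Re (\<tau> (cadj x ** y)) + (norm2 y)\<^sup>2" .
  moreover have "- Re (\<tau> (cadj x ** y)) \<le> norm2 x * norm2 y"
    using trace_cauchy_schwarz[OF x y] abs_Re_le_cmod[of "\<tau> (cadj x ** y)"] by linarith
  ultimately have "(norm2 (x - y))\<^sup>2 \<le> (norm2 x + norm2 y)\<^sup>2"
    by (simp add: power2_sum)
  then show ?thesis by (rule power2_le_imp_le) (use norm2_nonneg x y in auto)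
qed

text \<open>Gram-Schmidt, one generator at a time. \<open>span\<close> is the real span, so
  orthogonality is meant for the real part of the trace inner product only.\<close>

lemma orthogonal_projection_exists:
  assumes "finite B" "B \<subseteq> M" "x \<in> M"
  shows "\<exists>y\<in>span B. \<forall>z\<in>span B. Re (\<tau> (cadj z ** (x - y))) = 0"
  using assms
proof (induction B arbitrary: x rule: finite_induct)
  case empty
  then show ?case by simp
next
  case (insert b B)
  have spanM: "span B \<subseteq> M" using insert.prems subspace by (simp add: span_minimal)
  obtain p where p: "p \<in> span B" "\<And>z. z \<in> span B \<Longrightarrow> Re (\<tau> (cadj z ** (b - p))) = 0"
    using insert.IH[of b] insert.prems by auto
  obtain q where q: "q \<in> span B" "\<And>z. z \<in> span B \<Longrightarrow> Re (\<tau> (cadj z ** (x - q))) = 0"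
    using insert.IH[of x] insert.prems by auto
  define c where "c = b - p"
  have M: "b \<in> M" "p \<in> M" "q \<in> M" "c \<in> M" using p q spanM insert.prems by (auto simp: c_def)
  show ?case
  proof (cases "c = 0")
    case True
    then have "b \<in> span B" using p by (simp add: c_def)
    then have "span (insert b B) = span B" by (rule span_redundant)
    then show ?thesis using q by auto
  next
    case False
    have sym: "Re (\<tau> (cadj u ** v)) = Re (\<tau> (cadj v ** u))" if "u \<in> M" "v \<in> M" for u v
      using trace_cadj[of "cadj u ** v"] that by (simp add: mult_closed cadj_closed)
    define k where "k = Re (\<tau> (cadj c ** x)) / (norm2 c)\<^sup>2"
    have c0: "(norm2 c)\<^sup>2 \<noteq> 0"
      using False M(4) norm2_square_of_real[OF M(4)] trace_faithful[OF M(4)] by auto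
    define y where "y = q + k *\<^sub>R c"
    have yM: "y \<in> M" using M insert.prems by (auto simp: y_def)
    have xM: "x \<in> M" using insert.prems by simp
    have split: "Re (\<tau> (cadj w ** (x - y))) = Re (\<tau> (cadj w ** (x - q))) - k * Re (\<tau> (cadj w ** c))" if "w \<in> M" for w
    proof -
      have "cadj w ** (x - y) = cadj w ** (x - q) - cscale (of_real k) (cadj w ** c)"
        by (simp add: y_def mat_mult_diff mat_mult_add scaleR_eq_cscale algebra_simps)
      then show ?thesis using that xM M
        by (simp add: trace_diff trace_cscale diff_closed mult_closed cadj_closed cscale_closed)
    qed
    have orthB: "Re (\<tau> (cadj w ** (x - y))) = 0" if "w \<in> span B" for w
      using split[of w] p(2)[OF that] q(2)[OF that] that spanM by (auto simp: c_def)
    have orthc: "Re (\<tau> (cadj c ** (x - y))) = 0"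
    proof -
      have "Re (\<tau> (cadj c ** q)) = 0" using sym[OF M(4,3)] p(2)[OF q(1)] by (simp add: c_def)
      then have "Re (\<tau> (cadj c ** (x - q))) = Re (\<tau> (cadj c ** x))"
        using M xM by (simp add: mat_mult_diff trace_diff mult_closed cadj_closed)
      then show ?thesis using split[OF M(4)] c0 norm2_square[OF M(4)] by (simp add: k_def)
    qed
    have "Re (\<tau> (cadj z ** (x - y))) = 0" if z: "z \<in> span (insert b B)" for z
    proof -
      obtain r where r: "z - r *\<^sub>R b \<in> span B" using z by (auto simp: span_insert)
      define w where "w = z - r *\<^sub>R b + r *\<^sub>R p"
      have w: "w \<in> span B" "w \<in> M" using r p spanM unfolding w_def by (auto intro!: span_add span_scale)
      have "cadj z ** (x - y) = cadj w ** (x - y) + cscale (of_real r) (cadj c ** (x - y))"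
        by (simp add: w_def c_def mat_add_mult mat_diff_mult scaleR_eq_cscale cscale_diff algebra_simps)
      then have "Re (\<tau> (cadj z ** (x - y))) = Re (\<tau> (cadj w ** (x - y))) + r * Re (\<tau> (cadj c ** (x - y)))"
        using w xM yM M by (simp add: trace_add trace_cscale diff_closed mult_closed cadj_closed cscale_closed)
      then show ?thesis using orthB[OF w(1)] orthc by simp
    qed
    moreover have "y \<in> span (insert b B)"
    proof -
      have sub: "span B \<subseteq> span (insert b B)" by (rule span_mono) auto
      have "c \<in> span (insert b B)" unfolding c_def by (rule span_diff) (use p(1) sub in \<open>auto intro: span_base\<close>)
      then show ?thesis unfolding y_def using q(1) sub by (intro span_add span_scale) auto
    qed
    ultimately show ?thesis by blast
  qed
qed

end

locale traced_subalgebra = traced_algebra M \<tau> + N: star_algebra N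
  for M N :: "'n::finite cmat set" and \<tau> :: "'n cmat \<Rightarrow> complex" +
  assumes N_subset: "N \<subseteq> M"
begin

lemma in_M [intro]: "x \<in> N \<Longrightarrow> x \<in> M"
  using N_subset by auto

abbreviation E :: "'n cmat \<Rightarrow> 'n cmat" where "E \<equiv> cond_exp N \<tau>"

lemma cond_exp_unique:
  assumes "y \<in> N" "y' \<in> N" "\<And>z. z \<in> N \<Longrightarrow> \<tau> (y ** z) = \<tau> (y' ** z)"
  shows "y = y'"
proof -
  have w: "y - y' \<in> N" "cadj (y - y') \<in> N" using assms by blast+
  have "\<tau> (cadj (y - y') ** (y - y')) = \<tau> ((y - y') ** cadj (y - y'))"
    using w by (intro trace_commute) auto
  also have "\<dots> = \<tau> (y ** cadj (y - y')) - \<tau> (y' ** cadj (y - y'))"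
    unfolding mat_diff_mult using w assms by (intro trace_diff) auto
  also have "\<dots> = 0" using assms(3)[OF w(2)] by simp
  finally show ?thesis using trace_faithful[of "y - y'"] w by auto
qed

text \<open>The conditional expectation is the orthogonal projection of \<open>x\<close> onto
  \<open>N\<close> in the trace inner product.\<close>

lemma cond_exp_exists:
  assumes x: "x \<in> M"
  shows "\<exists>y. y \<in> N \<and> (\<forall>z\<in>N. \<tau> (y ** z) = \<tau> (x ** z))"
proof -
  obtain B where B: "B \<subseteq> N" "independent B" "N \<subseteq> span B"
    using maximal_independent_subset by blast
  have fin: "finite B" using B(2) by (rule independent_imp_finite)
  have span: "span B = N" using B N.subspace by (simp add: span_subspace)
  obtain y where y: "y \<in> N" and orth: "\<And>z. z \<in> N \<Longrightarrow> Re (\<tau> (cadj z ** (x - y))) = 0"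
    using orthogonal_projection_exists[OF fin, of x] B(1) N_subset x unfolding span by blast
  have "\<tau> (y ** z) = \<tau> (x ** z)" if z: "z \<in> N" for z
  proof -
    have M: "x - y \<in> M" "cadj z \<in> M" "z \<in> M" "y \<in> M" using x y z by blast+
    \<comment> \<open>Real orthogonality tested at \<i> times \<open>cadj z\<close>, which is again
      in \<open>N\<close>, yields the imaginary part and so complex orthogonality.\<close>
    have "Im (\<tau> (z ** (x - y))) = Re (\<tau> (cadj (cscale \<i> (cadj z)) ** (x - y)))"
      using M by (simp add: trace_cscale mult_closed)
    also have "\<dots> = 0" using z by (intro orth) auto
    finally have "Im (\<tau> (z ** (x - y))) = 0" .
    moreover have "Re (\<tau> (z ** (x - y))) = 0" using orth[of "cadj z"] z by auto
    ultimately have "\<tau> ((x - y) ** z) = 0"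
      using trace_commute[OF M(1,3)] by (simp add: complex_eq_iff)
    then show ?thesis using x M by (simp add: mat_diff_mult trace_diff mult_closed)
  qed
  with y show ?thesis by blast
qed

lemma cond_exp:
  assumes "x \<in> M"
  shows "E x \<in> N" and "z \<in> N \<Longrightarrow> \<tau> (E x ** z) = \<tau> (x ** z)"
proof -
  have "\<exists>!y. y \<in> N \<and> (\<forall>z\<in>N. \<tau> (y ** z) = \<tau> (x ** z))"
    using cond_exp_exists[OF assms] cond_exp_unique by metis
  from theI'[OF this] show "E x \<in> N" "z \<in> N \<Longrightarrow> \<tau> (E x ** z) = \<tau> (x ** z)"
    unfolding cond_exp_def by auto
qed

lemma cond_exp_hermitian:
  assumes x: "x \<in> M" and "hermitian x"
  shows "hermitian (E x)"
  unfolding hermitian_def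
proof (rule cond_exp_unique)
  show "cadj (E x) \<in> N" "E x \<in> N" using cond_exp(1)[OF x] by auto
  fix z assume z: "z \<in> N"
  have M: "E x \<in> M" "z \<in> M" "cadj z \<in> N" "cadj z \<in> M" using z cond_exp(1)[OF x] by auto
  have "\<tau> (cadj (E x) ** z) = cnj (\<tau> (cadj z ** E x))"
    using trace_cadj[of "cadj z ** E x"] M by (simp add: mult_closed)
  also have "\<tau> (cadj z ** E x) = \<tau> (cadj z ** x)"
    using cond_exp(2)[OF x M(3)] trace_commute M x by metis
  also have "cnj (\<tau> (cadj z ** x)) = \<tau> (x ** z)"
    using trace_cadj[of "cadj z ** x"] M x assms(2) by (simp add: mult_closed hermitian_def)
  also have "\<dots> = \<tau> (E x ** z)" using cond_exp(2)[OF x z] by simp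
  finally show "\<tau> (cadj (E x) ** z) = \<tau> (E x ** z)" .
qed

end

section \<open>Joint functional calculus of two positive operators\<close>

lemma mfun_cong_spectrum:
  assumes "hermitian A" "\<And>r. r \<in> spectrum A \<Longrightarrow> f (of_real r) = g (of_real r)"
  shows "mfun f A = mfun g A"
  using assms by (simp add: mfun_spectral cong: sum.cong)

text \<open>Faithful states and their conditional expectations both reduce to this condition, and it
  guarantees that complex powers are taken of positive reals only.\<close>

definition posdef :: "'n::finite cmat \<Rightarrow> bool" where
  "posdef A \<longleftrightarrow> hermitian A \<and> spectrum A \<subseteq> {0<..}"

lemma posdef_hermitian: "posdef A \<Longrightarrow> hermitian A"
  and posdef_spectrum_pos: "posdef A \<Longrightarrow> r \<in> spectrum A \<Longrightarrow> r > 0"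
  by (auto simp: posdef_def)

context
  fixes A :: "'n::finite cmat"
  assumes A: "posdef A"
begin

lemma mpow_mult: "mpow A z ** mpow A w = mpow A (z + w)"
  unfolding mpow_def mfun_mult[OF posdef_hermitian[OF A]] by (simp add: powr_add)

text \<open>Positivity of the spectrum is essential: \<open>0 powr 0 = 0\<close>, so for singular
  \<open>A\<close> this power would be the support projection.\<close>

lemma mpow_zero: "mpow A 0 = mat 1"
proof -
  have "mpow A 0 = mfun (\<lambda>x. 1) A"
    unfolding mpow_def by (rule mfun_cong_spectrum) (use A in \<open>force simp: posdef_def\<close>)+
  then show ?thesis by (simp add: mfun_const[OF posdef_hermitian[OF A]])
qed

lemma mpow_one: "mpow A 1 = A"
proof -
  have "mpow A 1 = mfun (\<lambda>x. x) A"
    unfolding mpow_def by (rule mfun_cong_spectrum) (use A in \<open>force simp: posdef_def\<close>)+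
  then show ?thesis by (simp add: mfun_ident[OF posdef_hermitian[OF A]])
qed

lemma cadj_mpow: "cadj (mpow A z) = mpow A (cnj z)"
  unfolding mpow_def cadj_mfun[OF posdef_hermitian[OF A]]
  by (rule mfun_cong_spectrum) (use A in \<open>force simp: posdef_def cnj_powr\<close>)+

lemma mpow_spectral: "mpow A z = (\<Sum>r\<in>spectrum A. cscale (of_real r powr z) (eigenproj A r))"
  unfolding mpow_def by (rule mfun_spectral[OF posdef_hermitian[OF A]])

end

definition spectrum_pairs :: "'n::finite cmat \<Rightarrow> 'n cmat \<Rightarrow> (real \<times> real) set" where
  "spectrum_pairs A B = spectrum A \<times> spectrum B"

definition pairproj :: "'n::finite cmat \<Rightarrow> 'n cmat \<Rightarrow> real \<times> real \<Rightarrow> 'n cmat" where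
  "pairproj A B i = eigenproj A (fst i) ** eigenproj B (snd i)"

text \<open>\<open>A\<close> and \<open>B\<close> need not commute, but left multiplication by
  \<open>A\<close> and right multiplication by \<open>B\<close> do; this is the function
  \<open>f\<close> of that commuting pair, applied to \<open>mat 1\<close>. When \<open>f\<close>
  depends on \<open>ratio\<close> only, it is a function of the relative modular operator sending
  \<open>x\<close> to \<open>A ** x ** mpow B (- 1)\<close>.\<close>

definition joint :: "'n::finite cmat \<Rightarrow> 'n cmat \<Rightarrow> (real \<times> real \<Rightarrow> complex) \<Rightarrow> 'n cmat" where
  "joint A B f = (\<Sum>i\<in>spectrum_pairs A B. cscale (f i) (pairproj A B i))"

abbreviation ratio :: "real \<times> real \<Rightarrow> real" where
  "ratio i \<equiv> fst i / snd i"

context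
  fixes A B :: "'n::finite cmat"
  assumes A: "posdef A" and B: "posdef B"
begin

lemma finite_spectrum_pairs: "finite (spectrum_pairs A B)"
  by (simp add: spectrum_pairs_def finite_spectrum posdef_hermitian A B)

lemma spectrum_pairs_pos: "i \<in> spectrum_pairs A B \<Longrightarrow> fst i > 0 \<and> snd i > 0 \<and> ratio i > 0"
  using posdef_spectrum_pos[OF A] posdef_spectrum_pos[OF B] by (auto simp: spectrum_pairs_def)

lemma joint_product:
  "(\<Sum>p\<in>spectrum A. cscale (f p) (eigenproj A p)) ** (\<Sum>q\<in>spectrum B. cscale (g q) (eigenproj B q)) =
    joint A B (\<lambda>i. f (fst i) * g (snd i))"
  unfolding sum_mat_mult mat_mult_sum
  by (subst sum.swap) (simp add: joint_def spectrum_pairs_def pairproj_def sum.cartesian_product split_def mult.commute)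

lemma joint_one: "joint A B (\<lambda>i. 1) = mat 1"
  using joint_product[of "\<lambda>p. 1" "\<lambda>q. 1"] sum_eigenproj[OF posdef_hermitian[OF A]] sum_eigenproj[OF posdef_hermitian[OF B]]
  by simp

lemma mpow_mult_mpow: "mpow A z ** mpow B w = joint A B (\<lambda>i. of_real (fst i) powr z * of_real (snd i) powr w)"
  unfolding mpow_spectral[OF A] mpow_spectral[OF B] by (rule joint_product)

lemma joint_diff: "joint A B f - joint A B g = joint A B (\<lambda>i. f i - g i)"
  by (simp add: joint_def cscale_diff sum_subtractf)

lemma joint_add: "joint A B f + joint A B g = joint A B (\<lambda>i. f i + g i)"
  by (simp add: joint_def cscale_add sum.distrib)

lemma joint_cscale: "cscale c (joint A B f) = joint A B (\<lambda>i. c * f i)"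
  by (simp add: joint_def cscale_sum)

lemma joint_cong: "(\<And>i. i \<in> spectrum_pairs A B \<Longrightarrow> f i = g i) \<Longrightarrow> joint A B f = joint A B g"
  by (simp add: joint_def cong: sum.cong)

lemma mult_joint: "A ** joint A B f = joint A B (\<lambda>i. of_real (fst i) * f i)"
  by (simp add: joint_def mat_mult_sum pairproj_def matrix_mul_assoc mult_eigenproj[OF posdef_hermitian[OF A]])
    (simp add: mult.commute)

lemma joint_mult: "joint A B f ** B = joint A B (\<lambda>i. of_real (snd i) * f i)"
proof -
  have "eigenproj B r ** B = cscale (of_real r) (eigenproj B r)" for r
  proof -
    have "cadj (B ** eigenproj B r) = cadj (cscale (of_real r) (eigenproj B r))"
      by (simp only: mult_eigenproj[OF posdef_hermitian[OF B]])
    then show ?thesis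
      using posdef_hermitian[OF B] cadj_eigenproj[OF posdef_hermitian[OF B]] by (simp add: hermitian_def)
  qed
  then show ?thesis
    by (simp add: joint_def sum_mat_mult pairproj_def flip: matrix_mul_assoc) (simp add: mult.commute)
qed

text \<open>The equation for the resolvent at \<open>- u\<close> of the relative modular operator
  applied to \<open>mat 1\<close>, multiplied by \<open>B\<close> on the right to avoid the inverse
  of \<open>B\<close>.\<close>

lemma joint_resolvent:
  assumes "u > 0"
  shows "A ** joint A B (\<lambda>i. 1 / of_real (ratio i + u)) + cscale (of_real u) (joint A B (\<lambda>i. 1 / of_real (ratio i + u)) ** B) = B"
proof -
  have "A ** joint A B (\<lambda>i. 1 / of_real (ratio i + u)) + cscale (of_real u) (joint A B (\<lambda>i. 1 / of_real (ratio i + u)) ** B) =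
      joint A B (\<lambda>i. of_real (snd i) * 1)"
    unfolding mult_joint joint_mult joint_cscale joint_add
  proof (rule joint_cong)
    fix i assume "i \<in> spectrum_pairs A B"
    then have pos: "fst i > 0" "snd i > 0" "ratio i > 0" using spectrum_pairs_pos by auto
    then have "fst i * (1 / (ratio i + u)) + u * (snd i * (1 / (ratio i + u))) = snd i"
      using assms by (simp add: divide_simps) (simp add: algebra_simps add_pos_pos less_imp_neq[symmetric])
    then show "complex_of_real (fst i) * (1 / of_real (ratio i + u)) + of_real u * (of_real (snd i) * (1 / of_real (ratio i + u)))
      = of_real (snd i) * 1"
      by (metis (no_types) mult.right_neutral of_real_1 of_real_add of_real_divide of_real_mult)
  qed
  also have "\<dots> = B" unfolding joint_mult[symmetric] joint_one by simp
  finally show ?thesis .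
qed

end

text \<open>The complex power of the relative modular operator applied to \<open>mat 1\<close>; both
  eigenvalues being positive, the power of their ratio splits.\<close>

lemma mpow_mult_mpow_minus:
  assumes "posdef A" "posdef B"
  shows "mpow A z ** mpow B (- z) = joint A B (\<lambda>i. of_real (ratio i) powr z)"
  unfolding mpow_mult_mpow[OF assms]
proof (rule joint_cong[OF assms])
  fix i assume "i \<in> spectrum_pairs A B"
  then have pos: "fst i > 0" "snd i > 0" "ratio i > 0" using spectrum_pairs_pos[OF assms] by auto
  have e: "complex_of_real x powr w = exp (w * of_real (ln x))" if "x > 0" for x w
    using that by (simp add: powr_def Ln_of_real)
  have ln: "ln (ratio i) = ln (fst i) - ln (snd i)" using pos by (simp add: ln_div)
  show "complex_of_real (fst i) powr z * of_real (snd i) powr (- z) = of_real (ratio i) powr z"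
    unfolding e[OF pos(1)] e[OF pos(2)] e[OF pos(3)] exp_add[symmetric] ln by (simp add: algebra_simps)
qed

section \<open>Spectral measure of the relative modular operator\<close>

context traced_algebra
begin

lemma mpow_closed: "posdef A \<Longrightarrow> A \<in> M \<Longrightarrow> mpow A z \<in> M"
  unfolding mpow_def by (intro mfun_closed posdef_hermitian)

text \<open>The mass at the pair \<open>i\<close> of the spectral measure belonging to the vector
  \<open>mat 1\<close> in the GNS space of \<open>B\<close>: the factor \<open>snd i\<close> is the
  action of \<open>B\<close> on its eigenprojection.\<close>

definition pair_weight :: "'n cmat \<Rightarrow> 'n cmat \<Rightarrow> real \<times> real \<Rightarrow> real" where
  "pair_weight A B i = snd i * Re (\<tau> (pairproj A B i))"

context
  fixes A B :: "'n cmat"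
  assumes A: "posdef A" "A \<in> M" and B: "posdef B" "B \<in> M"
begin

lemma pairproj_closed: "pairproj A B i \<in> M"
  unfolding pairproj_def using A B by (intro mult_closed eigenproj_closed posdef_hermitian)

lemma joint_closed: "joint A B f \<in> M"
  unfolding joint_def by (intro sum_closed cscale_closed pairproj_closed)

text \<open>\<open>pairproj\<close> is in general no projection, but cyclicity of the trace brings
  the two projections of \<open>A\<close> and the two of \<open>B\<close> together, which makes the
  family orthogonal.\<close>

lemma trace_pairproj_orthogonal:
  "\<tau> (cadj (pairproj A B i) ** pairproj A B j) = (if i = j then \<tau> (pairproj A B i) else 0)"
proof -
  let ?P = "eigenproj A" and ?Q = "eigenproj B"
  note hA = posdef_hermitian[OF A(1)] and hB = posdef_hermitian[OF B(1)]
  have P: "?P r \<in> M" and Q: "?Q r \<in> M" for r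
    using A B hA hB by (auto intro: eigenproj_closed)
  have "\<tau> (cadj (pairproj A B i) ** pairproj A B j) = \<tau> (?Q (snd i) ** (?P (fst i) ** ?P (fst j) ** ?Q (snd j)))"
    by (simp add: pairproj_def cadj_eigenproj[OF hA] cadj_eigenproj[OF hB] matrix_mul_assoc)
  also have "\<dots> = \<tau> ((?P (fst i) ** ?P (fst j) ** ?Q (snd j)) ** ?Q (snd i))"
    using P Q by (intro trace_commute) auto
  also have "\<dots> = \<tau> (?P (fst i) ** ?P (fst j) ** (?Q (snd j) ** ?Q (snd i)))"
    by (simp add: matrix_mul_assoc)
  also have "\<dots> = (if i = j then \<tau> (pairproj A B i) else 0)"
    by (auto simp: eigenproj_mult[OF hA] eigenproj_mult[OF hB] pairproj_def prod_eq_iff)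
  finally show ?thesis .
qed

lemma trace_pairproj: "\<tau> (pairproj A B i) = of_real (Re (\<tau> (pairproj A B i)))"
  and pair_weight_nonneg: "i \<in> spectrum_pairs A B \<Longrightarrow> pair_weight A B i \<ge> 0"
proof -
  have eq: "\<tau> (cadj (pairproj A B i) ** pairproj A B i) = \<tau> (pairproj A B i)"
    using trace_pairproj_orthogonal[of i i] by simp
  show "\<tau> (pairproj A B i) = of_real (Re (\<tau> (pairproj A B i)))"
    using trace_real[OF pairproj_closed, of i] unfolding eq by (simp add: complex_eq_iff)
  show "pair_weight A B i \<ge> 0" if "i \<in> spectrum_pairs A B"
    using trace_nonneg[OF pairproj_closed, of i] spectrum_pairs_pos[OF A(1) B(1) that]
    unfolding eq pair_weight_def by simp
qed

lemma trace_joint_inner: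
  "\<tau> (cadj (joint A B f) ** joint A B g ** B) = (\<Sum>i\<in>spectrum_pairs A B. cnj (f i) * g i * of_real (pair_weight A B i))"
proof -
  let ?I = "spectrum_pairs A B" and ?F = "pairproj A B"
  note fin = finite_spectrum_pairs[OF A(1) B(1)]
  have M: "?F i \<in> M" for i by (rule pairproj_closed)
  have "cadj (joint A B f) ** joint A B g ** B = cadj (joint A B f) ** joint A B (\<lambda>i. of_real (snd i) * g i)"
    by (simp add: joint_mult[OF A(1) B(1)] flip: matrix_mul_assoc)
  also have "\<dots> = (\<Sum>i\<in>?I. \<Sum>j\<in>?I. cscale (of_real (snd j) * g j * cnj (f i)) (cadj (?F i) ** ?F j))"
    unfolding joint_def cadj_sum sum_mat_mult mat_mult_sum by (subst sum.swap) (simp add: mult_ac)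
  also have "\<tau> \<dots> = (\<Sum>i\<in>?I. \<Sum>j\<in>?I. (of_real (snd j) * g j * cnj (f i)) * \<tau> (cadj (?F i) ** ?F j))"
    using M by (simp add: trace_sum trace_cscale sum_closed cscale_closed mult_closed cadj_closed)
  also have "\<dots> = (\<Sum>i\<in>?I. \<Sum>j\<in>?I. if i = j then of_real (snd j) * g j * cnj (f i) * \<tau> (?F i) else 0)"
    unfolding trace_pairproj_orthogonal by (intro sum.cong refl) auto
  also have "\<dots> = (\<Sum>i\<in>?I. of_real (snd i) * g i * cnj (f i) * \<tau> (?F i))"
    using fin by (intro sum.cong refl) simp
  also have "\<dots> = (\<Sum>i\<in>?I. cnj (f i) * g i * of_real (pair_weight A B i))"
  proof (intro sum.cong refl)
    fix i
    show "of_real (snd i) * g i * cnj (f i) * \<tau> (?F i) = cnj (f i) * g i * of_real (pair_weight A B i)"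
      by (subst trace_pairproj) (simp add: pair_weight_def)
  qed
  finally show ?thesis .
qed

lemma trace_joint: "\<tau> (joint A B g ** B) = (\<Sum>i\<in>spectrum_pairs A B. g i * of_real (pair_weight A B i))"
  using trace_joint_inner[of "\<lambda>i. 1" g] by (simp add: joint_one[OF A(1) B(1)])

lemma sum_pair_weight: "of_real (\<Sum>i\<in>spectrum_pairs A B. pair_weight A B i) = \<tau> B"
  using trace_joint[of "\<lambda>i. 1"] by (simp add: joint_one[OF A(1) B(1)])

lemma trace_joint_div:
  "\<tau> (joint A B g) = (\<Sum>i\<in>spectrum_pairs A B. g i / of_real (snd i) * of_real (pair_weight A B i))"
proof -
  have "joint A B g = joint A B (\<lambda>i. g i / of_real (snd i)) ** B"
    unfolding joint_mult[OF A(1) B(1)]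
  proof (rule joint_cong[OF A(1) B(1)])
    fix i assume "i \<in> spectrum_pairs A B"
    then have "snd i \<noteq> 0" using spectrum_pairs_pos[OF A(1) B(1)] by fastforce
    then show "g i = of_real (snd i) * (g i / of_real (snd i))" by simp
  qed
  then show ?thesis by (simp only: trace_joint)
qed

lemma sum_pair_weight_ratio: "of_real (\<Sum>i\<in>spectrum_pairs A B. pair_weight A B i * ratio i) = \<tau> A"
proof -
  have "A = A ** joint A B (\<lambda>i. 1)" by (simp add: joint_one[OF A(1) B(1)])
  also have "\<dots> = joint A B (\<lambda>i. of_real (fst i))" by (simp add: mult_joint[OF A(1) B(1)])
  finally have "\<tau> A = \<tau> (joint A B (\<lambda>i. of_real (fst i)))" by simp
  then show ?thesis by (simp add: trace_joint_div mult.commute)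
qed

text \<open>Since \<open>a^(1-s) b^s = b (a/b)^(1-s)\<close>, the quasi-entropy is the moment of
  order \<open>1 - s\<close> of the spectral measure; in the same way \<open>Q_inv\<close> is the
  second moment.\<close>

lemma Q_s_eq: "Q_s \<tau> s A B = of_real (\<Sum>i\<in>spectrum_pairs A B. pair_weight A B i * ratio i powr (1 - s))"
proof -
  have "Q_s \<tau> s A B = (\<Sum>i\<in>spectrum_pairs A B.
     of_real (fst i) powr of_real (1 - s) * of_real (snd i) powr of_real s / of_real (snd i) * of_real (pair_weight A B i))"
    unfolding Q_s_def mpow_mult_mpow[OF A(1) B(1)] trace_joint_div ..
  also have "\<dots> = (\<Sum>i\<in>spectrum_pairs A B. of_real (pair_weight A B i * ratio i powr (1 - s)))"
  proof (intro sum.cong refl)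
    fix i assume "i \<in> spectrum_pairs A B"
    then have pos: "fst i > 0" "snd i > 0" using spectrum_pairs_pos[OF A(1) B(1)] by auto
    have "ratio i powr (1 - s) = fst i powr (1 - s) * snd i powr s / snd i"
      using pos by (simp add: powr_divide powr_diff)
    then have "complex_of_real (ratio i powr (1 - s)) = of_real (fst i) powr of_real (1 - s) * of_real (snd i) powr of_real s / of_real (snd i)"
      using pos by (simp only: powr_of_real less_imp_le of_real_mult of_real_divide)
    then show "of_real (fst i) powr of_real (1 - s) * of_real (snd i) powr of_real s / of_real (snd i) * of_real (pair_weight A B i)
      = complex_of_real (pair_weight A B i * ratio i powr (1 - s))" by (simp only: of_real_mult mult.commute)
  qed
  finally show ?thesis by simp
qed

lemma Q_inv_eq: "Q_inv \<tau> A B = of_real (\<Sum>i\<in>spectrum_pairs A B. pair_weight A B i * (ratio i)\<^sup>2)"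
proof -
  have "Q_inv \<tau> A B = (\<Sum>i\<in>spectrum_pairs A B.
     of_real (fst i) powr 2 * of_real (snd i) powr (- 1) / of_real (snd i) * of_real (pair_weight A B i))"
    unfolding Q_inv_def mpow_mult_mpow[OF A(1) B(1)] trace_joint_div ..
  also have "\<dots> = (\<Sum>i\<in>spectrum_pairs A B. of_real (pair_weight A B i * (ratio i)\<^sup>2))"
  proof (intro sum.cong refl)
    fix i assume "i \<in> spectrum_pairs A B"
    then have pos: "fst i > 0" "snd i > 0" using spectrum_pairs_pos[OF A(1) B(1)] by auto
    have "complex_of_real (fst i) powr 2 = of_real ((fst i)\<^sup>2)"
      using pos powr_of_real[of "fst i" 2] by (simp add: powr_numeral)
    moreover have "complex_of_real (snd i) powr (- 1) = of_real (1 / snd i)"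
      using pos powr_of_real[of "snd i" "- 1"] by (simp add: powr_neg_one)
    ultimately show "of_real (fst i) powr 2 * of_real (snd i) powr (- 1) / of_real (snd i) * of_real (pair_weight A B i)
      = complex_of_real (pair_weight A B i * (ratio i)\<^sup>2)"
      by (simp add: power_divide power2_eq_square)
  qed
  finally show ?thesis by simp
qed

end

end

section \<open>The weighted norm\<close>

context traced_algebra
begin

lemma faithful_state_posdef:
  assumes "faithful_state M \<tau> A"
  shows "posdef A" "A \<in> M" "\<tau> A = 1"
  using assms pos_op_hermitian[of A] pos_op_invertible_spectrum_pos[of A]
  by (auto simp: faithful_state_def posdef_def)

end

context traced_subalgebra
begin

sublocale NT: traced_algebra N \<tau>
  using faithful_trace N_subset by unfold_locales (auto simp: faithful_trace_def subset_iff)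

lemma cond_exp_right:
  assumes "x \<in> M" "z \<in> N"
  shows "\<tau> (z ** E x) = \<tau> (z ** x)"
  using cond_exp[OF assms(1)] assms trace_commute by (metis in_M)

lemma trace_cond_exp: "x \<in> M \<Longrightarrow> \<tau> (E x) = \<tau> x"
  using cond_exp(2)[of x "mat 1"] by simp

text \<open>For the spectral projection \<open>?P\<close> of \<open>E A\<close> at \<open>r\<close>,
  \<open>r\<close> times the squared norm of \<open>?P\<close> equals
  \<open>\<tau> (A ** ?P)\<close>, the squared norm of \<open>?h ** ?P\<close>. This is positive as
  \<open>?h\<close>, the square root of \<open>A\<close>, is invertible.\<close>

lemma cond_exp_posdef:
  assumes A: "posdef A" "A \<in> M"
  shows "posdef (E A)"
proof -
  have herm: "hermitian (E A)" using cond_exp_hermitian A by (auto simp: posdef_def)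
  have EN: "E A \<in> N" using cond_exp A by auto
  have "r > 0" if r: "r \<in> spectrum (E A)" for r
  proof -
    let ?P = "eigenproj (E A) r" and ?h = "mpow A (1 / 2)"
    have P: "?P \<in> N" "?P \<in> M" using N.eigenproj_closed[OF herm EN] by auto
    have hM: "?h \<in> M" using mpow_closed A by blast
    have hh: "?h ** ?h = A" using mpow_mult[OF A(1), of "1 / 2" "1 / 2"] mpow_one[OF A(1)] by simp
    have P0: "?P \<noteq> 0" using r by (simp add: spectrum_def)
    have "of_real ((norm2 (?h ** ?P))\<^sup>2) = \<tau> (?P ** (A ** ?P))"
      using hM P by (simp only: norm2_square_of_real mult_closed)
        (simp add: cadj_eigenproj[OF herm] cadj_mpow[OF A(1)] hh matrix_mul_assoc flip: matrix_mul_assoc[of _ ?h ?h])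
    also have "\<dots> = \<tau> ((A ** ?P) ** ?P)" using P A by (intro trace_commute) auto
    also have "(A ** ?P) ** ?P = A ** ?P"
      by (simp add: eigenproj_mult[OF herm] flip: matrix_mul_assoc)
    also have "\<tau> (A ** ?P) = \<tau> (E A ** ?P)" using cond_exp(2)[OF A(2) P(1)] by simp
    also have "\<dots> = of_real r * \<tau> (cadj ?P ** ?P)"
      using P by (simp add: mult_eigenproj[OF herm] trace_cscale cadj_eigenproj[OF herm] eigenproj_mult[OF herm])
    also have "\<dots> = of_real (r * (norm2 ?P)\<^sup>2)"
      using norm2_square_of_real[OF P(2)] by simp
    finally have eq: "(norm2 (?h ** ?P))\<^sup>2 = r * (norm2 ?P)\<^sup>2" by (simp only: of_real_eq_iff)
    have pos: "(norm2 X)\<^sup>2 > 0" if "X \<in> M" "X \<noteq> 0" for X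
      using norm2_square_of_real[OF that(1)] trace_faithful[OF that(1)] that(2) by (cases "norm2 X = 0") auto
    have "?h ** ?P \<noteq> 0"
    proof
      assume "?h ** ?P = 0"
      then have "mpow A (- (1 / 2)) ** (?h ** ?P) = 0" by simp
      then have "?P = 0"
        using mpow_mult[OF A(1), of "- (1 / 2)" "1 / 2"] mpow_zero[OF A(1)] by (simp add: matrix_mul_assoc)
      with P0 show False by simp
    qed
    with pos[of "?h ** ?P"] hM P have "r * (norm2 ?P)\<^sup>2 > 0" unfolding eq[symmetric] by auto
    with pos[OF P(2) P0] show "r > 0" using zero_less_mult_pos2 by blast
  qed
  with herm show ?thesis by (auto simp: posdef_def)
qed

end

text \<open>Used with \<open>g = 1\<close>, where the total mass enters, and with
  \<open>g = ratio\<close>, where the second moment does.\<close>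

lemma weighted_sum_bound:
  assumes "finite I" "\<And>i. i \<in> I \<Longrightarrow> w i \<ge> 0" "\<And>i. i \<in> I \<Longrightarrow> cmod (f i) \<le> C * g i"
    "(\<Sum>i\<in>I. w i * (g i)\<^sup>2) \<le> q" "x\<^sup>2 = (\<Sum>i\<in>I. (cmod (f i))\<^sup>2 * w i)" "C \<ge> 0" "q \<ge> 0"
  shows "x \<le> C * sqrt q"
proof -
  have "x\<^sup>2 \<le> (\<Sum>i\<in>I. C\<^sup>2 * (w i * (g i)\<^sup>2))"
    unfolding assms(5)
  proof (rule sum_mono)
    fix i assume i: "i \<in> I"
    have "(cmod (f i))\<^sup>2 * w i \<le> (C * g i)\<^sup>2 * w i"
      using assms(2,3)[OF i] by (intro mult_right_mono power_mono) auto
    then show "(cmod (f i))\<^sup>2 * w i \<le> C\<^sup>2 * (w i * (g i)\<^sup>2)" by (simp add: power_mult_distrib mult_ac)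
  qed
  also have "\<dots> \<le> C\<^sup>2 * q" using assms(4) unfolding sum_distrib_left[symmetric] by (intro mult_left_mono) auto
  also have "\<dots> = (C * sqrt q)\<^sup>2" using assms(7) by (simp add: power_mult_distrib)
  finally show ?thesis by (rule power2_le_imp_le) (use assms(6,7) in simp)
qed

locale recovery = traced_subalgebra M N \<tau>
  for M N :: "'n::finite cmat set" and \<tau> :: "'n cmat \<Rightarrow> complex" +
  fixes \<rho> \<sigma> :: "'n cmat"
  assumes rho_state: "faithful_state M \<tau> \<rho>" and sigma_state: "faithful_state M \<tau> \<sigma>"
begin

abbreviation \<rho>N :: "'n cmat" where "\<rho>N \<equiv> E \<rho>"
abbreviation \<sigma>N :: "'n cmat" where "\<sigma>N \<equiv> E \<sigma>"

lemmas rho = faithful_state_posdef[OF rho_state]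
lemmas sigma = faithful_state_posdef[OF sigma_state]

lemma rhoN: "posdef \<rho>N" "\<rho>N \<in> N" "\<rho>N \<in> M" "\<tau> \<rho>N = 1"
  and sigmaN: "posdef \<sigma>N" "\<sigma>N \<in> N" "\<sigma>N \<in> M" "\<tau> \<sigma>N = 1"
  using cond_exp_posdef cond_exp trace_cond_exp rho sigma by auto

text \<open>The norm of the GNS space of \<open>\<sigma>\<close>; in it the relative modular operator of \<open>\<rho>\<close> and \<open>\<sigma>\<close> and
  its counterpart on \<open>N\<close> come from the same quadratic form.\<close>

definition wnorm :: "'n cmat \<Rightarrow> real" where
  "wnorm x = norm2 (x ** mpow \<sigma> (1 / 2))"

lemma sqrt_sigma: "mpow \<sigma> (1 / 2) \<in> M" "cadj (mpow \<sigma> (1 / 2)) = mpow \<sigma> (1 / 2)"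
  "mpow \<sigma> (1 / 2) ** mpow \<sigma> (1 / 2) = \<sigma>"
  using mpow_closed sigma cadj_mpow[OF sigma(1)] mpow_mult[OF sigma(1), of "1 / 2" "1 / 2"] mpow_one[OF sigma(1)]
  by auto

lemma trace_weighted:
  assumes "x \<in> M" "y \<in> M"
  shows "\<tau> (cadj (x ** mpow \<sigma> (1 / 2)) ** (y ** mpow \<sigma> (1 / 2))) = \<tau> (cadj x ** y ** \<sigma>)"
proof -
  let ?h = "mpow \<sigma> (1 / 2)"
  have "cadj (x ** ?h) ** (y ** ?h) = ?h ** (cadj x ** y ** ?h)"
    by (simp add: sqrt_sigma(2) matrix_mul_assoc)
  also have "\<tau> \<dots> = \<tau> ((cadj x ** y ** ?h) ** ?h)"
    using assms sqrt_sigma(1) by (intro trace_commute) auto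
  also have "(cadj x ** y ** ?h) ** ?h = cadj x ** y ** \<sigma>"
    by (simp add: sqrt_sigma(3) flip: matrix_mul_assoc)
  finally show ?thesis .
qed

lemma wnorm_nonneg: "x \<in> M \<Longrightarrow> wnorm x \<ge> 0"
  unfolding wnorm_def using sqrt_sigma(1) by (intro norm2_nonneg) auto

lemma wnorm_square: "x \<in> M \<Longrightarrow> of_real ((wnorm x)\<^sup>2) = \<tau> (cadj x ** x ** \<sigma>)"
  unfolding wnorm_def using trace_weighted[of x x] sqrt_sigma(1) norm2_square_of_real[of "x ** mpow \<sigma> (1 / 2)"]
  by (simp add: mult_closed)

lemma weighted_cauchy_schwarz:
  assumes "x \<in> M" "y \<in> M"
  shows "cmod (\<tau> (cadj x ** y ** \<sigma>)) \<le> wnorm x * wnorm y"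
  using trace_cauchy_schwarz[of "x ** mpow \<sigma> (1 / 2)" "y ** mpow \<sigma> (1 / 2)"] assms sqrt_sigma(1)
  unfolding wnorm_def by (simp add: trace_weighted mult_closed del: cadj_mult)

lemma wnorm_triangle: "x \<in> M \<Longrightarrow> y \<in> M \<Longrightarrow> wnorm (x - y) \<le> wnorm x + wnorm y"
  unfolding wnorm_def mat_diff_mult using sqrt_sigma(1) by (intro norm2_triangle) auto

abbreviation "J \<equiv> joint \<rho> \<sigma>"
abbreviation "JN \<equiv> joint \<rho>N \<sigma>N"
abbreviation "pairs \<equiv> spectrum_pairs \<rho> \<sigma>"
abbreviation "pairsN \<equiv> spectrum_pairs \<rho>N \<sigma>N"
abbreviation "wt \<equiv> pair_weight \<rho> \<sigma>"
abbreviation "wtN \<equiv> pair_weight \<rho>N \<sigma>N"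
abbreviation "Q \<equiv> Re (Q_inv \<tau> \<rho> \<sigma>)"

lemma J_closed: "J f \<in> M"
  using joint_closed rho sigma by blast

lemma JN_closed: "JN f \<in> N" "JN f \<in> M"
  using NT.joint_closed rhoN sigmaN by blast+

lemma wnorm_J: "(wnorm (J f))\<^sup>2 = (\<Sum>i\<in>pairs. (cmod (f i))\<^sup>2 * wt i)"
proof -
  have "complex_of_real ((wnorm (J f))\<^sup>2) = (\<Sum>i\<in>pairs. cnj (f i) * f i * of_real (wt i))"
    unfolding wnorm_square[OF J_closed] trace_joint_inner[OF rho(1,2) sigma(1,2)] ..
  also have "\<dots> = of_real (\<Sum>i\<in>pairs. (cmod (f i))\<^sup>2 * wt i)"
    by (simp add: complex_norm_square mult.commute del: of_real_power)
  finally show ?thesis by (simp only: of_real_eq_iff)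
qed

text \<open>For elements of \<open>N\<close> the weight \<sigma> may be replaced by its conditional
  expectation, so the norm defined by \<sigma> restricts to the GNS norm of
  \<open>\<sigma>N\<close>.\<close>

lemma wnorm_JN: "(wnorm (JN f))\<^sup>2 = (\<Sum>i\<in>pairsN. (cmod (f i))\<^sup>2 * wtN i)"
proof -
  have "complex_of_real ((wnorm (JN f))\<^sup>2) = \<tau> (cadj (JN f) ** JN f ** \<sigma>N)"
    unfolding wnorm_square[OF JN_closed(2)]
    using JN_closed(1) sigma(2) by (intro cond_exp_right[symmetric]) auto
  also have "\<dots> = (\<Sum>i\<in>pairsN. cnj (f i) * f i * of_real (wtN i))"
    unfolding trace_joint_inner[OF rhoN(1,3) sigmaN(1,3)] ..
  also have "\<dots> = of_real (\<Sum>i\<in>pairsN. (cmod (f i))\<^sup>2 * wtN i)"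
    by (simp add: complex_norm_square mult.commute del: of_real_power)
  finally show ?thesis by (simp only: of_real_eq_iff)
qed

text \<open>The moments of order 0, 1, 2 are \<open>\<tau> \<sigma>\<close>,
  \<open>\<tau> \<rho>\<close> and \<open>Q\<close>. The first two agree with those on
  \<open>N\<close>, which is the cancellation required for integrating differences of
  resolvents.\<close>

lemma pairs: "finite pairs" "i \<in> pairs \<Longrightarrow> ratio i > 0" "i \<in> pairs \<Longrightarrow> wt i \<ge> 0"
  "(\<Sum>i\<in>pairs. wt i) = 1" "(\<Sum>i\<in>pairs. wt i * ratio i) = 1" "(\<Sum>i\<in>pairs. wt i * (ratio i)\<^sup>2) = Q"
proof -
  show "finite pairs" using finite_spectrum_pairs rho sigma by blast
  show "i \<in> pairs \<Longrightarrow> ratio i > 0" using spectrum_pairs_pos rho sigma by blast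
  show "i \<in> pairs \<Longrightarrow> wt i \<ge> 0" using pair_weight_nonneg rho sigma by blast
  show "(\<Sum>i\<in>pairs. wt i) = 1" using sum_pair_weight[OF rho(1,2) sigma(1,2)] sigma(3) by (metis of_real_eq_1_iff)
  show "(\<Sum>i\<in>pairs. wt i * ratio i) = 1"
    using sum_pair_weight_ratio[OF rho(1,2) sigma(1,2)] rho(3) by (metis of_real_eq_1_iff)
  show "(\<Sum>i\<in>pairs. wt i * (ratio i)\<^sup>2) = Q" by (simp add: Q_inv_eq[OF rho(1,2) sigma(1,2)])
qed

lemma pairsN: "finite pairsN" "i \<in> pairsN \<Longrightarrow> ratio i > 0" "i \<in> pairsN \<Longrightarrow> wtN i \<ge> 0"
  "(\<Sum>i\<in>pairsN. wtN i) = 1" "(\<Sum>i\<in>pairsN. wtN i * ratio i) = 1"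
proof -
  show "finite pairsN" using finite_spectrum_pairs rhoN sigmaN by blast
  show "i \<in> pairsN \<Longrightarrow> ratio i > 0" using spectrum_pairs_pos rhoN sigmaN by blast
  show "i \<in> pairsN \<Longrightarrow> wtN i \<ge> 0" using pair_weight_nonneg rhoN sigmaN by blast
  show "(\<Sum>i\<in>pairsN. wtN i) = 1" using sum_pair_weight[OF rhoN(1,3) sigmaN(1,3)] sigmaN(4) by (metis of_real_eq_1_iff)
  show "(\<Sum>i\<in>pairsN. wtN i * ratio i) = 1"
    using sum_pair_weight_ratio[OF rhoN(1,3) sigmaN(1,3)] rhoN(4) by (metis of_real_eq_1_iff)
qed

text \<open>\<open>\<rho>N \<sigma>N\<^sup>-\<^sup>1\<close> is the orthogonal projection of \<open>\<rho> \<sigma>\<^sup>-\<^sup>1\<close> onto \<open>N\<close> in the weighted inner product.\<close>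

lemma Q_inv_data_processing: "(\<Sum>i\<in>pairsN. wtN i * (ratio i)\<^sup>2) \<le> Q"
proof -
  let ?f = "\<lambda>i. complex_of_real (ratio i)"
  let ?\<eta> = "J ?f" and ?\<eta>N = "JN ?f"
  have eta: "?\<eta> ** \<sigma> = \<rho>"
  proof -
    have "?\<eta> ** \<sigma> = J (\<lambda>i. of_real (fst i) * 1)"
      unfolding joint_mult[OF rho(1) sigma(1)]
      by (rule joint_cong[OF rho(1) sigma(1)]) (use spectrum_pairs_pos[OF rho(1) sigma(1)] in fastforce)
    then show ?thesis unfolding mult_joint[OF rho(1) sigma(1), symmetric] joint_one[OF rho(1) sigma(1)] by simp
  qed
  have etaN: "?\<eta>N ** \<sigma>N = \<rho>N"
  proof -
    have "?\<eta>N ** \<sigma>N = JN (\<lambda>i. of_real (fst i) * 1)"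
      unfolding joint_mult[OF rhoN(1) sigmaN(1)]
      by (rule joint_cong[OF rhoN(1) sigmaN(1)]) (use spectrum_pairs_pos[OF rhoN(1) sigmaN(1)] in fastforce)
    then show ?thesis unfolding mult_joint[OF rhoN(1) sigmaN(1), symmetric] joint_one[OF rhoN(1) sigmaN(1)] by simp
  qed
  have w: "(wnorm ?\<eta>)\<^sup>2 = Q" unfolding wnorm_J pairs(6)[symmetric]
    by (simp add: norm_divide power_divide mult.commute)
  have wN: "(wnorm ?\<eta>N)\<^sup>2 = (\<Sum>i\<in>pairsN. wtN i * (ratio i)\<^sup>2)" unfolding wnorm_JN
    by (simp add: norm_divide power_divide mult.commute)
  have "complex_of_real ((wnorm ?\<eta>N)\<^sup>2) = \<tau> (cadj ?\<eta>N ** ?\<eta>N ** \<sigma>N)"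
    unfolding wnorm_square[OF JN_closed(2)]
    using JN_closed(1) sigma(2) by (intro cond_exp_right[symmetric]) auto
  also have "\<dots> = \<tau> (cadj ?\<eta>N ** \<rho>N)" by (simp only: etaN matrix_mul_assoc[symmetric])
  also have "\<dots> = \<tau> (cadj ?\<eta>N ** \<rho>)" using JN_closed(1) rho(2) by (intro cond_exp_right) auto
  also have "\<dots> = \<tau> (cadj ?\<eta>N ** ?\<eta> ** \<sigma>)" by (simp only: eta matrix_mul_assoc[symmetric])
  finally have eq: "complex_of_real ((wnorm ?\<eta>N)\<^sup>2) = \<tau> (cadj ?\<eta>N ** ?\<eta> ** \<sigma>)" .
  have "cmod (complex_of_real ((wnorm ?\<eta>N)\<^sup>2)) \<le> wnorm ?\<eta>N * wnorm ?\<eta>"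
    unfolding eq by (rule weighted_cauchy_schwarz[OF JN_closed(2) J_closed])
  then have le: "(wnorm ?\<eta>N)\<^sup>2 \<le> wnorm ?\<eta>N * wnorm ?\<eta>" by (simp only: norm_of_real abs_power2)
  have cancel: "a \<le> b" if "0 \<le> a" "0 \<le> b" "a\<^sup>2 \<le> a * b" for a b :: real
  proof (rule ccontr)
    assume "\<not> a \<le> b"
    with that have "a * b < a * a" by (intro mult_strict_left_mono) auto
    with that show False by (simp add: power2_eq_square)
  qed
  have "wnorm ?\<eta>N \<le> wnorm ?\<eta>"
    by (rule cancel[OF wnorm_nonneg[OF JN_closed(2)] wnorm_nonneg[OF J_closed] le])
  then have "(wnorm ?\<eta>N)\<^sup>2 \<le> (wnorm ?\<eta>)\<^sup>2" using wnorm_nonneg[OF JN_closed(2)] by (intro power_mono)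
  then show ?thesis by (simp only: w wN)
qed

lemma Q_nonneg: "Q \<ge> 0"
  unfolding pairs(6)[symmetric] using pairs(3) by (intro sum_nonneg) auto

lemma wnorm_J_le: "(\<And>i. i \<in> pairs \<Longrightarrow> cmod (f i) \<le> C) \<Longrightarrow> C \<ge> 0 \<Longrightarrow> wnorm (J f) \<le> C"
  using weighted_sum_bound[OF pairs(1,3), where f = f and C = C and g = "\<lambda>i. 1" and q = 1] wnorm_J pairs(4) by simp

lemma wnorm_JN_le: "(\<And>i. i \<in> pairsN \<Longrightarrow> cmod (f i) \<le> C) \<Longrightarrow> C \<ge> 0 \<Longrightarrow> wnorm (JN f) \<le> C"
  using weighted_sum_bound[OF pairsN(1,3), where f = f and C = C and g = "\<lambda>i. 1" and q = 1] wnorm_JN pairsN(4) by simp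

lemma wnorm_J_le_sqrt_Q: "(\<And>i. i \<in> pairs \<Longrightarrow> cmod (f i) \<le> C * ratio i) \<Longrightarrow> C \<ge> 0 \<Longrightarrow> wnorm (J f) \<le> C * sqrt Q"
  using weighted_sum_bound[OF pairs(1,3), where f = f and C = C and g = ratio and q = Q] wnorm_J pairs(6) Q_nonneg by simp

lemma wnorm_JN_le_sqrt_Q: "(\<And>i. i \<in> pairsN \<Longrightarrow> cmod (f i) \<le> C * ratio i) \<Longrightarrow> C \<ge> 0 \<Longrightarrow> wnorm (JN f) \<le> C * sqrt Q"
  using weighted_sum_bound[OF pairsN(1,3), where f = f and C = C and g = ratio and q = Q] wnorm_JN Q_inv_data_processing Q_nonneg by simp

end

section \<open>The Galerkin error of the resolvents\<close>

context recovery
begin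

text \<open>The vector \<open>w(u)\<close>.\<close>

definition resolvent_gap :: "real \<Rightarrow> 'n cmat" where
  "resolvent_gap u = J (\<lambda>i. 1 / of_real (ratio i + u)) - JN (\<lambda>i. 1 / of_real (ratio i + u))"

text \<open>The difference of the resolvent functionals at \<open>mat 1\<close>, expressed by the
  spectral measures. It will turn out to be the energy of the Galerkin error, which also shows that
  it is nonnegative.\<close>

definition form_gap :: "real \<Rightarrow> real" where
  "form_gap u = (\<Sum>i\<in>pairs. wt i / (ratio i + u)) - (\<Sum>i\<in>pairsN. wtN i / (ratio i + u))"

lemma resolvent_gap_closed: "resolvent_gap u \<in> M"
  unfolding resolvent_gap_def using J_closed JN_closed by auto

lemma trace_sigma_J:
  "Re (\<tau> (J (\<lambda>i. 1 / of_real (ratio i + u)) ** \<sigma>)) = (\<Sum>i\<in>pairs. wt i / (ratio i + u))"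
proof -
  have "\<tau> (J (\<lambda>i. 1 / of_real (ratio i + u)) ** \<sigma>) = of_real (\<Sum>i\<in>pairs. wt i / (ratio i + u))"
    unfolding trace_joint[OF rho(1,2) sigma(1,2)] by simp
  then show ?thesis by (simp only: Re_complex_of_real)
qed

lemma trace_sigma_JN:
  "Re (\<tau> (JN (\<lambda>i. 1 / of_real (ratio i + u)) ** \<sigma>)) = (\<Sum>i\<in>pairsN. wtN i / (ratio i + u))"
proof -
  have "\<tau> (JN (\<lambda>i. 1 / of_real (ratio i + u)) ** \<sigma>) = \<tau> (JN (\<lambda>i. 1 / of_real (ratio i + u)) ** \<sigma>N)"
    using JN_closed(1) sigma(2) by (intro cond_exp_right[symmetric]) auto
  also have "\<dots> = of_real (\<Sum>i\<in>pairsN. wtN i / (ratio i + u))"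
    unfolding trace_joint[OF rhoN(1,3) sigmaN(1,3)] by simp
  finally show ?thesis by (simp only: Re_complex_of_real)
qed

text \<open>The two resolvents represent the same functional \<open>z \<mapsto> \<tau> (z\<^sup>* \<sigma>)\<close> for the same form, on \<open>M\<close> and on \<open>N\<close>:
  the gap is the error of a Galerkin approximation.\<close>

lemma form_gap_ge:
  assumes u: "u > 0"
  shows "u * (wnorm (resolvent_gap u))\<^sup>2 \<le> form_gap u"
proof -
  define y where "y = J (\<lambda>i. 1 / of_real (ratio i + u))"
  define yN where "yN = JN (\<lambda>i. 1 / of_real (ratio i + u))"
  \<comment> \<open>The form of the relative modular operator plus \<open>u\<close>: in the inner
    product weighted by \<sigma>, the factor \<sigma> cancels the inverse in
    \<open>\<rho> ** z ** mpow \<sigma> (- 1)\<close>.\<close>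
  define b where "b = (\<lambda>x z. \<tau> (cadj x ** \<rho> ** z) + of_real u * \<tau> (cadj x ** z ** \<sigma>))"
  have M: "y \<in> M" "yN \<in> M" "yN \<in> N" "\<rho> \<in> M" "\<sigma> \<in> M"
    using J_closed JN_closed rho sigma by (auto simp: y_def yN_def)
  have y: "\<rho> ** y + cscale (of_real u) (y ** \<sigma>) = \<sigma>"
    unfolding y_def by (rule joint_resolvent[OF rho(1) sigma(1) u])
  have yN: "\<rho>N ** yN + cscale (of_real u) (yN ** \<sigma>N) = \<sigma>N"
    unfolding yN_def by (rule joint_resolvent[OF rhoN(1) sigmaN(1) u])
  have bM: "b x y = \<tau> (cadj x ** \<sigma>)" if "x \<in> M" for x
  proof -
    have "\<tau> (cadj x ** \<sigma>) = \<tau> (cadj x ** \<rho> ** y + cscale (of_real u) (cadj x ** y ** \<sigma>))"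
      by (subst y[symmetric]) (simp add: mat_mult_add matrix_mul_assoc)
    also have "\<dots> = b x y" unfolding b_def using that M
      by (simp add: trace_add trace_cscale cscale_closed mult_closed cadj_closed)
    finally show ?thesis by simp
  qed
  \<comment> \<open>For test vectors in \<open>N\<close> both \<rho> and \<sigma> may be replaced by
    their conditional expectations, because \<open>yN\<close> and \<open>x\<close> lie in
    \<open>N\<close>; so the smaller problem is the restriction of the same form.\<close>
  have bN: "b x yN = \<tau> (cadj x ** \<sigma>)" if x: "x \<in> N" for x
  proof -
    have xM: "x \<in> M" "cadj x \<in> M" "cadj x \<in> N" using x by auto
    have 1: "\<tau> (cadj x ** \<rho> ** yN) = \<tau> (cadj x ** \<rho>N ** yN)"
    proof -
      have "\<tau> (cadj x ** \<rho> ** yN) = \<tau> (yN ** (cadj x ** \<rho>))" using xM M by (intro trace_commute) auto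
      also have "\<dots> = \<tau> ((yN ** cadj x) ** \<rho>)" by (simp add: matrix_mul_assoc)
      also have "\<dots> = \<tau> ((yN ** cadj x) ** \<rho>N)" using xM M by (intro cond_exp_right[symmetric]) auto
      also have "\<dots> = \<tau> (yN ** (cadj x ** \<rho>N))" by (simp add: matrix_mul_assoc)
      also have "\<dots> = \<tau> (cadj x ** \<rho>N ** yN)" using xM M rhoN by (intro trace_commute) auto
      finally show ?thesis .
    qed
    have 2: "\<tau> (cadj x ** yN ** \<sigma>) = \<tau> (cadj x ** yN ** \<sigma>N)"
      using xM M by (intro cond_exp_right[symmetric]) auto
    have "\<tau> (cadj x ** \<sigma>) = \<tau> (cadj x ** \<sigma>N)" using xM M by (intro cond_exp_right[symmetric])
    also have "\<dots> = \<tau> (cadj x ** \<rho>N ** yN + cscale (of_real u) (cadj x ** yN ** \<sigma>N))"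
      by (subst yN[symmetric]) (simp add: mat_mult_add matrix_mul_assoc)
    also have "\<dots> = b x yN" unfolding b_def 1 2 using xM M rhoN(3) sigmaN(3)
      by (simp add: trace_add trace_cscale cscale_closed mult_closed)
    finally show ?thesis by simp
  qed
  have herm: "b z x = cnj (b x z)" if "x \<in> M" "z \<in> M" for x z
  proof -
    have "cadj \<rho> = \<rho>" "cadj \<sigma> = \<sigma>" using posdef_hermitian rho sigma by (auto simp: hermitian_def)
    then have 1: "cnj (\<tau> (cadj x ** \<rho> ** z)) = \<tau> (cadj z ** \<rho> ** x)"
      and 2: "cnj (\<tau> (cadj x ** z ** \<sigma>)) = \<tau> (\<sigma> ** (cadj z ** x))"
      using that M trace_cadj[of "cadj x ** \<rho> ** z"] trace_cadj[of "cadj x ** z ** \<sigma>"]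
      by (simp_all add: mult_closed cadj_closed matrix_mul_assoc)
    have 3: "\<tau> (\<sigma> ** (cadj z ** x)) = \<tau> (cadj z ** x ** \<sigma>)"
      using that M by (intro trace_commute) auto
    show ?thesis by (simp add: b_def 1 2 3)
  qed
  have cs: "Re (\<tau> (cadj x ** \<sigma>)) = Re (\<tau> (x ** \<sigma>))" if "x \<in> M" for x
  proof -
    have "cadj \<sigma> = \<sigma>" using posdef_hermitian sigma by (auto simp: hermitian_def)
    then have "\<tau> (\<sigma> ** x) = cnj (\<tau> (cadj x ** \<sigma>))"
      using trace_cadj[of "cadj x ** \<sigma>"] that M by (simp add: mult_closed cadj_closed)
    then show ?thesis using trace_commute[OF that M(5)] by simp
  qed
  define U where "U = y - yN"
  have UM: "U \<in> M" using M by (auto simp: U_def)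
  have "b U U = b y y - b y yN - b yN y + b yN yN"
  proof -
    have 1: "cadj U ** \<rho> ** U = (cadj y ** \<rho> ** y - cadj y ** \<rho> ** yN) - (cadj yN ** \<rho> ** y - cadj yN ** \<rho> ** yN)"
      and 2: "cadj U ** U ** \<sigma> = (cadj y ** y ** \<sigma> - cadj y ** yN ** \<sigma>) - (cadj yN ** y ** \<sigma> - cadj yN ** yN ** \<sigma>)"
      by (simp_all add: U_def mat_diff_mult mat_mult_diff)
    show ?thesis unfolding b_def 1 2 using M
      by (simp add: trace_diff mult_closed cadj_closed diff_closed) (simp add: algebra_simps)
  qed
  \<comment> \<open>Galerkin orthogonality: tested at \<open>yN\<close>, both solutions give
    \<open>\<tau> (cadj yN ** \<sigma>)\<close>, so the cross terms and the last term combine into a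
    single \<open>- Re (\<tau> (yN ** \<sigma>))\<close>.\<close>
  also have "Re \<dots> = Re (\<tau> (y ** \<sigma>)) - Re (\<tau> (yN ** \<sigma>))"
    using herm[OF M(2,1)] by (simp add: bM bN M cs)
  also have "\<dots> = form_gap u"
    unfolding form_gap_def y_def yN_def trace_sigma_J trace_sigma_JN ..
  finally have gap: "Re (b U U) = form_gap u" .
  \<comment> \<open>The part of the energy coming from \<rho> is nonnegative and is dropped; the
    \<sigma> part alone is \<open>u\<close> times the squared norm.\<close>
  have "Re (\<tau> (cadj U ** \<rho> ** U)) \<ge> 0"
  proof -
    let ?h = "mpow \<rho> (1 / 2)"
    have h: "?h \<in> M" "cadj ?h = ?h" "?h ** ?h = \<rho>"
      using mpow_closed rho cadj_mpow[OF rho(1)] mpow_mult[OF rho(1), of "1 / 2" "1 / 2"] mpow_one[OF rho(1)] by auto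
    have "cadj U ** \<rho> ** U = cadj (?h ** U) ** (?h ** U)"
      unfolding cadj_mult h(2) by (subst h(3)[symmetric]) (simp only: matrix_mul_assoc)
    then show ?thesis using trace_nonneg[of "?h ** U"] h UM by (simp add: mult_closed del: cadj_mult)
  qed
  moreover have "Re (\<tau> (cadj U ** U ** \<sigma>)) = (wnorm U)\<^sup>2"
    using wnorm_square[OF UM] by (metis Re_complex_of_real)
  ultimately have "u * (wnorm U)\<^sup>2 \<le> Re (b U U)" by (simp add: b_def)
  then show ?thesis unfolding gap by (simp add: U_def resolvent_gap_def y_def yN_def)
qed

lemma form_gap_nonneg: "u > 0 \<Longrightarrow> form_gap u \<ge> 0"
  using form_gap_ge[of u] by (smt (verit) mult_nonneg_nonneg zero_le_power2)

lemma wnorm_resolvent_gap_le: "u > 0 \<Longrightarrow> wnorm (resolvent_gap u) \<le> 2 / u"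
proof -
  assume u: "u > 0"
  have c: "cmod (1 / of_real (x + u)) \<le> 1 / u" if "x > 0" for x
    using u that by (simp add: norm_divide frac_le flip: of_real_add)
  have "wnorm (resolvent_gap u) \<le> 1 / u + 1 / u"
    unfolding resolvent_gap_def
    using u by (intro order_trans[OF wnorm_triangle[OF J_closed JN_closed(2)]] add_mono
        wnorm_J_le[OF c[OF pairs(2)]] wnorm_JN_le[OF c[OF pairsN(2)]]) auto
  then show ?thesis by simp
qed

text \<open>In \<open>1/(x+u) = 1/u - x/(u(x+u))\<close> the first summand contributes the same
  multiple of \<open>mat 1\<close> on both sides and cancels. The second is at most
  \<open>x/u^2\<close>, which gains a power of \<open>u\<close> at the price of the second
  moment.\<close>

lemma wnorm_resolvent_gap_le_sqrt_Q: "u > 0 \<Longrightarrow> wnorm (resolvent_gap u) \<le> 2 * sqrt Q / u\<^sup>2"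
proof -
  assume u: "u > 0"
  let ?f = "\<lambda>i. complex_of_real (ratio i / (u * (ratio i + u)))"
  have eq: "1 / complex_of_real (x + u) = of_real (1 / u) - of_real (x / (u * (x + u)))" if "x > 0" for x
  proof -
    have "1 / (x + u) = 1 / u - x / (u * (x + u))" using u that add_pos_pos[OF that u] by (simp add: divide_simps)
    then show ?thesis by (metis of_real_1 of_real_diff of_real_divide)
  qed
  have "J (\<lambda>i. 1 / of_real (ratio i + u)) = J (\<lambda>i. of_real (1 / u) * 1 - ?f i)"
    by (rule joint_cong[OF rho(1) sigma(1)]) (simp only: mult_1_right eq[OF pairs(2)])
  then have "J (\<lambda>i. 1 / of_real (ratio i + u)) = cscale (of_real (1 / u)) (mat 1) - J ?f"
    by (simp only: joint_diff[OF rho(1) sigma(1), symmetric] joint_cscale[OF rho(1) sigma(1), symmetric] joint_one[OF rho(1) sigma(1)])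
  moreover have "JN (\<lambda>i. 1 / of_real (ratio i + u)) = JN (\<lambda>i. of_real (1 / u) * 1 - ?f i)"
    by (rule joint_cong[OF rhoN(1) sigmaN(1)]) (simp only: mult_1_right eq[OF pairsN(2)])
  then have "JN (\<lambda>i. 1 / of_real (ratio i + u)) = cscale (of_real (1 / u)) (mat 1) - JN ?f"
    by (simp only: joint_diff[OF rhoN(1) sigmaN(1), symmetric] joint_cscale[OF rhoN(1) sigmaN(1), symmetric] joint_one[OF rhoN(1) sigmaN(1)])
  ultimately have gap: "resolvent_gap u = JN ?f - J ?f" by (simp add: resolvent_gap_def)
  have c: "cmod (of_real (x / (u * (x + u)))) \<le> 1 / u\<^sup>2 * x" if "x > 0" for x
  proof -
    have "x / (u * (x + u)) \<le> x / (u * u)" using u that by (intro divide_left_mono mult_left_mono) auto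
    then show ?thesis using u that by (simp only: norm_of_real) (simp add: power2_eq_square)
  qed
  have "wnorm (resolvent_gap u) \<le> 1 / u\<^sup>2 * sqrt Q + 1 / u\<^sup>2 * sqrt Q"
    unfolding gap
    using u by (intro order_trans[OF wnorm_triangle[OF JN_closed(2) J_closed]] add_mono
        wnorm_J_le_sqrt_Q[OF c[OF pairs(2)]] wnorm_JN_le_sqrt_Q[OF c[OF pairsN(2)]]) auto
  then show ?thesis by simp
qed

lemma has_integral_form_gap:
  assumes s: "s \<in> {-1<..<0} \<union> {0<..<1}"
  shows "((\<lambda>u. u powr (1 - s) * form_gap u) has_integral
     (pi / sin (pi * \<bar>s\<bar>) * cmod (Q_s \<tau> s \<rho> \<sigma> - Q_s \<tau> s \<rho>N \<sigma>N))) {0<..}"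
proof -
  \<comment> \<open>A disjoint sum, since the two spectra may share pairs; the two spectral measures
    become one signed measure with masses \<open>c\<close> at the points \<open>x\<close>.\<close>
  define I where "I = pairs <+> pairsN"
  define c where "c = case_sum wt (\<lambda>i. - wtN i)"
  define x where "x = case_sum (\<lambda>i. ratio i) (\<lambda>i. ratio i)"
  have fin: "finite I" using pairs pairsN by (simp add: I_def)
  have sum_I: "(\<Sum>i\<in>I. c i * g (x i)) = (\<Sum>i\<in>pairs. wt i * g (ratio i)) - (\<Sum>i\<in>pairsN. wtN i * g (ratio i))" for g
    unfolding I_def using pairs(1) pairsN(1) by (simp add: sum.Plus c_def x_def sum_negf comp_def)
  define B where "B = (\<Sum>i\<in>I. c i * x i powr (1 - s))"
  have "((\<lambda>u. u powr (1 - s) * (\<Sum>i\<in>I. c i / (x i + u))) has_integral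
     (- sgn s * (pi / sin (pi * \<bar>s\<bar>) * B))) {0<..}"
    unfolding B_def
  proof (rule has_integral_resolvent_sum_quasi_entropy[OF fin _ _ _ s])
    show "x i > 0" if "i \<in> I" for i using that pairs(2) pairsN(2) by (auto simp: I_def x_def)
    show "sum c I = 0" using sum_I[of "\<lambda>_. 1"] pairs(4) pairsN(4) by simp
    show "(\<Sum>i\<in>I. c i * x i) = 0" using sum_I[of "\<lambda>x. x"] pairs(5) pairsN(5) by simp
  qed
  moreover have "(\<Sum>i\<in>I. c i / (x i + u)) = form_gap u" for u
    using sum_I[of "\<lambda>x. 1 / (x + u)"] by (simp add: form_gap_def)
  ultimately have int: "((\<lambda>u. u powr (1 - s) * form_gap u) has_integral (- sgn s * (pi / sin (pi * \<bar>s\<bar>) * B))) {0<..}"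
    by simp
  \<comment> \<open>Nonnegativity of \<open>form_gap\<close> decides the sign of \<open>B\<close>,
    so the integral is the absolute value of the entropy difference for either sign of
    \<open>s\<close>.\<close>
  have "- sgn s * (pi / sin (pi * \<bar>s\<bar>) * B) \<ge> 0"
    by (rule has_integral_nonneg[OF int]) (simp add: form_gap_nonneg)
  moreover have sin: "pi / sin (pi * \<bar>s\<bar>) > 0" using sin_pi_abs_pos[OF s] by simp
  moreover have "\<bar>- sgn s * (pi / sin (pi * \<bar>s\<bar>) * B)\<bar> = pi / sin (pi * \<bar>s\<bar>) * \<bar>B\<bar>"
    unfolding abs_mult[of "pi / _"] abs_mult[of "- sgn s"] abs_of_pos[OF sin] using s by (auto simp: abs_sgn_eq)
  ultimately have "- sgn s * (pi / sin (pi * \<bar>s\<bar>) * B) = pi / sin (pi * \<bar>s\<bar>) * \<bar>B\<bar>" by linarith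
  moreover have "cmod (Q_s \<tau> s \<rho> \<sigma> - Q_s \<tau> s \<rho>N \<sigma>N) = \<bar>B\<bar>"
    unfolding Q_s_eq[OF rho(1,2) sigma(1,2)] Q_s_eq[OF rhoN(1,3) sigmaN(1,3)] of_real_diff[symmetric] norm_of_real
    unfolding B_def sum_I[of "\<lambda>x. x powr (1 - s)"] ..
  ultimately show ?thesis using int by simp
qed

text \<open>The difference of the two relative modular operators raised to \<open>1/2 + it\<close>
  and applied to \<open>mat 1\<close>.\<close>

definition modular_gap :: "real \<Rightarrow> 'n cmat" where
  "modular_gap t = mpow \<rho> (1 / 2 + \<i> * of_real t) ** mpow \<sigma> (- (1 / 2 + \<i> * of_real t)) -
     mpow \<rho>N (1 / 2 + \<i> * of_real t) ** mpow \<sigma>N (- (1 / 2 + \<i> * of_real t))"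

lemma modular_gap_closed: "modular_gap t \<in> M"
  unfolding modular_gap_def using mpow_closed rho sigma rhoN sigmaN by auto

text \<open>Pairing with \<open>v\<close> makes the resolvent identity scalar, with complex
  coefficients. They sum to 0 because both joint calculi send the constant 1 to
  \<open>mat 1\<close>.\<close>

lemma has_integral_modular_gap:
  assumes v: "v \<in> M"
  shows "((\<lambda>u. of_real u powr (1 / 2 + \<i> * of_real t) * \<tau> (cadj v ** resolvent_gap u ** \<sigma>)) has_integral
     - (of_real (pi / cosh (pi * t)) * \<tau> (cadj v ** modular_gap t ** \<sigma>))) {0<..}"
proof -
  define I where "I = pairs <+> pairsN"
  define l where "l = (\<lambda>m. \<tau> (cadj v ** m ** \<sigma>))"
  define c where "c = case_sum (\<lambda>i. l (pairproj \<rho> \<sigma> i)) (\<lambda>i. - l (pairproj \<rho>N \<sigma>N i))"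
  define x where "x = case_sum (\<lambda>i. ratio i) (\<lambda>i. ratio i)"
  have fin: "finite I" using pairs pairsN by (simp add: I_def)
  have P: "pairproj \<rho> \<sigma> i \<in> M" "pairproj \<rho>N \<sigma>N i \<in> M" for i
    using pairproj_closed rho sigma rhoN sigmaN by blast+
  have lM: "cadj v \<in> M" "\<sigma> \<in> M" using v sigma by auto
  have l_diff: "l (a - b) = l a - l b" if "a \<in> M" "b \<in> M" for a b
    unfolding l_def using that lM by (simp add: mat_mult_diff mat_diff_mult trace_diff mult_closed)
  have l_sum: "l (\<Sum>i\<in>S. cscale (f i) (m i)) = (\<Sum>i\<in>S. f i * l (m i))" if "\<And>i. m i \<in> M"
    for S and f :: "real \<times> real \<Rightarrow> complex" and m
    unfolding l_def using that lM
    by (simp add: mat_mult_sum sum_mat_mult trace_sum trace_cscale cscale_closed mult_closed)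
  have sum_I: "(\<Sum>i\<in>I. c i * g (x i)) = l (J (\<lambda>i. g (ratio i)) - JN (\<lambda>i. g (ratio i)))" for g
  proof -
    have "l (J (\<lambda>i. g (ratio i)) - JN (\<lambda>i. g (ratio i))) = l (J (\<lambda>i. g (ratio i))) - l (JN (\<lambda>i. g (ratio i)))"
      by (rule l_diff[OF J_closed JN_closed(2)])
    also have "\<dots> = (\<Sum>i\<in>pairs. g (ratio i) * l (pairproj \<rho> \<sigma> i)) - (\<Sum>i\<in>pairsN. g (ratio i) * l (pairproj \<rho>N \<sigma>N i))"
      unfolding joint_def using P by (simp only: l_sum)
    also have "\<dots> = (\<Sum>i\<in>I. c i * g (x i))"
      unfolding I_def using pairs(1) pairsN(1) by (simp add: sum.Plus c_def x_def sum_negf comp_def mult.commute)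
    finally show ?thesis by simp
  qed
  have "((\<lambda>u. of_real u powr (1 / 2 + \<i> * of_real t) * (\<Sum>i\<in>I. c i / of_real (x i + u))) has_integral
     - (of_real (pi / cosh (pi * t)) * (\<Sum>i\<in>I. c i * of_real (x i) powr (1 / 2 + \<i> * of_real t)))) {0<..}"
  proof (rule has_integral_resolvent_sum_complex[OF fin])
    show "x i > 0" if "i \<in> I" for i using that pairs(2) pairsN(2) by (auto simp: I_def x_def)
    have "l (mat 1 - mat 1) = 0" using l_diff[OF one_closed one_closed] by simp
    then show "sum c I = 0" using sum_I[of "\<lambda>_. 1"] 
      by (simp add: joint_one[OF rho(1) sigma(1)] joint_one[OF rhoN(1) sigmaN(1)])
  qed
  moreover have "(\<Sum>i\<in>I. c i / of_real (x i + u)) = l (resolvent_gap u)" for u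
    using sum_I[of "\<lambda>x. 1 / of_real (x + u)"] by (simp add: resolvent_gap_def)
  moreover have "(\<Sum>i\<in>I. c i * of_real (x i) powr (1 / 2 + \<i> * of_real t)) = l (modular_gap t)"
    unfolding modular_gap_def mpow_mult_mpow_minus[OF rho(1) sigma(1)] mpow_mult_mpow_minus[OF rhoN(1) sigmaN(1)]
    by (rule sum_I)
  ultimately show ?thesis by (simp only: l_def)
qed

text \<open>Duality: the modular gap is paired with itself, Cauchy-Schwarz is applied under the
  integral, and one factor of its norm is divided out. An integrable majorant \<open>h\<close>
  replaces any integrability claim for the norm of the gap.\<close>

lemma wnorm_modular_gap_le:
  assumes h: "(h has_integral H) {0<..}"
    and le: "\<And>u. u > 0 \<Longrightarrow> sqrt u * wnorm (resolvent_gap u) \<le> h u"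
  shows "pi / cosh (pi * t) * wnorm (modular_gap t) \<le> H"
proof -
  define Z where "Z = modular_gap t"
  have Z: "Z \<in> M" by (simp add: Z_def modular_gap_closed)
  have cosh: "pi / cosh (pi * t) > 0" using cosh_real_pos by simp
  note int = has_integral_modular_gap[OF Z, of t, folded Z_def]
  have "norm (integral {0<..} (\<lambda>u. of_real u powr (1 / 2 + \<i> * of_real t) * \<tau> (cadj Z ** resolvent_gap u ** \<sigma>)))
      \<le> integral {0<..} (\<lambda>u. wnorm Z * h u)"
  proof (rule integral_norm_bound_integral)
    show "(\<lambda>u. of_real u powr (1 / 2 + \<i> * of_real t) * \<tau> (cadj Z ** resolvent_gap u ** \<sigma>)) integrable_on {0<..}"
      using int by (auto simp: integrable_on_def)
    show "(\<lambda>u. wnorm Z * h u) integrable_on {0<..}"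
      using has_integral_mult_right[OF h] by (auto simp: integrable_on_def)
    fix u :: real assume "u \<in> {0<..}"
    then have u: "u > 0" by simp
    have "cmod (of_real u powr (1 / 2 + \<i> * of_real t)) = sqrt u"
      using u by (simp add: norm_powr_real_powr powr_half_sqrt)
    then have "norm (of_real u powr (1 / 2 + \<i> * of_real t) * \<tau> (cadj Z ** resolvent_gap u ** \<sigma>)) =
        sqrt u * cmod (\<tau> (cadj Z ** resolvent_gap u ** \<sigma>))" by (simp only: norm_mult)
    also have "\<dots> \<le> sqrt u * (wnorm Z * wnorm (resolvent_gap u))"
      using u by (intro mult_left_mono weighted_cauchy_schwarz Z resolvent_gap_closed) auto
    also have "\<dots> = wnorm Z * (sqrt u * wnorm (resolvent_gap u))" by simp
    also have "\<dots> \<le> wnorm Z * h u" using le[OF u] wnorm_nonneg[OF Z] by (intro mult_left_mono)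
    finally show "norm (of_real u powr (1 / 2 + \<i> * of_real t) * \<tau> (cadj Z ** resolvent_gap u ** \<sigma>)) \<le> wnorm Z * h u" .
  qed
  then have "norm (- (of_real (pi / cosh (pi * t)) * \<tau> (cadj Z ** Z ** \<sigma>))) \<le> wnorm Z * H"
    using int has_integral_mult_right[OF h, of "wnorm Z"] by (simp only: integral_unique)
  then have "pi / cosh (pi * t) * (wnorm Z)\<^sup>2 \<le> wnorm Z * H"
    unfolding wnorm_square[OF Z, symmetric] norm_minus_cancel norm_mult norm_of_real
    using cosh by (simp only: abs_of_pos abs_power2)
  then have le2: "wnorm Z * (pi / cosh (pi * t) * wnorm Z) \<le> wnorm Z * H"
    by (simp only: power2_eq_square mult_ac)
  have "H \<ge> 0"
    by (rule has_integral_nonneg[OF h])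
      (metis greaterThan_iff le mult_nonneg_nonneg order_trans real_sqrt_ge_zero less_imp_le wnorm_nonneg resolvent_gap_closed)
  show ?thesis
  proof (cases "wnorm Z = 0")
    case True
    then show ?thesis using \<open>H \<ge> 0\<close> by (simp add: Z_def)
  next
    case False
    then have "wnorm Z > 0" using wnorm_nonneg[OF Z] by simp
    with le2 show ?thesis unfolding Z_def[symmetric] by (metis mult_le_cancel_left_pos)
  qed
qed

end

section \<open>Splitting the integral\<close>

text \<open>Optimising over \<open>y\<close> recovers the Cauchy-Schwarz bound. The weight stays
  free until after integration, so the mean inequality can be used pointwise and only integrals of
  known functions occur.\<close>

lemma le_add_sqrt_of_weighted_am_gm:
  fixes X C A B :: real
  assumes le: "\<And>y. y > 0 \<Longrightarrow> X \<le> C + y / 2 * A + B / (2 * y)" and AB: "A \<ge> 0" "B \<ge> 0"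
  shows "X \<le> C + sqrt (A * B)"
proof (cases "A = 0 \<or> B = 0")
  case False
  with AB have pos: "A > 0" "B > 0" by auto
  let ?y = "sqrt B / sqrt A"
  have eq: "B = sqrt B * sqrt B" "A = sqrt A * sqrt A" using AB by simp_all
  have y: "?y > 0" using pos by simp
  have e1: "?y / 2 * A = sqrt A * sqrt B / 2" using pos by (subst (2) eq(2)) (simp add: field_simps)
  have e2: "B / (2 * ?y) = sqrt A * sqrt B / 2" using pos by (subst (1) eq(1)) (simp add: field_simps)
  show ?thesis using le[OF y, unfolded e1 e2] by (simp add: real_sqrt_mult)
next
  case True
  have "X \<le> C"
  proof (rule field_le_epsilon)
    fix e :: real assume e: "e > 0"
    show "X \<le> C + e"
    proof (cases "A = 0")
      case True
      \<comment> \<open>A large weight makes the last summand small; the added 1 keeps the weight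
        positive when \<open>B = 0\<close>.\<close>
      have "B / (2 * ((B + 1) / e)) \<le> e"
        using e AB by (simp add: field_simps)
      moreover have "(B + 1) / e > 0" using e AB by simp
      ultimately show ?thesis using le[of "(B + 1) / e"] True by simp
    next
      case False
      then have "B = 0" "A > 0" using \<open>A = 0 \<or> B = 0\<close> AB by auto
      then show ?thesis using le[of "2 * e / A"] e by simp
    qed
  qed
  with True show ?thesis by auto
qed

lemma mult_exp_minus_le: "w * exp (- w) \<le> exp (- 1)" for w :: real
proof -
  have "w \<le> exp (w - 1)" using exp_ge_add_one_self[of "w - 1"] by simp
  then have "w * exp (- w) \<le> exp (w - 1) * exp (- w)" by (intro mult_right_mono) auto
  then show ?thesis by (simp flip: exp_add)
qed

text \<open>The inequality \<open>w exp (- w) \<le> 1/e\<close> at \<open>w = d ln (1/x)\<close>;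
  this is where the number e in \<open>K\<close> originates.\<close>

lemma powr_mult_ln_le:
  fixes x d :: real
  assumes "0 < x" "0 < d"
  shows "x powr d * ln (1 / x) \<le> 1 / (exp 1 * d)"
proof -
  have "d * ln (1 / x) * exp (- (d * ln (1 / x))) \<le> exp (- 1)" by (rule mult_exp_minus_le)
  also have "exp (- (d * ln (1 / x))) = x powr d" using assms by (simp add: powr_def ln_div)
  finally have "d * (x powr d * ln (1 / x)) \<le> exp (- 1)" by (simp add: mult_ac)
  then have "x powr d * ln (1 / x) \<le> exp (- 1) / d" using assms by (simp add: field_simps)
  then show ?thesis by (simp add: exp_minus divide_simps)
qed

text \<open>The cut point will be a power of \<open>D\<close> and must be positive; the case
  \<open>D = 0\<close> is reached by a limit.\<close>

lemma le_powr_of_forall_gt: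
  fixes x D \<theta> :: real
  assumes "\<And>D'. D' > 0 \<Longrightarrow> D \<le> D' \<Longrightarrow> x \<le> D' powr \<theta>" and D: "D \<ge> 0" and \<theta>: "\<theta> > 0"
  shows "x \<le> D powr \<theta>"
proof (cases "D = 0")
  case True
  have "x \<le> 0"
  proof (rule field_le_epsilon)
    fix e :: real assume "e > 0"
    then show "x \<le> 0 + e" using assms(1)[of "e powr (1 / \<theta>)"] True \<theta> by (simp add: powr_powr)
  qed
  with True show ?thesis by simp
qed (use assms in auto)

lemma powr_le_of_le_powr:
  fixes x D \<theta> :: real
  assumes "x \<le> D powr \<theta>" "x \<ge> 0" "D \<ge> 0" "\<theta> > 0"
  shows "x powr (1 / \<theta>) \<le> D"
proof -
  have "x powr (1 / \<theta>) \<le> (D powr \<theta>) powr (1 / \<theta>)" using assms by (intro powr_mono2) auto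
  also have "\<dots> = D" using assms by (simp add: powr_powr)
  finally show ?thesis .
qed

context recovery
begin

text \<open>With cuts at \<open>a\<close> and \<open>1/a\<close> both ends are of order
  \<open>sqrt a\<close>: the bound \<open>2/u\<close> yields \<open>4 sqrt a\<close> below and the
  bound with \<open>Q\<close> yields \<open>4 sqrt Q sqrt a\<close> above. The middle weight
  \<open>1/u\<close> integrates to \<open>2 ln (1/a)\<close>.\<close>

lemma wnorm_modular_gap_split:
  assumes s: "s \<in> {-1<..<0} \<union> {0<..<1}" and a: "0 < a" "a \<le> 1"
  shows "pi / cosh (pi * t) * wnorm (modular_gap t) \<le> 4 * sqrt a + 4 * sqrt Q * sqrt a +
    sqrt (pi / sin (pi * \<bar>s\<bar>) * cmod (Q_s \<tau> s \<rho> \<sigma> - Q_s \<tau> s \<rho>N \<sigma>N) * ((1 / a) powr \<bar>s\<bar> * (2 * ln (1 / a))))"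
proof -
  let ?D = "cmod (Q_s \<tau> s \<rho> \<sigma> - Q_s \<tau> s \<rho>N \<sigma>N)"
  let ?L = "(1 / a) powr \<bar>s\<bar>"
  have b1: "1 \<le> 1 / a" using a by simp
  have b: "a \<le> 1 / a" "1 \<le> 1 / a" by (rule order_trans[OF a(2) b1], rule b1)
  have sin: "pi / sin (pi * \<bar>s\<bar>) > 0" using sin_pi_abs_pos[OF s] by simp
  have "pi / cosh (pi * t) * wnorm (modular_gap t) \<le> (4 * sqrt a + 4 * sqrt Q * sqrt a) +
      y / 2 * (pi / sin (pi * \<bar>s\<bar>) * ?D) + ?L * (2 * ln (1 / a)) / (2 * y)" if y: "y > 0" for y
  proof -
    let ?p = "\<lambda>u. if u < a then 2 * u powr (1 / 2 - 1) else if u \<le> 1 / a then (?L / (2 * y)) / u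
      else (2 * sqrt Q) * u powr (- (1 / 2) - 1)"
    let ?h = "\<lambda>u. y / 2 * (u powr (1 - s) * form_gap u) + ?p u"
    have int: "(?h has_integral (y / 2 * (pi / sin (pi * \<bar>s\<bar>) * ?D) +
        (2 * a powr (1 / 2) / (1 / 2) + ?L / (2 * y) * ln (1 / a / a) + 2 * sqrt Q * (1 / a) powr (- (1 / 2)) / (1 / 2)))) {0<..}"
      by (intro has_integral_add has_integral_mult_right has_integral_form_gap s has_integral_piecewise_powr[OF a(1) b(1)]) simp
    have le: "sqrt u * wnorm (resolvent_gap u) \<le> ?h u" if u: "u > 0" for u
    proof -
      let ?g = "wnorm (resolvent_gap u)"
      \<comment> \<open>The entropy term stands in \<open>?h\<close> on the whole half-line, because
        only its full integral is known; at the two ends it is a harmless nonnegative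
        surplus.\<close>
      have G: "0 \<le> y / 2 * (u powr (1 - s) * form_gap u)" using form_gap_nonneg[OF u] y by simp
      have g: "?g \<ge> 0" by (rule wnorm_nonneg[OF resolvent_gap_closed])
      consider "u < a" | "a \<le> u" "u \<le> 1 / a" | "u > 1 / a" by linarith
      then show ?thesis
      proof cases
        case 1
        have "sqrt u * ?g \<le> sqrt u * (2 / u)" using wnorm_resolvent_gap_le[OF u] u by (intro mult_left_mono) auto
        also have "\<dots> = 2 * u powr (1 / 2 - 1)" unfolding powr_diff using u by (simp add: powr_half_sqrt)
        finally show ?thesis using G 1 by simp
      next
        case 2
        \<comment> \<open>The upper cut serves \<open>s > 0\<close>, the lower one
          \<open>s < 0\<close>; reciprocal cuts give the same bound in both cases.\<close>
        have uL: "u powr s \<le> ?L"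
        proof (cases "s > 0")
          case True
          then show ?thesis using 2 u by (simp add: powr_mono2)
        next
          case False
          have "u powr s \<le> a powr s" using False 2 a by (intro powr_mono2') auto
          also have "a powr s = ?L" using False a by (simp add: powr_divide powr_minus_divide)
          finally show ?thesis .
        qed
        \<comment> \<open>The powers of \<open>u\<close> are split so that \<open>A * B\<close> is
          exactly the square of \<open>sqrt u * ?g\<close>, with \<open>A\<close> below the entropy
          integrand.\<close>
        define A where "A = y * (u powr (1 - s) * (u * ?g\<^sup>2))"
        define B where "B = u powr s / (y * u)"
        have AB: "A \<ge> 0" "B \<ge> 0" using y u by (auto simp: A_def B_def)
        have "A * B = u powr (1 - s) * u powr s * ?g\<^sup>2" using y u by (simp add: A_def B_def)
        also have "u powr (1 - s) * u powr s = u" using u by (simp flip: powr_add)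
        finally have "sqrt u * ?g = sqrt (A * B)" using g by (simp add: real_sqrt_mult)
        also have "\<dots> \<le> (A + B) / 2" by (rule arith_geo_mean_sqrt[OF AB])
        also have "\<dots> \<le> (y * (u powr (1 - s) * form_gap u) + ?L / (y * u)) / 2"
        proof (intro divide_right_mono add_mono)
          show "A \<le> y * (u powr (1 - s) * form_gap u)"
            unfolding A_def using y form_gap_ge[OF u] by (intro mult_left_mono) auto
          show "B \<le> ?L / (y * u)" unfolding B_def using uL y u by (intro divide_right_mono) auto
        qed simp
        also have "\<dots> = ?h u" using 2 by (simp add: add_divide_distrib)
        finally show ?thesis .
      next
        case 3
        have "sqrt u * ?g \<le> sqrt u * (2 * sqrt Q / u\<^sup>2)"
          using wnorm_resolvent_gap_le_sqrt_Q[OF u] u by (intro mult_left_mono) auto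
        also have "\<dots> = (2 * sqrt Q) * u powr (- (1 / 2) - 1)"
        proof -
          have "u powr (- (1 / 2) - 1) = u powr (1 / 2 - 2)" by simp
          also have "\<dots> = sqrt u / u\<^sup>2" unfolding powr_diff using u by (simp add: powr_half_sqrt powr_numeral)
          finally show ?thesis by (simp only: mult_ac times_divide_eq_right)
        qed
        finally have "sqrt u * ?g \<le> (2 * sqrt Q) * u powr (- (1 / 2) - 1)" .
        moreover have "\<not> u < a" using 3 b(1) by (meson less_le_not_le order_trans)
        ultimately show ?thesis using G 3 by simp
      qed
    qed
    have "pi / cosh (pi * t) * wnorm (modular_gap t) \<le> y / 2 * (pi / sin (pi * \<bar>s\<bar>) * ?D) +
        (2 * a powr (1 / 2) / (1 / 2) + ?L / (2 * y) * ln (1 / a / a) + 2 * sqrt Q * (1 / a) powr (- (1 / 2)) / (1 / 2))"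
      by (rule wnorm_modular_gap_le[OF int le])
    also have "a powr (1 / 2) = sqrt a" using a by (simp add: powr_half_sqrt)
    also have "(1 / a) powr (- (1 / 2)) = sqrt a"
      using a by (simp add: powr_minus powr_divide powr_half_sqrt)
    also have "ln (1 / a / a) = 2 * ln (1 / a)" using a by (simp add: ln_div ln_mult)
    finally show ?thesis by (simp add: algebra_simps)
  qed
  moreover have "0 \<le> pi / sin (pi * \<bar>s\<bar>) * ?D" by (intro mult_nonneg_nonneg less_imp_le[OF sin]) simp
  moreover have "0 \<le> ?L * (2 * ln (1 / a))" using b(2) by simp
  ultimately have "pi / cosh (pi * t) * wnorm (modular_gap t) \<le> (4 * sqrt a + 4 * sqrt Q * sqrt a) +
      sqrt (pi / sin (pi * \<bar>s\<bar>) * ?D * (?L * (2 * ln (1 / a))))"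
    by (rule le_add_sqrt_of_weighted_am_gm)
  then show ?thesis by simp
qed

lemma wnorm_modular_gap_le_powr:
  fixes s \<epsilon> D :: real
  assumes s: "s \<in> {-1<..<0} \<union> {0<..<1}" and \<epsilon>: "0 < \<epsilon>" "\<epsilon> < (1 - \<bar>s\<bar>) / 2"
    and D: "D > 0" "cmod (Q_s \<tau> s \<rho> \<sigma> - Q_s \<tau> s \<rho>N \<sigma>N) \<le> D"
  shows "pi / cosh (pi * t) * wnorm (modular_gap t) \<le>
    (4 * sqrt Q + sqrt (pi / (exp 1 * \<epsilon> * sin (pi * \<bar>s\<bar>))) + 4) * D powr ((1 - \<bar>s\<bar>) / 2 - \<epsilon>)"
proof -
  let ?D = "cmod (Q_s \<tau> s \<rho> \<sigma> - Q_s \<tau> s \<rho>N \<sigma>N)"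
  let ?X = "pi / cosh (pi * t) * wnorm (modular_gap t)"
  define \<theta> where "\<theta> = (1 - \<bar>s\<bar>) / 2 - \<epsilon>"
  have \<theta>: "\<theta> > 0" using \<epsilon> by (simp add: \<theta>_def)
  have sin: "sin (pi * \<bar>s\<bar>) > 0" by (rule sin_pi_abs_pos[OF s])
  let ?R = "sqrt (pi / (exp 1 * \<epsilon> * sin (pi * \<bar>s\<bar>)))"
  have R: "?R \<ge> 0" using sin \<epsilon> by simp
  show ?thesis unfolding \<theta>_def[symmetric]
  proof (cases "D \<ge> 1")
    case True
    \<comment> \<open>At \<open>a = 1\<close> the logarithm vanishes and only the two end terms
      remain.\<close>
    have "?X \<le> 4 + 4 * sqrt Q" using wnorm_modular_gap_split[OF s, of 1 t] by simp
    also have "\<dots> \<le> (4 * sqrt Q + ?R + 4) * 1" using R by simp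
    also have "\<dots> \<le> (4 * sqrt Q + ?R + 4) * D powr \<theta>"
      using True \<theta> R Q_nonneg by (intro mult_left_mono ge_one_powr_ge_zero) auto
    finally show "?X \<le> (4 * sqrt Q + ?R + 4) * D powr \<theta>" .
  next
    case False
    \<comment> \<open>Chosen so that the end terms, of order \<open>sqrt a\<close>, have exactly the
      desired order \<open>D powr \<theta>\<close>.\<close>
    define a where "a = D powr (2 * \<theta>)"
    have a: "0 < a" "a \<le> 1" using D False \<theta> by (auto simp: a_def powr_le1)
    have sqrt_a: "sqrt a = D powr \<theta>"
      by (rule real_sqrt_unique) (simp_all add: a_def power2_eq_square flip: powr_add)
    \<comment> \<open>The power of \<open>D\<close> left over in the middle term after splitting off
      \<open>a = D powr (2 * \<theta>)\<close>; being positive, it can absorb the logarithm.\<close>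
    define \<delta> where "\<delta> = 1 - 2 * \<theta> * \<bar>s\<bar> - 2 * \<theta>"
    have \<delta>_eq: "\<delta> = \<bar>s\<bar> * \<bar>s\<bar> + 2 * \<epsilon> + 2 * \<epsilon> * \<bar>s\<bar>"
    proof -
      have "1 - 2 * ((1 - r) / 2 - \<epsilon>) * r - 2 * ((1 - r) / 2 - \<epsilon>) = r * r + 2 * \<epsilon> + 2 * \<epsilon> * r" for r
        by (simp add: field_simps)
      then show ?thesis unfolding \<delta>_def \<theta>_def .
    qed
    have ss: "0 \<le> \<bar>s\<bar> * \<bar>s\<bar>" "0 \<le> \<epsilon> * \<bar>s\<bar>" using \<epsilon> by simp_all
    have \<delta>: "\<delta> > 0" using \<delta>_eq ss \<epsilon> by linarith
    \<comment> \<open>With \<open>\<delta> \<ge> 2 * \<epsilon>\<close> this turns the factor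
      \<open>4 * \<theta> / \<delta>\<close> from the logarithm into the
      \<open>1 / \<epsilon>\<close> of the constant.\<close>
    have "4 * \<theta> * \<epsilon> \<le> 2 * \<epsilon>"
    proof -
      have "2 * \<theta> \<le> 1" using \<epsilon> abs_ge_zero[of s] unfolding \<theta>_def by argo
      then have "2 * \<epsilon> * (2 * \<theta>) \<le> 2 * \<epsilon> * 1" using \<epsilon> by (intro mult_left_mono) auto
      then show ?thesis by (simp add: mult_ac)
    qed
    then have key: "4 * \<theta> * \<epsilon> \<le> \<delta>" using \<delta>_eq ss by linarith
    have lna: "2 * ln (1 / a) = 4 * \<theta> * ln (1 / D)" using D by (simp add: a_def ln_div ln_powr)
    have "(1 / a) powr \<bar>s\<bar> = D powr (- 2 * \<theta> * \<bar>s\<bar>)"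
      using D by (simp add: a_def powr_divide powr_powr powr_minus_divide)
    then have "D * (1 / a) powr \<bar>s\<bar> = D powr (1 + (- 2 * \<theta> * \<bar>s\<bar>))" using D by (simp only: powr_add) simp
    also have "1 + (- 2 * \<theta> * \<bar>s\<bar>) = 2 * \<theta> + \<delta>" by (simp add: \<delta>_def)
    finally have DL: "D * (1 / a) powr \<bar>s\<bar> = a * D powr \<delta>" by (simp add: powr_add a_def)
    have ln_nonneg: "ln (1 / D) \<ge> 0" using D False by simp
    have "?D * ((1 / a) powr \<bar>s\<bar> * (2 * ln (1 / a))) \<le> D * ((1 / a) powr \<bar>s\<bar> * (2 * ln (1 / a)))"
      using D a by (intro mult_right_mono) auto
    also have "\<dots> = a * (4 * \<theta> * (D powr \<delta> * ln (1 / D)))"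
      unfolding lna mult.assoc[symmetric] DL by (simp add: mult_ac)
    also have "\<dots> \<le> a * (4 * \<theta> * (1 / (exp 1 * \<delta>)))"
      using a \<theta> \<delta> D by (intro mult_left_mono powr_mult_ln_le) auto
    also have "\<dots> \<le> a * (1 / (exp 1 * \<epsilon>))"
      using a key \<epsilon> \<delta> by (intro mult_left_mono) (auto simp: field_simps)
    finally have "pi / sin (pi * \<bar>s\<bar>) * (?D * ((1 / a) powr \<bar>s\<bar> * (2 * ln (1 / a)))) \<le>
        pi / sin (pi * \<bar>s\<bar>) * (a * (1 / (exp 1 * \<epsilon>)))"
      using sin by (intro mult_left_mono) auto
    also have "\<dots> = pi / (exp 1 * \<epsilon> * sin (pi * \<bar>s\<bar>)) * a" by simp
    finally have "sqrt (pi / sin (pi * \<bar>s\<bar>) * ?D * ((1 / a) powr \<bar>s\<bar> * (2 * ln (1 / a)))) \<le> sqrt (pi / (exp 1 * \<epsilon> * sin (pi * \<bar>s\<bar>)) * a)"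
      by (intro real_sqrt_le_mono) (simp only: mult.assoc)
    also have "\<dots> = ?R * D powr \<theta>" by (simp only: real_sqrt_mult sqrt_a)
    finally have "?X \<le> 4 * D powr \<theta> + 4 * sqrt Q * D powr \<theta> + ?R * D powr \<theta>"
      using wnorm_modular_gap_split[OF s a, of t] unfolding sqrt_a by linarith
    then show "?X \<le> (4 * sqrt Q + ?R + 4) * D powr \<theta>" by (simp only: distrib_right)
  qed
qed

end

section \<open>Recovery maps\<close>

context traced_algebra
begin

text \<open>Raising the final inequalities to the power \<open>1 / \<theta>\<close> requires a
  nonnegative base.\<close>

lemma norm1_nonneg:
  assumes "X \<in> M" "hermitian X"
  shows "norm1 \<tau> X \<ge> 0"
proof -
  let ?h = "mfun (\<lambda>x. of_real (sqrt \<bar>Re x\<bar>)) X"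
  have "?h \<in> M" using mfun_closed assms by blast
  moreover have "cadj ?h ** ?h = mabs X"
    unfolding cadj_mfun[OF assms(2)] mfun_mult[OF assms(2)] mabs_hermitian[OF assms(2)]
    by (rule mfun_cong[OF assms(2)]) (simp flip: of_real_mult)
  ultimately show ?thesis using trace_nonneg[of ?h] by (simp add: norm1_def)
qed

lemma sign_unitary:
  assumes X: "X \<in> M" "hermitian X"
  shows "\<exists>S\<in>M. cadj S = S \<and> S ** S = mat 1 \<and> norm1 \<tau> X = Re (\<tau> (S ** X))"
proof -
  \<comment> \<open>The sign at 0 is set to 1, so that \<open>S\<close> is unitary even for singular
    \<open>X\<close>.\<close>
  define S where "S = mfun (\<lambda>x. if Re x < 0 then -1 else 1) X"
  have "S ** X = S ** mfun (\<lambda>x. x) X" by (simp add: mfun_ident[OF X(2)])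
  also have "\<dots> = mabs X"
    unfolding S_def mfun_mult[OF X(2)] mabs_hermitian[OF X(2)] by (rule mfun_cong[OF X(2)]) auto
  finally have "S ** X = mabs X" .
  moreover have "S \<in> M" unfolding S_def using mfun_closed X by blast
  moreover have "cadj S = S" unfolding S_def cadj_mfun[OF X(2)] by (rule mfun_cong[OF X(2)]) auto
  moreover have "S ** S = mfun (\<lambda>x. 1) X" unfolding S_def mfun_mult[OF X(2)] by (rule mfun_cong[OF X(2)]) auto
  moreover have "mfun (\<lambda>x. 1) X = mat 1" by (simp add: mfun_const[OF X(2)])
  ultimately show ?thesis by (intro bexI[of _ S]) (auto simp: norm1_def)
qed

text \<open>The difference is \<open>cadj v ** (v - w) + cadj (v - w) ** w\<close>; Cauchy-Schwarz
  applies to each summand, and \<open>S\<close> disappears because right multiplication by it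
  preserves \<open>norm2\<close>.\<close>

lemma trace_sign_diff_le:
  assumes S: "S \<in> M" "cadj S = S" "S ** S = mat 1" and v: "v \<in> M" and w: "w \<in> M"
  shows "Re (\<tau> (S ** (cadj v ** v - cadj w ** w))) \<le> (norm2 v + norm2 w) * norm2 (v - w)"
proof -
  have n: "norm2 (x ** S) = norm2 x" if "x \<in> M" for x
  proof -
    have "\<tau> (cadj (x ** S) ** (x ** S)) = \<tau> (S ** (cadj x ** x ** S))"
      by (simp add: S(2) matrix_mul_assoc)
    also have "\<dots> = \<tau> ((cadj x ** x ** S) ** S)" using S that by (intro trace_commute) auto
    also have "(cadj x ** x ** S) ** S = cadj x ** x" by (simp add: S(3) flip: matrix_mul_assoc)
    finally show ?thesis by (simp add: norm2_def)
  qed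
  have "S ** (cadj v ** v - cadj w ** w) = cadj (v ** S) ** (v - w) + S ** (cadj (v - w) ** w)"
    by (simp add: S(2) mat_mult_diff mat_diff_mult matrix_mul_assoc)
  also have "\<tau> \<dots> = \<tau> (cadj (v ** S) ** (v - w)) + \<tau> (S ** (cadj (v - w) ** w))"
    using S v w by (intro trace_add) auto
  also have "\<tau> (S ** (cadj (v - w) ** w)) = \<tau> ((cadj (v - w) ** w) ** S)"
    using S v w by (intro trace_commute) auto
  also have "(cadj (v - w) ** w) ** S = cadj (v - w) ** (w ** S)" by (simp only: matrix_mul_assoc)
  finally have "Re (\<tau> (S ** (cadj v ** v - cadj w ** w))) =
      Re (\<tau> (cadj (v ** S) ** (v - w))) + Re (\<tau> (cadj (v - w) ** (w ** S)))" by simp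
  also have "\<dots> \<le> cmod (\<tau> (cadj (v ** S) ** (v - w))) + cmod (\<tau> (cadj (v - w) ** (w ** S)))"
    by (intro add_mono complex_Re_le_cmod)
  also have "\<dots> \<le> norm2 (v ** S) * norm2 (v - w) + norm2 (v - w) * norm2 (w ** S)"
    using S v w by (intro add_mono trace_cauchy_schwarz) auto
  also have "\<dots> = (norm2 v + norm2 w) * norm2 (v - w)" by (simp add: n v w algebra_simps)
  finally show ?thesis .
qed

end

context recovery
begin

text \<open>The imaginary part of the exponent contributes only a unitary factor, so the rotation by
  \<open>t\<close> is invisible in the norm.\<close>

lemma norm2_mult_mpow_sigma:
  assumes x: "x \<in> M" and z: "Re z = 1 / 2"
  shows "norm2 (x ** mpow \<sigma> z) = wnorm x"
proof -
  let ?h = "mpow \<sigma> z"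
  have h: "?h \<in> M" "cadj ?h = mpow \<sigma> (cnj z)" using mpow_closed sigma cadj_mpow by auto
  have "z + cnj z = 1" using z by (simp add: complex_eq_iff)
  then have hh: "?h ** cadj ?h = \<sigma>" using mpow_mult[OF sigma(1)] mpow_one[OF sigma(1)] h(2) by simp
  have "\<tau> (cadj (x ** ?h) ** (x ** ?h)) = \<tau> (cadj ?h ** (cadj x ** x ** ?h))" by (simp add: matrix_mul_assoc)
  also have "\<dots> = \<tau> ((cadj x ** x ** ?h) ** cadj ?h)" using x h(1) by (intro trace_commute) auto
  also have "(cadj x ** x ** ?h) ** cadj ?h = cadj x ** x ** \<sigma>" by (simp only: hh flip: matrix_mul_assoc)
  finally have "complex_of_real ((norm2 (x ** ?h))\<^sup>2) = of_real ((wnorm x)\<^sup>2)"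
    using wnorm_square[OF x] norm2_square_of_real[of "x ** ?h"] x h(1) by (simp add: mult_closed)
  then have "(norm2 (x ** ?h))\<^sup>2 = (wnorm x)\<^sup>2" by (simp only: of_real_eq_iff)
  then show ?thesis using norm2_nonneg[of "x ** ?h"] wnorm_nonneg[OF x] x h(1) by (simp add: mult_closed)
qed

definition recovered :: "real \<Rightarrow> 'n cmat" where
  "recovered t = petz_rot N \<tau> \<sigma> t \<rho>N"

lemma recovered_eq:
  fixes t :: real
  defines "z \<equiv> 1 / 2 + \<i> * of_real t"
  shows "recovered t = mpow \<sigma> (cnj z) ** mpow \<sigma>N (- cnj z) ** \<rho>N ** mpow \<sigma>N (- z) ** mpow \<sigma> z"
proof -
  have z: "cnj z = 1 / 2 - \<i> * of_real t" "- z = - 1 / 2 - \<i> * of_real t" by (simp_all add: z_def)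
  have nz: "- cnj z = - 1 / 2 + \<i> * of_real t" by (simp add: z_def)
  show ?thesis unfolding recovered_def petz_rot_def Let_def nz unfolding z unfolding z_def ..
qed

text \<open>Splitting the central \<open>\<rho>N\<close> as
  \<open>mpow \<rho>N (cnj z) ** mpow \<rho>N z\<close> exhibits the recovered state as an explicit
  square, to be compared with that of \<rho>.\<close>

lemma recovered_factorization:
  fixes t :: real
  defines "z \<equiv> 1 / 2 + \<i> * of_real t"
  shows "recovered t = cadj (mpow \<rho>N z ** mpow \<sigma>N (- z) ** mpow \<sigma> z) ** (mpow \<rho>N z ** mpow \<sigma>N (- z) ** mpow \<sigma> z)"
proof -
  have "z + cnj z = 1" by (simp add: z_def)
  then have r: "\<rho>N = mpow \<rho>N (cnj z) ** mpow \<rho>N z"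
    using mpow_mult[OF rhoN(1)] mpow_one[OF rhoN(1)] by (simp add: add.commute)
  have "recovered t = mpow \<sigma> (cnj z) ** mpow \<sigma>N (- cnj z) ** (mpow \<rho>N (cnj z) ** mpow \<rho>N z) ** mpow \<sigma>N (- z) ** mpow \<sigma> z"
    unfolding r[symmetric] unfolding z_def by (rule recovered_eq)
  then show ?thesis by (simp add: cadj_mpow[OF rhoN(1)] cadj_mpow[OF sigmaN(1)] cadj_mpow[OF sigma(1)] matrix_mul_assoc)
qed

lemma recovered_closed: "recovered t \<in> M"
  unfolding recovered_factorization using mpow_closed rhoN sigmaN sigma by (intro mult_closed cadj_closed) auto

lemma recovered_hermitian: "hermitian (recovered t)"
  unfolding recovered_factorization hermitian_def by (simp add: matrix_mul_assoc)

text \<open>With \<open>v = Y ** mpow \<sigma> z\<close> and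
  \<open>w = YN ** mpow \<sigma> z\<close>, \<rho> and the recovered state are the squares of
  \<open>v\<close> and \<open>w\<close>, whose difference is the modular gap times
  \<open>mpow \<sigma> z\<close>. Both have norm 1, as the first moments are 1. Keeping
  \<open>S\<close> arbitrary allows integration over \<open>t\<close> with one fixed
  \<open>S\<close>.\<close>

lemma trace_sign_recovery_error_le:
  assumes S: "S \<in> M" "cadj S = S" "S ** S = mat 1"
  shows "Re (\<tau> (S ** (\<rho> - recovered t))) \<le> 2 * wnorm (modular_gap t)"
proof -
  define z where "z = 1 / 2 + \<i> * complex_of_real t"
  define Y where "Y = mpow \<rho> z ** mpow \<sigma> (- z)"
  define YN where "YN = mpow \<rho>N z ** mpow \<sigma>N (- z)"
  have M: "Y \<in> M" "YN \<in> M" "mpow \<sigma> z \<in> M" "mpow \<rho> z \<in> M"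
    using mpow_closed rho sigma rhoN sigmaN by (auto simp: Y_def YN_def)
  have z: "Re z = 1 / 2" by (simp add: z_def)
  have "z + cnj z = 1" using z by (simp add: complex_eq_iff)
  then have "cadj (mpow \<rho> z) ** mpow \<rho> z = \<rho>"
    using mpow_mult[OF rho(1)] mpow_one[OF rho(1)] cadj_mpow[OF rho(1)] by (simp add: add.commute)
  moreover have Ys: "Y ** mpow \<sigma> z = mpow \<rho> z"
    using mpow_mult[OF sigma(1), of "- z" z] mpow_zero[OF sigma(1)]
    by (simp add: Y_def flip: matrix_mul_assoc)
  ultimately have rho_eq: "\<rho> = cadj (Y ** mpow \<sigma> z) ** (Y ** mpow \<sigma> z)" by simp
  have rec_eq: "recovered t = cadj (YN ** mpow \<sigma> z) ** (YN ** mpow \<sigma> z)"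
    unfolding recovered_factorization YN_def z_def ..
  have p: "(cmod (complex_of_real r powr z))\<^sup>2 = r" if "r > 0" for r
  proof -
    have "cmod (complex_of_real r powr z) = r powr Re z" using that by (simp add: norm_powr_real_powr)
    then show ?thesis unfolding z using that by (simp add: powr_half_sqrt)
  qed
  have "(wnorm Y)\<^sup>2 = 1"
    unfolding Y_def mpow_mult_mpow_minus[OF rho(1) sigma(1)] wnorm_J pairs(5)[symmetric]
    by (intro sum.cong refl) (simp only: p[OF pairs(2)] mult.commute)
  then have wY: "wnorm Y = 1" using wnorm_nonneg[OF M(1)] by (simp add: power2_eq_1_iff)
  have "(wnorm YN)\<^sup>2 = 1"
    unfolding YN_def mpow_mult_mpow_minus[OF rhoN(1) sigmaN(1)] wnorm_JN pairsN(5)[symmetric]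
    by (intro sum.cong refl) (simp only: p[OF pairsN(2)] mult.commute)
  then have wYN: "wnorm YN = 1" using wnorm_nonneg[OF M(2)] by (simp add: power2_eq_1_iff)
  have "Re (\<tau> (S ** (\<rho> - recovered t))) \<le>
      (norm2 (Y ** mpow \<sigma> z) + norm2 (YN ** mpow \<sigma> z)) * norm2 (Y ** mpow \<sigma> z - YN ** mpow \<sigma> z)"
    unfolding rec_eq by (subst rho_eq) (use S M in \<open>intro trace_sign_diff_le; auto\<close>)
  also have "Y ** mpow \<sigma> z - YN ** mpow \<sigma> z = modular_gap t ** mpow \<sigma> z"
    by (simp add: modular_gap_def Y_def YN_def z_def mat_diff_mult)
  also have "(norm2 (Y ** mpow \<sigma> z) + norm2 (YN ** mpow \<sigma> z)) * norm2 (modular_gap t ** mpow \<sigma> z) =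
      2 * wnorm (modular_gap t)"
    using M modular_gap_closed by (simp only: norm2_mult_mpow_sigma z wY wYN) simp
  finally show ?thesis .
qed

lemma norm1_recovery_error_le: "norm1 \<tau> (\<rho> - recovered t) \<le> 2 * wnorm (modular_gap t)"
proof -
  have "\<rho> - recovered t \<in> M" using rho(2) recovered_closed by auto
  moreover have "hermitian (\<rho> - recovered t)"
    using recovered_hermitian[of t] posdef_hermitian[OF rho(1)] by (simp add: hermitian_def)
  ultimately obtain S where "S \<in> M" "cadj S = S" "S ** S = mat 1"
    "norm1 \<tau> (\<rho> - recovered t) = Re (\<tau> (S ** (\<rho> - recovered t)))"
    using sign_unitary by blast
  then show ?thesis using trace_sign_recovery_error_le by simp
qed

text \<open>Spectral decomposition moves all dependence on \<open>t\<close> into finitely many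
  bounded continuous scalars, with fixed matrices from \<open>M\<close>; the matrix integral thereby
  reduces to scalar ones.\<close>

lemma recovered_spectral:
  "\<exists>(I :: ((real \<times> real) \<times> (real \<times> real)) set) k X C. finite I \<and> (\<forall>i\<in>I. X i \<in> M) \<and>
     (\<forall>t. recovered t = (\<Sum>i\<in>I. cscale (k i t) (X i))) \<and>
     (\<forall>i\<in>I. continuous_on UNIV (k i) \<and> (\<forall>t. cmod (k i t) \<le> C i))"
proof -
  let ?I = "spectrum_pairs \<sigma> \<sigma>N" and ?F = "pairproj \<sigma> \<sigma>N"
  define f where "f = (\<lambda>t i. complex_of_real (fst i) powr (1 / 2 - \<i> * of_real t) * of_real (snd i) powr (- 1 / 2 + \<i> * of_real t))"
  define k where "k = (\<lambda>(i, j) t. f t i * cnj (f t j))"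
  define X where "X = (\<lambda>(i, j). ?F i ** \<rho>N ** cadj (?F j))"
  define C where "C = (\<lambda>(i, j). (fst i powr (1 / 2) * snd i powr (- 1 / 2)) * (fst j powr (1 / 2) * snd j powr (- 1 / 2)) :: real)"
  have pos: "fst i > 0 \<and> snd i > 0" if "i \<in> ?I" for i
    using spectrum_pairs_pos[OF sigma(1) sigmaN(1) that] by simp
  have fin: "finite ?I" using finite_spectrum_pairs sigma sigmaN by blast
  have F: "?F i \<in> M" for i using pairproj_closed sigma sigmaN by blast
  have rec: "recovered t = (\<Sum>i\<in>?I \<times> ?I. cscale (k i t) (X i))" for t
  proof -
    define z where "z = 1 / 2 + \<i> * complex_of_real t"
    have cz: "cnj z = 1 / 2 - \<i> * of_real t" by (simp add: z_def)
    have A: "mpow \<sigma> (cnj z) ** mpow \<sigma>N (- cnj z) = joint \<sigma> \<sigma>N (f t)"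
      unfolding mpow_mult_mpow[OF sigma(1) sigmaN(1)] by (simp add: f_def cz)
    have "recovered t = (mpow \<sigma> (cnj z) ** mpow \<sigma>N (- cnj z)) ** \<rho>N ** cadj (mpow \<sigma> (cnj z) ** mpow \<sigma>N (- cnj z))"
      unfolding recovered_eq[of t, folded z_def]
      by (simp add: cadj_mpow[OF sigma(1)] cadj_mpow[OF sigmaN(1)] matrix_mul_assoc)
    also have "\<dots> = (\<Sum>j\<in>?I. \<Sum>i\<in>?I. cscale (f t i * cnj (f t j)) (?F i ** \<rho>N ** cadj (?F j)))"
      unfolding A by (simp add: joint_def cadj_sum mat_mult_sum sum_mat_mult cscale_sum mult.commute)
    also have "\<dots> = (\<Sum>i\<in>?I. \<Sum>j\<in>?I. cscale (f t i * cnj (f t j)) (?F i ** \<rho>N ** cadj (?F j)))"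
      by (rule sum.swap)
    also have "\<dots> = (\<Sum>i\<in>?I \<times> ?I. cscale (k i t) (X i))"
      by (simp add: sum.cartesian_product split_def k_def X_def)
    finally show ?thesis .
  qed
  have "continuous_on UNIV (k i) \<and> (\<forall>t. cmod (k i t) \<le> C i)" if i: "i \<in> ?I \<times> ?I" for i
  proof -
    obtain a b where ab: "i = (a, b)" "a \<in> ?I" "b \<in> ?I" using i by auto
    have cont: "continuous_on UNIV (\<lambda>t. f t a)" if "a \<in> ?I" for a
      unfolding f_def using pos[OF that] by (intro continuous_intros) (auto simp: complex_nonpos_Reals_iff)
    have norm: "cmod (f t a) = fst a powr (1 / 2) * snd a powr (- 1 / 2)" if "a \<in> ?I" for t a
      unfolding f_def using pos[OF that] by (simp add: norm_mult norm_powr_real_powr)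
    show ?thesis using cont[OF ab(2)] cont[OF ab(3)] norm[OF ab(2)] norm[OF ab(3)]
      unfolding ab(1) k_def C_def by (auto intro!: continuous_intros simp: norm_mult)
  qed
  moreover have "X i \<in> M" if "i \<in> ?I \<times> ?I" for i
    using that F rhoN(3) by (auto simp: X_def)
  ultimately show ?thesis using fin rec by (intro exI[of _ "?I \<times> ?I"] exI[of _ k] exI[of _ X] exI[of _ C]) auto
qed

text \<open>The finite expansion shows that the averaged state lies in \<open>M\<close> and lets
  \<tau>, linear on \<open>M\<close> only, pass under the integral.\<close>

lemma petz_univ_properties:
  obtains R where "petz_univ N \<tau> \<sigma> \<rho>N = R" "R \<in> M" "hermitian R"
    "\<forall>S\<in>M. ((\<lambda>t. of_real (logistic t) * \<tau> (S ** recovered (t / 2))) has_integral \<tau> (S ** R)) UNIV"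
proof -
  obtain I :: "((real \<times> real) \<times> (real \<times> real)) set" and k X C where
    I: "finite I" "\<And>i. i \<in> I \<Longrightarrow> X i \<in> M" "\<And>t. recovered t = (\<Sum>i\<in>I. cscale (k i t) (X i))"
      "\<And>i. i \<in> I \<Longrightarrow> continuous_on UNIV (k i)" "\<And>i t. i \<in> I \<Longrightarrow> cmod (k i t) \<le> C i"
    using recovered_spectral by blast
  define c where "c = (\<lambda>i. integral UNIV (\<lambda>t. complex_of_real (logistic t) * k i (t / 2)))"
  define R where "R = (\<Sum>i\<in>I. cscale (c i) (X i))"
  have c: "((\<lambda>t. complex_of_real (logistic t) * k i (t / 2)) has_integral c i) UNIV" if "i \<in> I" for i
    unfolding c_def
  proof (intro integrable_integral integrable_logistic_mult)
    show "continuous_on UNIV (\<lambda>t. k i (t / 2))"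
      by (rule continuous_on_compose2[OF I(4)[OF that]]) (auto intro!: continuous_intros)
    show "cmod (k i (t / 2)) \<le> C i" for t using I(5) that by blast
  qed
  have eq: "logistic t *\<^sub>R recovered (t / 2) = (\<Sum>i\<in>I. cscale (complex_of_real (logistic t) * k i (t / 2)) (X i))" for t
    by (simp only: scaleR_eq_cscale I(3) cscale_sum cscale_simps)
  have int: "((\<lambda>t. logistic t *\<^sub>R recovered (t / 2)) has_integral R) UNIV"
    unfolding R_def eq
    by (intro has_integral_sum I(1) has_integral_linear[OF c bounded_linear_cscale, unfolded o_def])
  have "petz_univ N \<tau> \<sigma> \<rho>N = R"
    using int unfolding petz_univ_def recovered_def by (rule integral_unique)
  moreover have "R \<in> M" unfolding R_def by (intro sum_closed cscale_closed I(2))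
  moreover have "hermitian R"
  proof -
    have "((\<lambda>t. cadj (logistic t *\<^sub>R recovered (t / 2))) has_integral cadj R) UNIV"
      using has_integral_linear[OF int bounded_linear_cadj] by (simp only: o_def)
    moreover have "cadj (logistic t *\<^sub>R recovered (t / 2)) = logistic t *\<^sub>R recovered (t / 2)" for t
      using recovered_hermitian[of "t / 2"] by (simp add: hermitian_def scaleR_eq_cscale del: of_real_divide)
    ultimately have "((\<lambda>t. logistic t *\<^sub>R recovered (t / 2)) has_integral cadj R) UNIV" by (simp only:)
    then show ?thesis unfolding hermitian_def by (rule has_integral_unique[OF _ int])
  qed
  moreover have "((\<lambda>t. of_real (logistic t) * \<tau> (S ** recovered (t / 2))) has_integral \<tau> (S ** R)) UNIV" if S: "S \<in> M" for S
  proof -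
    have "((\<lambda>t. \<Sum>i\<in>I. complex_of_real (logistic t) * k i (t / 2) * \<tau> (S ** X i)) has_integral (\<Sum>i\<in>I. c i * \<tau> (S ** X i))) UNIV"
      by (intro has_integral_sum I(1) has_integral_mult_left c)
    moreover have "(\<Sum>i\<in>I. c i * \<tau> (S ** X i)) = \<tau> (S ** R)"
      using S I(2) by (simp add: R_def mat_mult_sum trace_sum trace_cscale mult_closed cscale_closed)
    moreover have "(\<Sum>i\<in>I. complex_of_real (logistic t) * k i (t / 2) * \<tau> (S ** X i)) = of_real (logistic t) * \<tau> (S ** recovered (t / 2))" for t
      using S I(2) by (simp add: I(3) mat_mult_sum trace_sum trace_cscale mult_closed cscale_closed sum_distrib_left mult.assoc)
    ultimately show ?thesis by simp
  qed
  ultimately show ?thesis using that by blast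
qed

text \<open>The sign \<open>S\<close> of the averaged error attains its trace norm and is tested
  against the rotated error for every \<open>t\<close>; the assumed bound then only has to be
  integrated against a density of mass 1.\<close>

lemma norm1_universal_recovery_error_le:
  assumes B: "\<And>t. pi / cosh (pi * t) * wnorm (modular_gap t) \<le> B"
  shows "norm1 \<tau> (\<rho> - petz_univ N \<tau> \<sigma> \<rho>N) \<le> B"
proof -
  obtain R where R: "petz_univ N \<tau> \<sigma> \<rho>N = R" "R \<in> M" "hermitian R"
    and int: "\<forall>S\<in>M. ((\<lambda>t. of_real (logistic t) * \<tau> (S ** recovered (t / 2))) has_integral \<tau> (S ** R)) UNIV"
    by (rule petz_univ_properties)
  have "\<rho> - R \<in> M" "hermitian (\<rho> - R)"
    using R rho(2) posdef_hermitian[OF rho(1)] by (auto simp: hermitian_def)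
  then obtain S where S: "S \<in> M" "cadj S = S" "S ** S = mat 1" "norm1 \<tau> (\<rho> - R) = Re (\<tau> (S ** (\<rho> - R)))"
    using sign_unitary by blast
  have split: "\<tau> (S ** (\<rho> - Y)) = \<tau> (S ** \<rho>) - \<tau> (S ** Y)" if "Y \<in> M" for Y
    using S(1) rho(2) that by (simp add: mat_mult_diff trace_diff mult_closed)
  have "((\<lambda>t. Re (of_real (logistic t) * \<tau> (S ** recovered (t / 2)))) has_integral Re (\<tau> (S ** R))) UNIV"
    using has_integral_linear[OF bspec[OF int S(1)] bounded_linear_Re] by (simp only: o_def)
  moreover have "((\<lambda>t. logistic t * Re (\<tau> (S ** \<rho>))) has_integral 1 * Re (\<tau> (S ** \<rho>))) UNIV"
    by (intro has_integral_mult_left has_integral_logistic_density)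
  ultimately have "((\<lambda>t. logistic t * Re (\<tau> (S ** \<rho>)) - Re (of_real (logistic t) * \<tau> (S ** recovered (t / 2)))) has_integral
      (1 * Re (\<tau> (S ** \<rho>)) - Re (\<tau> (S ** R)))) UNIV" by (rule has_integral_diff[rotated])
  then have "((\<lambda>t. logistic t * Re (\<tau> (S ** (\<rho> - recovered (t / 2))))) has_integral norm1 \<tau> (\<rho> - R)) UNIV"
    unfolding S(4) split[OF R(2)] split[OF recovered_closed]
    by (simp del: of_real_divide add: right_diff_distrib)
  moreover have "((\<lambda>t. 1 / (2 * cosh (pi * t / 2)) * B) has_integral 1 * B) UNIV"
    by (intro has_integral_mult_left has_integral_half_sech)
  ultimately have "norm1 \<tau> (\<rho> - R) \<le> 1 * B"
  proof (rule has_integral_le)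
    fix t :: real
    define c where "c = cosh (pi * t / 2)"
    have c: "c > 0" by (simp add: c_def)
    \<comment> \<open>The duplication formula writes the logistic density as
      \<open>pi / (4 c^2)\<close>. One factor \<open>pi / c\<close> belongs to the bound at
      \<open>t / 2\<close>, and the doubled error leaves \<open>1 / (2 c)\<close>.\<close>
    have "cosh (pi * t) = 2 * c\<^sup>2 - 1"
      using cosh_double[of "pi * t / 2"] cosh_square_eq[of "pi * t / 2"] by (simp add: c_def)
    then have l: "logistic t = pi / (4 * c\<^sup>2)" by simp
    have "logistic t * Re (\<tau> (S ** (\<rho> - recovered (t / 2)))) \<le> logistic t * (2 * wnorm (modular_gap (t / 2)))"
      using trace_sign_recovery_error_le[OF S(1-3)] c unfolding l by (intro mult_left_mono) auto
    also have "\<dots> = 1 / (2 * c) * (pi / c * wnorm (modular_gap (t / 2)))"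
      unfolding l using c by (simp add: power2_eq_square)
    also have "\<dots> \<le> 1 / (2 * c) * B" using B[of "t / 2"] c by (intro mult_left_mono) (auto simp: c_def)
    finally show "logistic t * Re (\<tau> (S ** (\<rho> - recovered (t / 2)))) \<le> 1 / (2 * cosh (pi * t / 2)) * B"
      by (simp only: c_def)
  qed
  then show ?thesis using R(1) by simp
qed

end

theorem theorem4p15:
  fixes M N :: "('n::finite) cmat set" and \<tau> :: "'n cmat \<Rightarrow> complex"
    and \<rho> \<sigma> :: "'n cmat" and s t \<epsilon> :: real
  assumes "star_subalg M" and "star_subalg N" and "N \<subseteq> M"
    and "faithful_trace M \<tau>"
    and "faithful_state M \<tau> \<rho>" and "faithful_state M \<tau> \<sigma>"
    and "s \<in> {-1<..<0} \<union> {0<..<1}"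
    and "0 < \<epsilon>" and "\<epsilon> < (1 - \<bar>s\<bar>) / 2"
  defines "K \<equiv> 1 / (4 * sqrt (Re (Q_inv \<tau> \<rho> \<sigma>))
                    + sqrt (pi / (exp 1 * \<epsilon> * sin (pi * \<bar>s\<bar>))) + 4)"
    and "\<rho>N \<equiv> cond_exp N \<tau> \<rho>"
    and "a \<equiv> 1 / ((1 - \<bar>s\<bar>) / 2 - \<epsilon>)"
    and "D \<equiv> cmod (Q_s \<tau> s \<rho> \<sigma> - Q_s \<tau> s (cond_exp N \<tau> \<rho>) (cond_exp N \<tau> \<sigma>))"
  shows "D \<ge> (K * (pi / 2) * norm1 \<tau> (\<rho> - petz_rot N \<tau> \<sigma> 0 \<rho>N)) powr a \<and>
         D \<ge> (K * (pi / (2 * cosh (pi * t))) * norm1 \<tau> (\<rho> - petz_rot N \<tau> \<sigma> t \<rho>N)) powr a \<and>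
         D \<ge> (K * norm1 \<tau> (\<rho> - petz_univ N \<tau> \<sigma> \<rho>N)) powr a"
proof -
  interpret recovery M N \<tau> \<rho> \<sigma>
    using assms(1-6) by unfold_locales auto
  define \<theta> where "\<theta> = (1 - \<bar>s\<bar>) / 2 - \<epsilon>"
  have \<theta>: "\<theta> > 0" using assms(9) by (simp add: \<theta>_def)
  have D: "D \<ge> 0" by (simp add: D_def)
  define k where "k = 4 * sqrt Q + sqrt (pi / (exp 1 * \<epsilon> * sin (pi * \<bar>s\<bar>))) + 4"
  have "sin (pi * \<bar>s\<bar>) > 0" by (rule sin_pi_abs_pos[OF assms(7)])
  then have "sqrt (pi / (exp 1 * \<epsilon> * sin (pi * \<bar>s\<bar>))) \<ge> 0" using assms(8) by simp
  moreover have "sqrt Q \<ge> 0" using Q_nonneg by simp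
  ultimately have k: "k > 0" unfolding k_def by linarith
  have K: "K = 1 / k" "K > 0" using k by (simp_all add: K_def k_def)
  have main: "K * (pi / cosh (pi * t) * wnorm (modular_gap t)) \<le> D powr \<theta>" for t
  proof (rule le_powr_of_forall_gt[OF _ D \<theta>])
    fix D' assume "D' > 0" "D \<le> D'"
    then have "pi / cosh (pi * t) * wnorm (modular_gap t) \<le> k * D' powr \<theta>"
      unfolding \<theta>_def D_def k_def by (intro wnorm_modular_gap_le_powr assms)
    then show "K * (pi / cosh (pi * t) * wnorm (modular_gap t)) \<le> D' powr \<theta>"
      unfolding K(1) using k by (simp add: divide_le_eq mult_ac)
  qed
  have rot: "D \<ge> (K * (pi / (2 * cosh (pi * t))) * norm1 \<tau> (\<rho> - petz_rot N \<tau> \<sigma> t \<rho>N)) powr a" for t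
  proof -
    let ?n = "norm1 \<tau> (\<rho> - recovered t)"
    have cosh: "cosh (pi * t) > 0" by (rule cosh_real_pos)
    have "?n \<ge> 0" using rho(2) recovered_closed recovered_hermitian[of t] posdef_hermitian[OF rho(1)]
      by (intro norm1_nonneg) (auto simp: hermitian_def)
    have "K * (pi / (2 * cosh (pi * t))) * ?n \<le> K * (pi / (2 * cosh (pi * t))) * (2 * wnorm (modular_gap t))"
      using K(2) cosh by (intro mult_left_mono norm1_recovery_error_le) auto
    also have "\<dots> = K * (pi / cosh (pi * t) * wnorm (modular_gap t))" by simp
    also have "\<dots> \<le> D powr \<theta>" by (rule main)
    finally have "(K * (pi / (2 * cosh (pi * t))) * ?n) powr (1 / \<theta>) \<le> D"
      using K(2) cosh \<open>?n \<ge> 0\<close> by (intro powr_le_of_le_powr D \<theta>) auto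
    then show ?thesis by (simp add: a_def \<theta>_def recovered_def \<rho>N_def)
  qed
  have univ: "D \<ge> (K * norm1 \<tau> (\<rho> - petz_univ N \<tau> \<sigma> \<rho>N)) powr a"
  proof -
    let ?n = "norm1 \<tau> (\<rho> - petz_univ N \<tau> \<sigma> (E \<rho>))"
    obtain R where R: "petz_univ N \<tau> \<sigma> (E \<rho>) = R" "R \<in> M" "hermitian R"
      using petz_univ_properties by metis
    have "?n \<ge> 0" unfolding R(1) using rho(2) R posdef_hermitian[OF rho(1)]
      by (intro norm1_nonneg) (auto simp: hermitian_def)
    \<comment> \<open>The right-hand side is free of \<open>t\<close>, as the averaged estimate
      demands.\<close>
    have "pi / cosh (pi * t) * wnorm (modular_gap t) \<le> D powr \<theta> / K" for t
      using main[of t] K(2) by (simp add: field_simps)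
    then have "?n \<le> D powr \<theta> / K" by (rule norm1_universal_recovery_error_le)
    then have "K * ?n \<le> D powr \<theta>" using K(2) by (simp add: field_simps)
    then have "(K * ?n) powr (1 / \<theta>) \<le> D"
      using K(2) \<open>?n \<ge> 0\<close> by (intro powr_le_of_le_powr D \<theta>) auto
    then show ?thesis by (simp add: a_def \<theta>_def \<rho>N_def)
  qed
  show ?thesis using rot[of 0] rot[of t] univ by simp
qed

end
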